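(* Let $M$ and $N$ be $C^{\infty}$ manifolds (possibly with boundary), and let $k\in\mathbb{N}\cup\{0\}$. Then the subset $\mathrm{Emb}^{k,1}(M,N)$ is open in $C^{k,1}(M,N)$ (with the strong topology).
   Context: Let $m=\dim M$, $n=\dim N$. Charts of $M$ are smooth maps $\varphi:U\to M$ with $U$ open in $\mathbb{H}^m:=\{x\in\mathbb{R}^m:x_1\ge0\}$, and similarly for $N$. $C^{k,1}(M,N)$ is the set of $C^k$ maps $M\to N$ whose $k$-th order derivative is locally Lipschitz with respect to any pair of charts. The Clarke derivative $Df(x)$ of a locally Lipschitz $f:U\to\mathbb{R}^n$ ($U\subset\mathbb{H}^m$ open) is the convex hull of all matrices $\lim_i Df(x_i)$ with $x_i\to x$ points of differentiability of $f$. Strong topology on $C^{k,1}(M,N)$: for compact $K\subset\mathbb{H}^m$ let $\|f\|^{k,1}_K$ be the supremum of $|D^jf(x)|_{j,\mathrm{op}}$ ($x\in K$, $0\le j\le k$) and of $|D^kf(y)-D^kf(x)|_{k,\mathrm{op}}/|x-y|$ ($x\neq y\in K$), with multilinear operator norms. Given $f\in C^{k,1}(M,N)$, charts $\varphi:U\to M$, $\psi:V\to N$, compact $K\subset U$ with $f\circ\varphi(K)\subset\psi(V)$ and $\epsilon\in(0,\infty]$, the elementary neighbourhood $\mathcal{N}^{k,1}(f;K,(U,\varphi),(V,\psi),\epsilon)$ is the set of $h\in C^{k,1}(M,N)$ (with $h\circ\varphi(K)\subset\psi(V)$) such that $\|\psi^{-1}\circ h\circ\varphi-\psi^{-1}\circ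 f\circ\varphi\|^{k,1}_K<\epsilon$. The strong topology has as basis all sets $\bigcap_{i\in I}\mathcal{N}^{k,1}(f;K_i,(U_i,\varphi_i),(V_i,\psi_i),\epsilon_i)$ with $f\in C^{k,1}(M,N)$ and the family $\{K_i\}_{i\in I}$ (i.e. the images $\varphi_i(K_i)$ in $M$) locally finite. Let $\sigma_j(A)$ be the $j$-th largest singular value of $A$. $\mathrm{Imm}^{k,1}(M,N)$ is the set of $f\in C^{k,1}(M,N)$ such that for any charts $(U,\varphi)$ of $M$ and $(V,\psi)$ of $N$ with $f\circ\varphi(U)\subset\psi(V)$ one has $\inf_{A\in D(\psi^{-1}\circ f\circ\varphi)(x)}\sigma_m(A)>0$ for all $x\in U$, where $D$ is the Clarke derivative. $\mathrm{Emb}^{k,1}(M,N)$ is the set of $f\in\mathrm{Imm}^{k,1}(M,N)$ that are homeomorphisms onto their image. *)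

theory Defs
  imports "HOL-Analysis.Analysis" "HOL-Library.Multiset"
begin

section \<open>Calculus on the half-space\<close>

text \<open>
  The model space is \<open>real ^ 'm\<close> with \<open>m = CARD('m)\<close>; the linear order on the index
  type singles out the first coordinate.
\<close>

type_synonym 'm euc = "(real, 'm) vec"

definition half_space :: "(real ^ 'm::{finite,linorder}) set" where
  "half_space = {x. 0 \<le> x $ Min UNIV}"

text \<open>
  All functions considered are defined on relatively open subsets of the half-space, so the
  derivative at \<open>x\<close> within the half-space depends only on the germ at \<open>x\<close>, also when \<open>x\<close> is a
  boundary point. It is unique there:
\<close>

lemma has_derivative_half_space_unique:
  fixes f :: "real ^ 'm::{finite,linorder} \<Rightarrow> real ^ 'n"
  assumes "x \<in> half_space"
    and "(f has_derivative D) (at x within half_space)"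
    and "(f has_derivative D') (at x within half_space)"
  shows "D = D'"
proof (rule frechet_derivative_unique_within[OF assms(2,3)])
  fix i :: "real ^ 'm::{finite,linorder}" and e :: real
  assume i: "i \<in> Basis" and e: "e > 0"
  have "0 \<le> i $ Min UNIV"
    using i by (auto simp: Basis_vec_def axis_def)
  then have "x + (e/2) *\<^sub>R i \<in> half_space"
    using assms(1) e by (simp add: half_space_def)
  then show "\<exists>d. 0 < \<bar>d\<bar> \<and> \<bar>d\<bar> < e \<and> x + d *\<^sub>R i \<in> half_space"
    using e by (intro exI[of _ "e/2"]) auto
qed

text \<open>
  \<open>nderiv [v\<^sub>1, \<dots>, v\<^sub>j] f x\<close> is \<open>D\<^sup>j f(x)(v\<^sub>1, \<dots>, v\<^sub>j)\<close>; thus the \<open>j\<close>-linear map \<open>D\<^sup>j f(x)\<close> is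
  represented by \<open>\<lambda>vs. nderiv vs f x\<close> on lists of length \<open>j\<close>.
\<close>

primrec nderiv ::
  "'m::{finite,linorder} euc list \<Rightarrow> ('m euc \<Rightarrow> 'n::finite euc) \<Rightarrow> 'm euc \<Rightarrow> 'n euc"
where
  "nderiv [] f = f"
| "nderiv (v # vs) f = (\<lambda>x. frechet_derivative (nderiv vs f) (at x within half_space) v)"

text \<open>
  Differentiability and continuity of the map \<open>D\<^sup>j f\<close> into the finite-dimensional space of
  \<open>j\<close>-linear maps is tested on each fixed tuple of arguments.
\<close>

definition Ck_on ::
  "nat \<Rightarrow> 'm::{finite,linorder} euc set \<Rightarrow> ('m euc \<Rightarrow> 'n::finite euc) \<Rightarrow> bool"
where
  "Ck_on k W f \<longleftrightarrow>
     (\<forall>vs. length vs < k \<longrightarrow> (\<forall>x\<in>W. nderiv vs f differentiable (at x within half_space))) \<and>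
     (\<forall>vs. length vs \<le> k \<longrightarrow> continuous_on W (nderiv vs f))"

definition smooth_on ::
  "'m::{finite,linorder} euc set \<Rightarrow> ('m euc \<Rightarrow> 'n::finite euc) \<Rightarrow> bool"
where
  "smooth_on W f \<longleftrightarrow> (\<forall>k. Ck_on k W f)"

definition mop_norm :: "nat \<Rightarrow> ('m::finite euc list \<Rightarrow> 'n::finite euc) \<Rightarrow> ennreal" where
  "mop_norm j T =
     (SUP vs\<in>{vs. length vs = j \<and> (\<forall>v\<in>set vs. norm v \<le> 1)}. ennreal (norm (T vs)))"

definition Ck1_on ::
  "nat \<Rightarrow> 'm::{finite,linorder} euc set \<Rightarrow> ('m euc \<Rightarrow> 'n::finite euc) \<Rightarrow> bool"
where
  "Ck1_on k W f \<longleftrightarrow> Ck_on k W f \<and>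
     (\<forall>x\<in>W. \<exists>r>0. \<exists>L::real. \<forall>y\<in>W \<inter> ball x r. \<forall>z\<in>W \<inter> ball x r.
        mop_norm k (\<lambda>vs. nderiv vs f y - nderiv vs f z) \<le> ennreal (L * dist y z))"

text \<open>With values in \<open>ennreal\<close> the norm over the empty set is \<open>0\<close>.\<close>

definition Ck1_norm ::
  "nat \<Rightarrow> 'm::{finite,linorder} euc set \<Rightarrow> ('m euc \<Rightarrow> 'n::finite euc) \<Rightarrow> ennreal"
where
  "Ck1_norm k K f =
     sup (SUP x\<in>K. SUP j\<in>{..k}. mop_norm j (\<lambda>vs. nderiv vs f x))
         (SUP (x, y)\<in>{(x, y). x \<in> K \<and> y \<in> K \<and> x \<noteq> y}.
            mop_norm k (\<lambda>vs. nderiv vs f y - nderiv vs f x) / ennreal (norm (x - y)))"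


section \<open>Clarke derivative and singular values\<close>

definition clarke_derivative ::
  "'m euc set \<Rightarrow> ('m euc \<Rightarrow> 'n euc) \<Rightarrow> 'm euc \<Rightarrow> (real ^ 'm ^ 'n) set"
where
  "clarke_derivative U f x = convex hull
     {A. \<exists>\<xi> D. (\<forall>i::nat. \<xi> i \<in> U \<and> (f has_derivative D i) (at (\<xi> i) within U)) \<and>
               \<xi> \<longlonglongrightarrow> x \<and> (\<lambda>i. matrix (D i)) \<longlonglongrightarrow> A}"

text \<open>
  The singular values of an \<open>n \<times> m\<close> matrix \<open>A\<close> are the \<open>m\<close> nonnegative square roots of the
  eigenvalues of \<open>A\<^sup>T A\<close>, with multiplicities. So \<open>\<sigma>\<^sub>m(A) = 0\<close> if \<open>n < m\<close>.
\<close>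

definition singular_eigenspace :: "real ^ 'm ^ 'n \<Rightarrow> real \<Rightarrow> 'm euc set" where
  "singular_eigenspace A s = {v. (transpose A ** A) *v v = s\<^sup>2 *\<^sub>R v}"

definition singular_values :: "real ^ 'm ^ 'n \<Rightarrow> real multiset" where
  "singular_values A =
     (\<Sum>s\<in>{s. 0 \<le> s \<and> singular_eigenspace A s \<noteq> {0}}.
        replicate_mset (dim (singular_eigenspace A s)) s)"

definition singular_value :: "nat \<Rightarrow> real ^ 'm ^ 'n \<Rightarrow> real" where
  "singular_value j A = rev (sorted_list_of_multiset (singular_values A)) ! (j - 1)"


section \<open>Smooth manifolds with boundary\<close>

text \<open>A chart is a parametrisation \<open>\<phi> : U \<rightarrow> M\<close>; only the values of \<open>\<phi>\<close> on \<open>U\<close> matter.\<close>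

type_synonym ('p, 'm) chart = "'m euc set \<times> ('m euc \<Rightarrow> 'p)"

definition topological_chart :: "'p topology \<Rightarrow> ('p, 'm::{finite,linorder}) chart \<Rightarrow> bool" where
  "topological_chart X = (\<lambda>(U, \<phi>).
     openin (top_of_set half_space) U \<and> openin X (\<phi> ` U) \<and>
     homeomorphic_map (top_of_set U) (subtopology X (\<phi> ` U)) \<phi>)"

definition local_rep ::
  "('m::finite euc \<Rightarrow> 'p) \<Rightarrow> 'n::finite euc set \<Rightarrow> ('n euc \<Rightarrow> 'q) \<Rightarrow> ('p \<Rightarrow> 'q) \<Rightarrow> 'm euc \<Rightarrow> 'n euc"
where
  "local_rep \<phi> V \<psi> f = (\<lambda>x. inv_into V \<psi> (f (\<phi> x)))"

definition local_dom ::
  "'m::finite euc set \<Rightarrow> ('m euc \<Rightarrow> 'p) \<Rightarrow> 'n::finite euc set \<Rightarrow> ('n euc \<Rightarrow> 'q) \<Rightarrow> ('p \<Rightarrow> 'q)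
     \<Rightarrow> 'm euc set"
where
  "local_dom U \<phi> V \<psi> f = {x\<in>U. f (\<phi> x) \<in> \<psi> ` V}"

definition smooth_compatible ::
  "('p, 'm::{finite,linorder}) chart \<Rightarrow> ('p, 'm) chart \<Rightarrow> bool"
where
  "smooth_compatible = (\<lambda>(U, \<phi>) (V, \<psi>).
     smooth_on (local_dom U \<phi> V \<psi> id) (local_rep \<phi> V \<psi> id) \<and>
     smooth_on (local_dom V \<psi> U \<phi> id) (local_rep \<psi> U \<phi> id))"

text \<open>
  A smooth manifold is a Hausdorff, second countable topology \<open>X\<close> with a maximal smooth atlas
  \<open>\<A>\<close>, the set of all charts of the manifold. Its dimension is \<open>CARD('m)\<close>.
\<close>

definition smooth_manifold ::
  "'p topology \<Rightarrow> ('p, 'm::{finite,linorder}) chart set \<Rightarrow> bool"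
where
  "smooth_manifold X \<A> \<longleftrightarrow>
     Hausdorff_space X \<and> second_countable X \<and>
     (\<forall>c\<in>\<A>. topological_chart X c) \<and>
     (\<Union>(U, \<phi>)\<in>\<A>. \<phi> ` U) = topspace X \<and>
     (\<forall>c\<in>\<A>. \<forall>d\<in>\<A>. smooth_compatible c d) \<and>
     (\<forall>c. topological_chart X c \<and> (\<forall>d\<in>\<A>. smooth_compatible c d) \<longrightarrow> c \<in> \<A>)"


section \<open>The space of \<open>C\<^sup>k\<^sup>,\<^sup>1\<close> maps with the strong topology\<close>

definition Ck1_maps ::
  "nat \<Rightarrow> 'p topology \<Rightarrow> ('p, 'm::{finite,linorder}) chart set \<Rightarrow>
     'q topology \<Rightarrow> ('q, 'n::{finite,linorder}) chart set \<Rightarrow> ('p \<Rightarrow> 'q) set"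
where
  "Ck1_maps k X \<A> Y \<B> =
     {f \<in> topspace X \<rightarrow>\<^sub>E topspace Y. continuous_map X Y f \<and>
        (\<forall>(U, \<phi>)\<in>\<A>. \<forall>(V, \<psi>)\<in>\<B>. Ck1_on k (local_dom U \<phi> V \<psi> f) (local_rep \<phi> V \<psi> f))}"

text \<open>A datum is a tuple \<open>(K, (U, \<phi>), (V, \<psi>), \<epsilon>)\<close>, where \<open>\<epsilon> = \<infinity>\<close> is allowed.\<close>

type_synonym ('p, 'm, 'q, 'n) nbhd_datum =
  "'m euc set \<times> ('p, 'm) chart \<times> ('q, 'n) chart \<times> ennreal"

definition admissible_datum ::
  "('p, 'm::{finite,linorder}) chart set \<Rightarrow> ('q, 'n::{finite,linorder}) chart set \<Rightarrow>
     ('p \<Rightarrow> 'q) \<Rightarrow> ('p, 'm, 'q, 'n) nbhd_datum \<Rightarrow> bool"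
where
  "admissible_datum \<A> \<B> f = (\<lambda>(K, (U, \<phi>), (V, \<psi>), \<epsilon>).
     (U, \<phi>) \<in> \<A> \<and> (V, \<psi>) \<in> \<B> \<and> compact K \<and> K \<subseteq> U \<and>
     (\<lambda>x. f (\<phi> x)) ` K \<subseteq> \<psi> ` V \<and> 0 < \<epsilon>)"

definition elementary_nbhd ::
  "nat \<Rightarrow> 'p topology \<Rightarrow> ('p, 'm::{finite,linorder}) chart set \<Rightarrow>
     'q topology \<Rightarrow> ('q, 'n::{finite,linorder}) chart set \<Rightarrow>
     ('p \<Rightarrow> 'q) \<Rightarrow> ('p, 'm, 'q, 'n) nbhd_datum \<Rightarrow> ('p \<Rightarrow> 'q) set"
where
  "elementary_nbhd k X \<A> Y \<B> f = (\<lambda>(K, (U, \<phi>), (V, \<psi>), \<epsilon>).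
     {h \<in> Ck1_maps k X \<A> Y \<B>. (\<lambda>x. h (\<phi> x)) ` K \<subseteq> \<psi> ` V \<and>
        Ck1_norm k K (\<lambda>x. local_rep \<phi> V \<psi> h x - local_rep \<phi> V \<psi> f x) < \<epsilon>})"

definition locally_finite_data ::
  "'p topology \<Rightarrow> ('p, 'm, 'q, 'n) nbhd_datum set \<Rightarrow> bool"
where
  "locally_finite_data X I \<longleftrightarrow>
     (\<forall>p\<in>topspace X. \<exists>W. openin X W \<and> p \<in> W \<and>
        finite {(K, (U, \<phi>), (V, \<psi>), \<epsilon>) \<in> I. \<phi> ` K \<inter> W \<noteq> {}})"

text \<open>
  A family of data enters an intersection of elementary neighbourhoods only through its range,
  so families are represented by (arbitrary, possibly empty) sets \<open>I\<close> of data.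
\<close>

definition strong_basis ::
  "nat \<Rightarrow> 'p topology \<Rightarrow> ('p, 'm::{finite,linorder}) chart set \<Rightarrow>
     'q topology \<Rightarrow> ('q, 'n::{finite,linorder}) chart set \<Rightarrow> ('p \<Rightarrow> 'q) set set"
where
  "strong_basis k X \<A> Y \<B> =
     {Ck1_maps k X \<A> Y \<B> \<inter> (\<Inter>d\<in>I. elementary_nbhd k X \<A> Y \<B> f d) | f I.
        f \<in> Ck1_maps k X \<A> Y \<B> \<and> (\<forall>d\<in>I. admissible_datum \<A> \<B> f d) \<and>
        locally_finite_data X I}"

text \<open>
  By the triangle inequality for \<open>Ck1_norm\<close>, each set of this family containing \<open>h\<close> contains one
  centred at \<open>h\<close>, and the union of two locally finite families is locally finite; so
  the family is a base of the topology it generates.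
\<close>

definition strong_topology ::
  "nat \<Rightarrow> 'p topology \<Rightarrow> ('p, 'm::{finite,linorder}) chart set \<Rightarrow>
     'q topology \<Rightarrow> ('q, 'n::{finite,linorder}) chart set \<Rightarrow> ('p \<Rightarrow> 'q) topology"
where
  "strong_topology k X \<A> Y \<B> = topology_generated_by (strong_basis k X \<A> Y \<B>)"


section \<open>Immersions and embeddings\<close>

text \<open>The infimum is taken in the extended reals.\<close>

definition Imm ::
  "nat \<Rightarrow> 'p topology \<Rightarrow> ('p, 'm::{finite,linorder}) chart set \<Rightarrow>
     'q topology \<Rightarrow> ('q, 'n::{finite,linorder}) chart set \<Rightarrow> ('p \<Rightarrow> 'q) set"
where
  "Imm k X \<A> Y \<B> =
     {f \<in> Ck1_maps k X \<A> Y \<B>.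
        \<forall>(U, \<phi>)\<in>\<A>. \<forall>(V, \<psi>)\<in>\<B>. (\<lambda>x. f (\<phi> x)) ` U \<subseteq> \<psi> ` V \<longrightarrow>
          (\<forall>x\<in>U. 0 < (INF A\<in>clarke_derivative U (local_rep \<phi> V \<psi> f) x.
                        ereal (singular_value CARD('m) A)))}"

definition Emb ::
  "nat \<Rightarrow> 'p topology \<Rightarrow> ('p, 'm::{finite,linorder}) chart set \<Rightarrow>
     'q topology \<Rightarrow> ('q, 'n::{finite,linorder}) chart set \<Rightarrow> ('p \<Rightarrow> 'q) set"
where
  "Emb k X \<A> Y \<B> = {f \<in> Imm k X \<A> Y \<B>. embedding_map X Y f}"

end

theory Submission
  imports Defs
begin

text \<open>
  In suitable charts around a point, an immersion \<open>f\<close> is expanding: for every unit vector \<open>v\<close>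
  there is a unit vector \<open>w\<close> with \<open>w \<bullet> (f (x + t v) - f x) \<ge> c t\<close>. Indeed, the Clarke derivative
  is convex, so \<open>w\<close> can be found by separating the set of all \<open>A v\<close> from \<open>0\<close>; by upper
  semicontinuity, \<open>w\<close> works for the derivative at all nearby points of differentiability, and by
  Rademacher's theorem this can be integrated along segments. The condition survives a change of
  \<open>f\<close> by a map of Lipschitz constant less than \<open>c\<close>, and gives back local injectivity and the bound
  on the singular values, in arbitrary charts. For global injectivity and the continuity of the
  inverse, take a locally finite cover of \<open>M\<close> by compact sets \<open>L j\<close> in open sets \<open>U j\<close> on whose
  closures \<open>f\<close> is expanding. As \<open>f\<close> is an embedding, the images of \<open>L j\<close> and of the complement
  of \<open>U j\<close> lie in disjoint open sets \<open>A j\<close>, \<open>B j\<close>. For a map \<open>h\<close> near \<open>f\<close> one only needs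
  \<open>h (L j) \<subseteq> A j\<close>, and \<open>h (L j - U i) \<subseteq> B i\<close> for \<open>i\<close> preceding \<open>j\<close> in an enumeration, which for
  each \<open>j\<close> are finitely many conditions on a compact set.
\<close>

text \<open>A bound \<open>c \<le> norm (A v)\<close> at every point of differentiability cannot be
  integrated: the vectors \<open>A v\<close> at different points may cancel. It has to be replaced
  by a bound for the component along one vector \<open>w\<close> common to all nearby points, and
  this is where the convex hull in the Clarke derivative is decisive. The same common
  \<open>w\<close> makes the way back possible: the matrices with
  \<open>c \<le> w \<bullet> A v\<close> form a half-space, which contains limits of derivatives
  together with their convex combinations. For \<open>k = 0\<close> the maps are merely Lipschitz,
  and in dimension at least two a segment is a null set, about which Rademacher's theorem is silent;
  hence an averaging over balls. At the boundary of the half-space, the local representation is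
  extended by the nearest-point projection onto a half-ball, the estimate is proved in the open
  part, and segments in the boundary are reached as limits of parallel ones. The compact sets of the
  data are half-balls in charts since, for \<open>k > 0\<close>, a small derivative gives a
  Lipschitz constant by the mean value inequality on convex sets. A perturbation may use up half of
  the expansion rate of \<open>f\<close>.\<close>

section \<open>Rademacher's theorem\<close>

text \<open>After rescaling and adding a multiple of the identity, \<open>f\<close> becomes
  nondecreasing with a Stieltjes measure dominated by Lebesgue measure, so the Radon-Nikodym theorem
  supplies the density.\<close>

lemma lipschitz_real_has_integral_density:
  fixes f :: "real \<Rightarrow> real"
  assumes lip: "L-lipschitz_on UNIV f"
  obtains g where "\<And>a b. a \<le> b \<Longrightarrow> (g has_integral f b - f a) {a..b}"
proof -
  \<comment> \<open>\<open>L\<close> may be zero, and \<open>K\<close> becomes a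
    denominator.\<close>
  define K where "K = L + 1"
  have L0: "0 \<le> L" using lip by (rule lipschitz_on_nonneg)
  have K: "K > 0" using L0 by (simp add: K_def)
  have fK: "\<bar>f y - f x\<bar> \<le> K * (y - x)" if "x \<le> y" for x y
  proof -
    have "\<bar>f y - f x\<bar> \<le> L * \<bar>y - x\<bar>"
      using lipschitz_onD[OF lip, of y x] by (simp add: dist_real_def)
    also have "\<dots> \<le> K * (y - x)"
      using that by (simp add: K_def algebra_simps)
    finally show ?thesis .
  qed
  have contf: "continuous_on UNIV f"
    using lip by (rule lipschitz_on_continuous_on)
  \<comment> \<open>Both functions are nondecreasing because \<open>f\<close> has Lipschitz constant
    at most \<open>K\<close>, and they add up to the identity. So Lebesgue measure is the sum of
    their Stieltjes measures and dominates that of \<open>F\<close>.\<close>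
  define F where "F t = t / 2 + f t / (2 * K)" for t
  define G where "G t = t / 2 - f t / (2 * K)" for t
  have Fmono: "F x \<le> F y" and Gmono: "G x \<le> G y" if "x \<le> y" for x y
  proof -
    have *: "\<bar>f y / (2 * K) - f x / (2 * K)\<bar> \<le> (y - x) / 2"
      using fK[OF that] K by (simp add: diff_divide_distrib[symmetric] field_simps)
    show "F x \<le> F y" "G x \<le> G y"
      using * unfolding F_def G_def abs_le_iff by (auto simp: diff_divide_distrib)
  qed
  have contF: "continuous_on UNIV F" and contG: "continuous_on UNIV G"
    unfolding F_def G_def using K by (auto intro!: continuous_intros contf)
  have FG: "F b + G b = b" for b by (simp add: F_def G_def)
  have Fc: "continuous (at x within S) F" and Gc: "continuous (at x within S) G" for x S
    using contF contG by (auto simp: continuous_on_eq_continuous_within intro: continuous_at_imp_continuous_at_within)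
  \<comment> \<open>Lebesgue measure is recognised below by its values on open intervals, whereas
    Stieltjes measures are given on half-open ones; continuity makes the endpoint a null
    set.\<close>
  have Ioo: "emeasure (interval_measure H) {l<..<u} = ennreal (H u - H l)"
    if "l \<le> u" and Hm: "\<And>x y. x \<le> y \<Longrightarrow> H x \<le> H y" and Hc: "continuous_on UNIV H" for H :: "real \<Rightarrow> real" and l u
  proof (cases "l = u")
    case False
    have c: "continuous (at x within S) H" for x S
      using Hc by (auto simp: continuous_on_eq_continuous_within intro: continuous_at_imp_continuous_at_within)
    have "emeasure (interval_measure H) {u..u} = ennreal (H u - H u)"
      by (rule emeasure_interval_measure_Icc) (auto intro: Hm continuous_on_subset[OF Hc])
    then have 0: "emeasure (interval_measure H) {u} = 0" by simp
    have "{l<..u} = {l<..<u} \<union> {u}" using False that by auto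
    then have "emeasure (interval_measure H) {l<..u} = emeasure (interval_measure H) {l<..<u} + emeasure (interval_measure H) {u}"
      by (simp add: plus_emeasure)
    then show ?thesis
      using 0 emeasure_interval_measure_Ioc[OF that(1) Hm c] by simp
  qed auto
  define M where "M = measure_of UNIV (sets borel) (\<lambda>A. emeasure (interval_measure F) A + emeasure (interval_measure G) A)"
  have setsM: "sets M = sets borel"
    unfolding M_def by (metis sets.sets_measure_of_eq space_borel)
  have emM: "emeasure M A = emeasure (interval_measure F) A + emeasure (interval_measure G) A"
    if "A \<in> sets borel" for A
  proof (rule emeasure_measure_of[OF M_def])
    show "sets (borel :: real measure) \<subseteq> Pow UNIV" by simp
    show "A \<in> sets M" using that setsM by simp
    show "positive (sets M) (\<lambda>A. emeasure (interval_measure F) A + emeasure (interval_measure G) A)"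
      by (simp add: positive_def)
    show "countably_additive (sets M) (\<lambda>A. emeasure (interval_measure F) A + emeasure (interval_measure G) A)"
    proof (rule countably_additiveI)
      fix A :: "nat \<Rightarrow> real set"
      assume A: "range A \<subseteq> sets M" "disjoint_family A" "\<Union> (range A) \<in> sets M"
      have "(\<Sum>i. emeasure (interval_measure F) (A i) + emeasure (interval_measure G) (A i)) =
        (\<Sum>i. emeasure (interval_measure F) (A i)) + (\<Sum>i. emeasure (interval_measure G) (A i))"
        by (rule suminf_add[symmetric]) auto
      then show "(\<Sum>i. emeasure (interval_measure F) (A i) + emeasure (interval_measure G) (A i)) =
        emeasure (interval_measure F) (\<Union> (range A)) + emeasure (interval_measure G) (\<Union> (range A))"
        using A setsM by (simp add: suminf_emeasure)
    qed
  qed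
  have lborM: "lborel = M"
  proof (rule lborel_eqI)
    fix l u :: real
    assume "\<And>b. b \<in> Basis \<Longrightarrow> l \<bullet> b \<le> u \<bullet> b"
    then have lu: "l \<le> u" by auto
    have "emeasure M {l<..<u} = ennreal (F u - F l) + ennreal (G u - G l)"
      using Ioo[OF lu Fmono contF] Ioo[OF lu Gmono contG] by (simp add: emM)
    also have "\<dots> = ennreal ((F u - F l) + (G u - G l))"
      using Fmono[OF lu] Gmono[OF lu] by (subst ennreal_plus) auto
    also have "(F u - F l) + (G u - G l) = u - l"
      using FG[of u] FG[of l] by linarith
    finally show "emeasure M (box l u) = (\<Prod>b\<in>Basis. (u - l) \<bullet> b)"
      by (simp add: box_real)
  qed (rule setsM)
  have "absolutely_continuous lborel (interval_measure F)"
    unfolding absolutely_continuous_def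
  proof
    fix N :: "real set" assume N: "N \<in> null_sets lborel"
    then have "N \<in> sets borel" "emeasure M N = 0"
      by (auto simp: null_sets_def lborM[symmetric])
    then show "N \<in> null_sets (interval_measure F)"
      using emM[of N] by (auto simp: null_sets_def)
  qed
  then obtain h where h: "h \<in> borel_measurable lborel" "density lborel h = interval_measure F"
    using sigma_finite_measure.Radon_Nikodym[OF sigma_finite_lborel, of "interval_measure F"] by auto
  \<comment> \<open>\<open>h\<close> takes extended values; its integral over a bounded interval is
    finite, so it is finite almost everywhere there and \<open>enn2real\<close> changes it only on a
    null set.\<close>
  define g where "g = (\<lambda>t. enn2real (h t))"
  have gm: "g \<in> borel_measurable borel"
    using h(1) by (simp add: g_def)
  have gi: "(g has_integral F b - F a) {a..b}" if ab: "a \<le> b" for a b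
  proof -
    have "emeasure (density lborel h) {a<..b} = (\<integral>\<^sup>+x. h x * indicator {a<..b} x \<partial>lborel)"
      using h(1) by (subst emeasure_density) auto
    then have 1: "(\<integral>\<^sup>+x. h x * indicator {a<..b} x \<partial>lborel) = ennreal (F b - F a)"
      using emeasure_interval_measure_Ioc[OF ab Fmono Fc] h(2) by simp
    have "AE x in lborel. h x * indicator {a<..b} x \<noteq> \<infinity>"
      using h(1) 1 by (intro nn_integral_PInf_AE) auto
    then have "(\<integral>\<^sup>+x. h x * indicator {a<..b} x \<partial>lborel) =
       (\<integral>\<^sup>+x. ennreal (g x * indicator {a<..b} x) \<partial>lborel)"
    proof (intro nn_integral_cong_AE, elim AE_mp, intro AE_I2 impI)
      fix x assume "h x * indicator {a<..b} x \<noteq> \<infinity>"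
      then show "h x * indicator {a<..b} x = ennreal (g x * indicator {a<..b} x)"
        by (auto simp: g_def indicator_def top.not_eq_extremum)
    qed
    then have "(\<integral>\<^sup>+x. ennreal (g x * indicator {a<..b} x) \<partial>lborel) = ennreal (F b - F a)"
      using 1 by simp
    then have "((\<lambda>x. g x * indicator {a<..b} x) has_integral (F b - F a)) UNIV"
      using gm Fmono[OF ab] by (intro nn_integral_has_integral) (auto simp: g_def)
    then have "((\<lambda>x. if x \<in> {a<..b} then g x else 0) has_integral (F b - F a)) UNIV"
      by (rule has_integral_eq[rotated]) auto
    then have "(g has_integral (F b - F a)) {a<..b}"
      by (simp only: has_integral_restrict_UNIV)
    moreover have "(g has_integral (F b - F a)) {a<..b} \<longleftrightarrow> (g has_integral (F b - F a)) {a..b}"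
      by (rule has_integral_spike_set_eq) (auto intro: negligible_subset[of "{a}"])
    ultimately show ?thesis by simp
  qed
  show thesis
  proof (rule that)
    fix a b :: real assume ab: "a \<le> b"
    \<comment> \<open>Inverts \<open>F t = t / 2 + f t / (2 * K)\<close>.\<close>
    have "((\<lambda>t. 2 * K * (g t - 1/2)) has_integral 2 * K * ((F b - F a) - (b - a) * (1/2))) {a..b}"
      using has_integral_const_real[of "1/2::real" a b] ab
      by (intro has_integral_mult_right has_integral_diff gi) auto
    moreover have "2 * K * ((F b - F a) - (b - a) * (1/2)) = f b - f a"
      using K by (simp add: F_def field_simps)
    ultimately show "((\<lambda>t. 2 * K * (g t - 1/2)) has_integral f b - f a) {a..b}" by simp
  qed
qed

text \<open>Lebesgue's differentiation theorem for the density of \<open>f\<close>. It is used in a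
  form that speaks of intervals to the right of a point, so left difference quotients are obtained
  from the reflected density \<open>\<lambda>t. g (- t)\<close>.\<close>

lemma lipschitz_real_AE_differentiable:
  fixes f :: "real \<Rightarrow> real"
  assumes lip: "L-lipschitz_on UNIV f"
  obtains N where "negligible N" "\<And>x. x \<notin> N \<Longrightarrow> f differentiable (at x)"
proof -
  obtain g where g: "\<And>a b. a \<le> b \<Longrightarrow> (g has_integral f b - f a) {a..b}"
    using lipschitz_real_has_integral_density[OF lip] by blast
  have gint: "g integrable_on cbox a b" for a b
    using g[of a b] by (cases "a \<le> b") (auto simp: cbox_interval)
  have g': "((\<lambda>t. g (- t)) has_integral f (- a) - f (- b)) {a..b}" if "a \<le> b" for a b
    using has_integral_reflect_real[of g "f (-a) - f (-b)" "-a" "-b"] g[of "-b" "-a"] that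
    by (simp add: has_integral_reflect_real)
  have gint': "(\<lambda>t. g (- t)) integrable_on cbox a b" for a b
    using g'[of a b] by (cases "a \<le> b") (auto simp: cbox_interval)
  obtain N where N: "negligible N" "\<And>x e. x \<notin> N \<Longrightarrow> 0 < e \<Longrightarrow>
      \<exists>d>0. \<forall>h. 0 < h \<and> h < d \<longrightarrow> norm (integral (cbox x (x + h *\<^sub>R One)) g /\<^sub>R h ^ DIM(real) - g x) < e"
    using integrable_ccontinuous_explicit[OF gint] by metis
  obtain N' where N': "negligible N'" "\<And>x e. x \<notin> N' \<Longrightarrow> 0 < e \<Longrightarrow>
      \<exists>d>0. \<forall>h. 0 < h \<and> h < d \<longrightarrow> norm (integral (cbox x (x + h *\<^sub>R One)) (\<lambda>t. g (- t)) /\<^sub>R h ^ DIM(real) - g (- x)) < e"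
    using integrable_ccontinuous_explicit[OF gint'] by metis
  have "negligible (uminus ` N')"
    using N'(1) by (intro negligible_differentiable_image_negligible) (auto intro!: derivative_intros)
  then have "negligible (N \<union> uminus ` N')" using N(1) by (rule negligible_Un[rotated])
  moreover have "f differentiable (at x)" if x: "x \<notin> N \<union> uminus ` N'" for x
  proof -
    have xN: "x \<notin> N" and xN': "- x \<notin> N'" using x by force+
    have "((\<lambda>h. (f (x + h) - f x) / h) \<longlongrightarrow> g x) (at 0)"
      unfolding LIM_eq
    proof (intro allI impI)
      fix e :: real assume e: "e > 0"
      obtain d where d: "d > 0" "\<And>h. 0 < h \<Longrightarrow> h < d \<Longrightarrow> \<bar>integral {x..x+h} g / h - g x\<bar> < e"
        using N(2)[OF xN e] by (auto simp: divide_inverse mult.commute)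
      obtain d' where d': "d' > 0" "\<And>h. 0 < h \<Longrightarrow> h < d' \<Longrightarrow> \<bar>integral {-x..-x+h} (\<lambda>t. g (- t)) / h - g x\<bar> < e"
        using N'(2)[OF xN' e] by (auto simp: divide_inverse mult.commute)
      show "\<exists>s>0. \<forall>h. h \<noteq> 0 \<and> norm (h - 0) < s \<longrightarrow> norm ((f (x + h) - f x) / h - g x) < e"
      proof (intro exI[of _ "min d d'"] conjI allI impI)
        fix h :: real assume h: "h \<noteq> 0 \<and> norm (h - 0) < min d d'"
        show "norm ((f (x + h) - f x) / h - g x) < e"
        proof (cases "h > 0")
          case True
          have "integral {x..x+h} g = f (x + h) - f x"
            using g[of x "x+h"] True by (auto intro: integral_unique)
          then show ?thesis using d(2)[of h] True h by auto
        next
          case False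
          then have h': "- h > 0" "- h < d'" using h by auto
          have "integral {-x..-x+(-h)} (\<lambda>t. g (- t)) = f x - f (x + h)"
            using g'[of "-x" "-x+(-h)"] h' by (intro integral_unique) (simp add: add.commute)
          then have "integral {-x..-x+(-h)} (\<lambda>t. g (- t)) / (-h) = (f (x + h) - f x) / h"
            using h by (simp add: field_simps)
          then show ?thesis using d'(2)[OF h'] by auto
        qed
      qed (use d d' in auto)
    qed
    then show ?thesis
      by (metis DERIV_def real_differentiable_def)
  qed
  ultimately show thesis by (rule that)
qed

section \<open>Differentiability almost everywhere along a fixed direction\<close>

lemma closed_directional_quotients:
  fixes F :: "'a::euclidean_space \<Rightarrow> real"
  assumes "continuous_on UNIV F"
  shows "closed {x. \<forall>p\<in>P. \<bar>(F (x + fst p *\<^sub>R v) - F x) / fst p - (F (x + snd p *\<^sub>R v) - F x) / snd p\<bar> \<le> (e::real)}"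
proof -
  have "continuous_on UNIV (\<lambda>x. F (x + t *\<^sub>R v))" for t
    by (rule continuous_on_compose2[OF assms]) (auto intro!: continuous_intros)
  then have "closed {x. \<bar>(F (x + fst p *\<^sub>R v) - F x) / fst p - (F (x + snd p *\<^sub>R v) - F x) / snd p\<bar> \<le> e}" for p
    unfolding divide_inverse by (intro closed_Collect_le continuous_intros assms)
  then show ?thesis
    by (simp add: Collect_ball_eq closed_INT)
qed

text \<open>Cauchy's criterion gets rid of the unknown limit. What remains has countable outer
  quantifiers, which later makes the exceptional set of a direction Borel.\<close>

lemma real_differentiable_zero_iff_Cauchy:
  fixes f :: "real \<Rightarrow> real"
  shows "f differentiable (at 0) \<longleftrightarrow>
    (\<forall>n. \<exists>m. \<forall>p \<in> {p. fst p \<noteq> 0 \<and> snd p \<noteq> 0 \<and> \<bar>fst p\<bar> < 1 / Suc m \<and> \<bar>snd p\<bar> < 1 / Suc m}.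
      \<bar>(f (fst p) - f 0) / fst p - (f (snd p) - f 0) / snd p\<bar> \<le> 1 / Suc n)" (is "?L \<longleftrightarrow> ?R")
proof -
  define q where "q h = (f h - f 0) / h" for h
  have "?L \<longleftrightarrow> (\<exists>d. filtermap q (at 0) \<le> nhds d)"
    by (simp add: real_differentiable_def DERIV_def filterlim_def q_def[abs_def])
  also have "\<dots> \<longleftrightarrow> cauchy_filter (filtermap q (at 0))"
    using cauchy_filter_complete_converges[OF _ complete_UNIV, of "filtermap q (at 0)"]
    by (auto intro: nhds_imp_cauchy_filter simp: filtermap_bot_iff)
  also have "\<dots> \<longleftrightarrow> ?R"
    unfolding cauchy_filter_metric_filtermap
  proof (intro iffI allI impI)
    fix n
    assume "\<forall>e>0. \<exists>P. eventually P (at 0) \<and> (\<forall>x y. P x \<and> P y \<longrightarrow> dist (q x) (q y) < e)"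
    then obtain P where P: "eventually P (at 0)" "\<And>x y. P x \<Longrightarrow> P y \<Longrightarrow> dist (q x) (q y) < 1 / Suc n"
      by (metis of_nat_0_less_iff zero_less_Suc zero_less_divide_1_iff)
    obtain d where d: "0 < d" "\<And>h. h \<noteq> 0 \<Longrightarrow> \<bar>h\<bar> < d \<Longrightarrow> P h"
      using P(1) by (auto simp: eventually_at)
    obtain m where m: "1 / real (Suc m) < d" using nat_approx_posE[OF d(1)] .
    show "\<exists>m. \<forall>p \<in> {p. fst p \<noteq> 0 \<and> snd p \<noteq> 0 \<and> \<bar>fst p\<bar> < 1 / Suc m \<and> \<bar>snd p\<bar> < 1 / Suc m}.
      \<bar>(f (fst p) - f 0) / fst p - (f (snd p) - f 0) / snd p\<bar> \<le> 1 / Suc n"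
    proof (intro exI[of _ m] ballI)
      fix p :: "real \<times> real"
      assume "p \<in> {p. fst p \<noteq> 0 \<and> snd p \<noteq> 0 \<and> \<bar>fst p\<bar> < 1 / Suc m \<and> \<bar>snd p\<bar> < 1 / Suc m}"
      then have "P (fst p)" "P (snd p)" using m by (auto intro!: d(2) simp del: of_nat_Suc)
      from less_imp_le[OF P(2)[OF this]]
      show "\<bar>(f (fst p) - f 0) / fst p - (f (snd p) - f 0) / snd p\<bar> \<le> 1 / Suc n"
        unfolding q_def dist_real_def .
    qed
  next
    fix e :: real assume R: ?R and "0 < e"
    then obtain n where n: "1 / real (Suc n) < e" using nat_approx_posE by blast
    obtain m where m: "\<And>p. fst p \<noteq> 0 \<Longrightarrow> snd p \<noteq> 0 \<Longrightarrow> \<bar>fst p\<bar> < 1 / Suc m \<Longrightarrow> \<bar>snd p\<bar> < 1 / Suc m \<Longrightarrow>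
        \<bar>q (fst p) - q (snd p)\<bar> \<le> 1 / Suc n"
      using R[rule_format, of n] unfolding q_def[symmetric] by blast
    show "\<exists>P. eventually P (at 0) \<and> (\<forall>x y. P x \<and> P y \<longrightarrow> dist (q x) (q y) < e)"
    proof (intro exI[of _ "\<lambda>h. h \<noteq> 0 \<and> \<bar>h\<bar> < 1 / real (Suc m)"] conjI allI impI)
      show "eventually (\<lambda>h. h \<noteq> 0 \<and> \<bar>h\<bar> < 1 / real (Suc m)) (at 0)"
        unfolding eventually_at by (intro exI[of _ "1 / real (Suc m)"]) auto
      fix x y
      assume "(x \<noteq> 0 \<and> \<bar>x\<bar> < 1 / real (Suc m)) \<and> y \<noteq> 0 \<and> \<bar>y\<bar> < 1 / real (Suc m)"
      then have "\<bar>q x - q y\<bar> \<le> 1 / real (Suc n)" using m[of "(x, y)"] by simp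
      then show "dist (q x) (q y) < e" unfolding dist_real_def using n by (rule le_less_trans)
    qed
  qed
  finally show ?thesis .
qed

lemma lipschitz_on_line:
  fixes F :: "'a::euclidean_space \<Rightarrow> real"
  assumes lip: "L-lipschitz_on UNIV F"
  shows "(L * norm v)-lipschitz_on UNIV (\<lambda>t. F (x + t *\<^sub>R v))"
proof (rule lipschitz_onI)
  fix s t :: real
  have "dist (F (x + s *\<^sub>R v)) (F (x + t *\<^sub>R v)) \<le> L * dist (x + s *\<^sub>R v) (x + t *\<^sub>R v)"
    by (rule lipschitz_onD[OF lip]) auto
  also have "dist (x + s *\<^sub>R v) (x + t *\<^sub>R v) = norm v * dist s t"
    by (simp add: dist_norm scaleR_left_diff_distrib[symmetric] mult.commute)
  finally show "dist (F (x + s *\<^sub>R v)) (F (x + t *\<^sub>R v)) \<le> L * norm v * dist s t" by (simp add: mult.assoc)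
qed (use lipschitz_on_nonneg[OF lip] in auto)

lemma null_sets_lborelI:
  assumes "negligible S" "S \<in> sets borel"
  shows "S \<in> null_sets lborel"
  using assms by (simp add: negligible_iff_null_sets null_sets_completion_iff)

text \<open>
  The exceptional set \<open>E\<close> meets every line of direction \<open>v\<close> in a null set. By translation
  invariance the measure of \<open>E\<close> is \<open>\<integral>\<^sub>0\<^sup>1 \<bar>E - t v\<bar> dt\<close>, and exchanging the integrals gives \<open>0\<close>.
\<close>

lemma lipschitz_AE_directional_derivative:
  fixes F :: "'a::euclidean_space \<Rightarrow> real"
  assumes lip: "L-lipschitz_on UNIV F"
  shows "AE x in lborel. (\<lambda>t. F (x + t *\<^sub>R v)) differentiable (at 0)"
proof -
  define E where "E = {x. \<not> (\<lambda>t. F (x + t *\<^sub>R v)) differentiable (at 0)}"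
  have contF: "continuous_on UNIV F" using lip by (rule lipschitz_on_continuous_on)
  define P where "P m = {p :: real \<times> real. fst p \<noteq> 0 \<and> snd p \<noteq> 0 \<and> \<bar>fst p\<bar> < 1 / Suc m \<and> \<bar>snd p\<bar> < 1 / Suc m}" for m :: nat
  define S where "S n m = {x. \<forall>p\<in>P m. \<bar>(F (x + fst p *\<^sub>R v) - F x) / fst p - (F (x + snd p *\<^sub>R v) - F x) / snd p\<bar> \<le> 1 / Suc n}" for n m
  \<comment> \<open>The uncountable quantifier over pairs of increments is harmless, as any
    intersection of closed sets is closed; so \<open>- E\<close> is a countable intersection of
    countable unions of closed sets.\<close>
  have "- E = (\<Inter>n. \<Union>m. S n m)"
    by (rule set_eqI) (simp only: E_def S_def P_def real_differentiable_zero_iff_Cauchy Compl_iff mem_Collect_eq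
        INT_iff UN_iff not_not scaleR_zero_left add_0_right ball_UNIV bex_UNIV)
  also have "\<dots> \<in> sets borel"
  proof -
    have "S n m \<in> sets borel" for n m
      unfolding S_def by (intro borel_closed closed_directional_quotients contF)
    then have "(\<Union>m. S n m) \<in> sets borel" for n
      by (intro sets.countable_UN) auto
    then show ?thesis
      by (intro sets.countable_INT) auto
  qed
  finally have "- E \<in> sets borel" .
  then have E: "E \<in> sets borel"
    using borel_comp[of "- E"] by simp
  have meas_line: "{t. x + t *\<^sub>R v \<in> E} \<in> sets borel" for x
  proof -
    have "(\<lambda>t. x + t *\<^sub>R v) -` E \<inter> space borel \<in> sets borel"
      by (rule measurable_sets[OF _ E]) (intro borel_measurable_continuous_onI continuous_intros)
    then show ?thesis by (simp add: vimage_def)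
  qed
  have null: "emeasure lborel {t. x + t *\<^sub>R v \<in> E} = 0" for x
  proof -
    obtain N where N: "negligible N" "\<And>t. t \<notin> N \<Longrightarrow> (\<lambda>t. F (x + t *\<^sub>R v)) differentiable (at t)"
      using lipschitz_real_AE_differentiable[OF lipschitz_on_line[OF lip, where x = x and v = v]] by metis
    have "t \<in> N" if "x + t *\<^sub>R v \<in> E" for t
    proof (rule ccontr)
      assume "t \<notin> N"
      from N(2)[OF this] obtain d where d: "((\<lambda>t. F (x + t *\<^sub>R v)) has_real_derivative d) (at t)"
        unfolding real_differentiable_def by blast
      have "((\<lambda>s. F (x + (s + t) *\<^sub>R v)) has_real_derivative d) (at 0)"
        by (rule DERIV_shift[of "\<lambda>t. F (x + t *\<^sub>R v)" d 0 t, THEN iffD1]) (simp only: add_0_left d)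
      moreover have "(\<lambda>s. F (x + (s + t) *\<^sub>R v)) = (\<lambda>s. F ((x + t *\<^sub>R v) + s *\<^sub>R v))"
        by (rule ext) (simp add: scaleR_add_left add_ac)
      ultimately have "((\<lambda>s. F ((x + t *\<^sub>R v) + s *\<^sub>R v)) has_real_derivative d) (at 0)"
        by (simp only:)
      then have "(\<lambda>s. F ((x + t *\<^sub>R v) + s *\<^sub>R v)) differentiable (at 0)"
        unfolding real_differentiable_def by (rule exI)
      moreover have "\<not> (\<lambda>s. F ((x + t *\<^sub>R v) + s *\<^sub>R v)) differentiable (at 0)"
        using that unfolding E_def by (rule CollectD)
      ultimately show False by (rule notE[rotated])
    qed
    then have "negligible {t. x + t *\<^sub>R v \<in> E}"
      by (intro negligible_subset[OF N(1)]) auto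
    then show ?thesis
      by (intro null_setsD1 null_sets_lborelI meas_line)
  qed
  have meas: "(\<lambda>(x, t). indicator E (x + t *\<^sub>R v) * indicator {0..1::real} t :: ennreal) \<in> borel_measurable (lborel \<Otimes>\<^sub>M lborel)"
  proof -
    have 1: "(\<lambda>p::'a \<times> real. fst p + snd p *\<^sub>R v) \<in> measurable (lborel \<Otimes>\<^sub>M lborel) borel"
    proof -
      have "(\<lambda>p::'a \<times> real. fst p + snd p *\<^sub>R v) \<in> measurable (borel \<Otimes>\<^sub>M borel) borel"
        unfolding borel_prod by (intro borel_measurable_continuous_onI continuous_intros)
      then show ?thesis
        by (subst measurable_cong_sets[OF sets_pair_measure_cong[OF sets_lborel sets_lborel] refl])
    qed
    have "(\<lambda>p::'a \<times> real. indicator E (fst p + snd p *\<^sub>R v) :: ennreal) \<in> borel_measurable (lborel \<Otimes>\<^sub>M lborel)"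
      by (rule measurable_compose[OF 1]) (use E in measurable)
    then show ?thesis
      unfolding split_beta
      by (intro borel_measurable_times_ennreal) (auto intro!: measurable_compose[OF measurable_snd] borel_measurable_indicator)
  qed
  have shift: "(\<integral>\<^sup>+x. indicator E (x + t *\<^sub>R v) \<partial>lborel) = emeasure lborel E" for t
  proof -
    have "emeasure lborel E = (\<integral>\<^sup>+x. indicator E x \<partial>lborel)" using E by simp
    also have "\<dots> = (\<integral>\<^sup>+x. indicator E x \<partial>distr lborel borel ((+) (t *\<^sub>R v)))"
      by (simp add: lborel_distr_plus)
    also have "\<dots> = (\<integral>\<^sup>+x. indicator E (t *\<^sub>R v + x) \<partial>lborel)"
      using E by (intro nn_integral_distr) auto
    finally show ?thesis by (simp add: add.commute)
  qed
  have "emeasure lborel E = (\<integral>\<^sup>+t. emeasure lborel E * indicator {0..1::real} t \<partial>lborel)"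
    by (subst nn_integral_cmult_indicator) auto
  also have "\<dots> = (\<integral>\<^sup>+t. (\<integral>\<^sup>+x. indicator E (x + t *\<^sub>R v) * indicator {0..1::real} t \<partial>lborel) \<partial>lborel)"
    by (intro nn_integral_cong) (auto simp: indicator_def[of "{0..1}"] shift)
  also have "\<dots> = (\<integral>\<^sup>+x. (\<integral>\<^sup>+t. indicator E (x + t *\<^sub>R v) * indicator {0..1::real} t \<partial>lborel) \<partial>lborel)"
    using lborel_pair.Fubini'[OF meas] by simp
  also have "\<dots> = nn_integral lborel (\<lambda>x::'a. 0)"
  proof (intro nn_integral_cong)
    fix x :: 'a
    have "{t. x + t *\<^sub>R v \<in> E} \<in> null_sets lborel" using null[of x] meas_line[of x] by (auto simp: null_sets_def)
    then have "AE t in lborel. indicator E (x + t *\<^sub>R v) * indicator {0..1::real} t = (0::ennreal)"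
      by (rule AE_I') (auto simp: indicator_def)
    then show "(\<integral>\<^sup>+t. indicator E (x + t *\<^sub>R v) * indicator {0..1::real} t \<partial>lborel) = 0"
      by (subst nn_integral_cong_AE) auto
  qed
  finally have "emeasure lborel E = 0" by simp
  then have "E \<in> null_sets lborel" using E by (auto simp: null_sets_def)
  then show ?thesis
    by (rule AE_I') (auto simp: E_def)
qed

section \<open>Linearity of the directional derivative and Rademacher's theorem\<close>

text \<open>The value is unspecified where the limit does not exist.\<close>

definition dirderiv :: "('a::euclidean_space \<Rightarrow> real) \<Rightarrow> 'a \<Rightarrow> 'a \<Rightarrow> real" where
  "dirderiv F v x = lim (\<lambda>n. (F (x + (1 / Suc n) *\<^sub>R v) - F x) / (1 / Suc n))"

lemma dirderiv_LIMSEQ: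
  fixes F :: "'a::euclidean_space \<Rightarrow> real"
  assumes "((\<lambda>t. F (x + t *\<^sub>R v)) has_real_derivative d) (at 0)"
    and "X \<longlonglongrightarrow> 0" "\<And>n. X n \<noteq> 0"
  shows "(\<lambda>n. (F (x + X n *\<^sub>R v) - F x) / X n) \<longlonglongrightarrow> d"
proof -
  have "((\<lambda>h. (F (x + h *\<^sub>R v) - F x) / h) \<longlongrightarrow> d) (at 0)"
    using assms(1) by (simp add: DERIV_def)
  moreover have "filterlim X (at 0) sequentially"
    using assms(2,3) by (simp add: filterlim_at)
  ultimately show ?thesis
    by (rule filterlim_compose)
qed

lemma inverse_Suc_LIMSEQ: "(\<lambda>n. 1 / real (Suc n)) \<longlonglongrightarrow> 0"
  using LIMSEQ_inverse_real_of_nat by (simp add: divide_inverse)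

lemma dirderiv_eqI:
  assumes "((\<lambda>t. F (x + t *\<^sub>R v)) has_real_derivative d) (at 0)"
  shows "dirderiv F v x = d"
  unfolding dirderiv_def
  by (rule limI, rule dirderiv_LIMSEQ[OF assms inverse_Suc_LIMSEQ]) simp

lemma has_dirderiv:
  assumes "(\<lambda>t. F (x + t *\<^sub>R v)) differentiable (at 0)"
  shows "((\<lambda>t. F (x + t *\<^sub>R v)) has_real_derivative dirderiv F v x) (at 0)"
  using assms dirderiv_eqI by (metis real_differentiable_def)

lemma continuous_on_shift:
  fixes F :: "'a::real_normed_vector \<Rightarrow> real"
  assumes "continuous_on UNIV F"
  shows "continuous_on S (\<lambda>x. F (x + v))"
  by (rule continuous_on_compose2[OF assms]) (auto intro!: continuous_intros)

lemma borel_measurable_shift: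
  fixes F :: "'a::real_normed_vector \<Rightarrow> real"
  assumes "continuous_on UNIV F"
  shows "(\<lambda>x. F (x + v)) \<in> borel_measurable borel"
  by (rule borel_measurable_continuous_onI) (rule continuous_on_shift[OF assms])

text \<open>The definition takes the limit along the sequence \<open>1 / Suc n\<close> and not over
  all real increments, so that it is a limit of countably many Borel functions.\<close>

lemma borel_measurable_dirderiv:
  assumes "continuous_on UNIV F"
  shows "dirderiv F v \<in> borel_measurable borel"
  unfolding dirderiv_def[abs_def]
  by (intro borel_measurable_lim_metric borel_measurable_divide borel_measurable_diff
      borel_measurable_shift assms borel_measurable_const borel_measurable_continuous_onI)

lemma lipschitz_quotient_bound:
  fixes F :: "'a::euclidean_space \<Rightarrow> real"
  assumes lip: "L-lipschitz_on UNIV F"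
  shows "\<bar>(F (x + h *\<^sub>R v) - F x) / h\<bar> \<le> L * norm v"
proof (cases "h = 0")
  case True
  then show ?thesis using lipschitz_on_nonneg[OF lip] by simp
next
  case False
  have "\<bar>F (x + h *\<^sub>R v) - F x\<bar> \<le> L * (\<bar>h\<bar> * norm v)"
    using lipschitz_onD[OF lip, of "x + h *\<^sub>R v" x] by (simp add: dist_norm)
  then show ?thesis using False by (simp add: abs_divide field_simps)
qed

text \<open>By Lebesgue's differentiation theorem, \<open>r x\<close> is almost everywhere the limit
  of averages over cubes with corner \<open>x\<close>, all of which vanish.\<close>

lemma AE_eq_0_if_integral_cbox_eq_0:
  fixes r :: "'a::euclidean_space \<Rightarrow> real"
  assumes "\<And>a b. set_integrable lborel (cbox a b) r"
    and "\<And>a b. (LINT x:cbox a b|lborel. r x) = 0"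
  obtains N where "negligible N" "\<And>x. x \<notin> N \<Longrightarrow> r x = 0"
proof -
  have i: "r integrable_on cbox a b" "integral (cbox a b) r = 0" for a b
    using set_borel_integral_eq_integral[OF assms(1)] assms(2) by metis+
  obtain N where N: "negligible N" "\<And>x e. x \<notin> N \<Longrightarrow> 0 < e \<Longrightarrow>
      \<exists>d>0. \<forall>h. 0 < h \<and> h < d \<longrightarrow> norm (integral (cbox x (x + h *\<^sub>R One)) r /\<^sub>R h ^ DIM('a) - r x) < e"
    using integrable_ccontinuous_explicit[OF i(1)] by metis
  have "r x = 0" if xN: "x \<notin> N" for x
  proof (rule ccontr)
    assume "r x \<noteq> 0"
    then obtain d where d: "d > 0"
      "\<And>h. 0 < h \<and> h < d \<longrightarrow> norm (integral (cbox x (x + h *\<^sub>R One)) r /\<^sub>R h ^ DIM('a) - r x) < \<bar>r x\<bar>"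
      using N(2)[OF xN, of "\<bar>r x\<bar>"] by auto
    then have "norm (integral (cbox x (x + (d/2) *\<^sub>R One)) r /\<^sub>R (d/2) ^ DIM('a) - r x) < \<bar>r x\<bar>"
      by simp
    then show False by (simp add: i(2))
  qed
  with N(1) that show thesis by blast
qed

lemma integral_shift_lborel:
  fixes g :: "'a::euclidean_space \<Rightarrow> real"
  assumes "g \<in> borel_measurable borel"
  shows "(\<integral>x. g (x + c) \<partial>lborel) = (\<integral>x. g x \<partial>lborel)"
proof -
  have "(\<integral>x. g x \<partial>lborel) = (\<integral>x. g x \<partial>distr lborel borel ((+) c))"
    by (simp add: lborel_distr_plus)
  also have "\<dots> = (\<integral>x. g (c + x) \<partial>lborel)"
    by (rule integral_distr) (use assms in auto)
  finally show ?thesis by (simp add: add.commute)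
qed

lemma integrable_indicator_cball:
  "integrable lborel (\<lambda>x::'a::euclidean_space. C * indicator (cball 0 R) x :: real)"
  by (intro integrable_mult_right) (use emeasure_bounded_finite[OF bounded_cball] in \<open>simp add: integrable_indicator_iff\<close>)

lemma integrable_bounded_support:
  fixes g :: "'a::euclidean_space \<Rightarrow> real"
  assumes "g \<in> borel_measurable borel" "\<And>x. \<bar>g x\<bar> \<le> C * indicator (cball 0 R) x"
  shows "integrable lborel g"
proof (rule Bochner_Integration.integrable_bound[of lborel "\<lambda>x. C * indicator (cball 0 R) x"])
  show "integrable lborel (\<lambda>x. C * indicator (cball 0 R) x :: real)"
    by (rule integrable_indicator_cball)
qed (use assms in \<open>auto intro!: AE_I2 order.trans[OF assms(2)]\<close>)

text \<open>
  The sum of the difference quotients of \<open>u\<close> and \<open>v\<close> differs from that of \<open>u + v\<close> only by a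
  translation of one of them, which does not matter for the limit of its integral over a box.
\<close>

lemma dirderiv_add:
  fixes F :: "'a::euclidean_space \<Rightarrow> real"
  assumes lip: "L-lipschitz_on UNIV F"
  shows "AE x in lborel. dirderiv F (u + v) x = dirderiv F u x + dirderiv F v x"
proof -
  have contF: "continuous_on UNIV F" using lip by (rule lipschitz_on_continuous_on)
  have L0: "L \<ge> 0" using lip by (rule lipschitz_on_nonneg)
  define e where "e n = 1 / real (Suc n)" for n
  have e0: "e \<longlonglongrightarrow> 0" "e n \<noteq> 0" "e n > 0" "e n \<le> 1" for n
    using inverse_Suc_LIMSEQ by (auto simp: e_def[abs_def])
  define q where "q w n x = (F (x + e n *\<^sub>R w) - F x) / e n" for w n x
  have qm [measurable]: "q w n \<in> borel_measurable borel" for w n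
    unfolding q_def[abs_def]
    by (intro borel_measurable_divide borel_measurable_diff
      borel_measurable_shift contF borel_measurable_const borel_measurable_continuous_onI)
  have qb: "\<bar>q w n x\<bar> \<le> L * norm w" for w n x
    unfolding q_def by (rule lipschitz_quotient_bound[OF lip])
  have qlim: "AE x in lborel. (\<lambda>n. q w n x) \<longlonglongrightarrow> dirderiv F w x" for w
    using lipschitz_AE_directional_derivative[OF lip, of w]
  proof eventually_elim
    case (elim x)
    show ?case
      unfolding q_def by (rule dirderiv_LIMSEQ[OF has_dirderiv[OF elim]]) (use e0 in auto)
  qed
  define r where "r x = dirderiv F (u + v) x - dirderiv F u x - dirderiv F v x" for x
  have rm [measurable]: "r \<in> borel_measurable borel"
    unfolding r_def[abs_def] by (intro borel_measurable_diff borel_measurable_dirderiv contF)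
  define rn where "rn n x = q v n (x + e n *\<^sub>R u) - q v n x" for n x
  \<comment> \<open>Splitting the increment \<open>u + v\<close> into \<open>u\<close> followed by
    \<open>v\<close>, the failure of additivity at step \<open>e n\<close> is the quotient along
    \<open>v\<close> at the shifted base point minus that at \<open>x\<close>.\<close>
  have rn: "rn n x = q (u + v) n x - q u n x - q v n x" for n x
    by (simp add: rn_def q_def scaleR_add_right add.assoc diff_divide_distrib)
  have rnlim: "AE x in lborel. (\<lambda>n. rn n x) \<longlonglongrightarrow> r x"
    using qlim[of "u + v"] qlim[of u] qlim[of v]
    by eventually_elim (auto simp: rn r_def intro!: tendsto_intros)
  have rnm [measurable]: "rn n \<in> borel_measurable borel" for n
    unfolding rn[abs_def] by measurable
  have rnb: "\<bar>rn n x\<bar> \<le> 2 * (L * norm v)" for n x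
    using qb[of v n x] qb[of v n "x + e n *\<^sub>R u"] unfolding rn_def by linarith
  have "set_integrable lborel (cbox a b) r \<and> (LINT x:cbox a b|lborel. r x) = 0" for a b
  proof -
    let ?B = "cbox a b"
    let ?D = "\<lambda>n x. indicator ?B (x - e n *\<^sub>R u) - indicator ?B x :: real"
    define C where "C = 2 * (L * norm v)"
    have C0: "0 \<le> C" "L * norm v \<le> C" using L0 by (auto simp: C_def)
    obtain R0 where "?B \<subseteq> cball 0 R0"
      using bounded_cbox[of a b] by (auto simp: bounded_iff subset_iff)
    \<comment> \<open>Since \<open>e n \<le> 1\<close>, one ball of this radius contains the box and
      all its translates by \<open>e n *\<^sub>R u\<close>.\<close>
    define R where "R = R0 + norm u"
    have BR: "?B \<subseteq> cball 0 R"
      by (rule order.trans[OF \<open>?B \<subseteq> cball 0 R0\<close>]) (simp add: R_def subset_cball)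
    have BR': "x \<in> cball 0 R" if "x - e n *\<^sub>R u \<in> ?B" for x n
    proof -
      have "norm (x - e n *\<^sub>R u) \<le> R0" using that \<open>?B \<subseteq> cball 0 R0\<close> by auto
      moreover have "norm (e n *\<^sub>R u) \<le> norm u" using e0(3,4)[of n] by (simp add: mult_left_le_one_le)
      ultimately have "norm x \<le> R"
        using norm_triangle_ineq[of "x - e n *\<^sub>R u" "e n *\<^sub>R u"] unfolding R_def by simp
      then show ?thesis by simp
    qed
    have dom: "integrable lborel (\<lambda>x. C * indicator (cball 0 R) x :: real)"
      by (rule integrable_indicator_cball)
    have iv: "integrable lborel (\<lambda>x. indicator ?B x * r x)"
      and lim1: "(\<lambda>n. \<integral>x. indicator ?B x * rn n x \<partial>lborel) \<longlonglongrightarrow> (\<integral>x. indicator ?B x * r x \<partial>lborel)"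
    proof -
      have m: "(\<lambda>x. indicator ?B x * r x) \<in> borel_measurable lborel"
          "\<And>n. (\<lambda>x. indicator ?B x * rn n x) \<in> borel_measurable lborel" by measurable
      have l: "AE x in lborel. (\<lambda>n. indicator ?B x * rn n x) \<longlonglongrightarrow> indicator ?B x * r x"
        using rnlim by eventually_elim (intro tendsto_intros)
      have bd: "\<And>n. AE x in lborel. norm (indicator ?B x * rn n x) \<le> C * indicator (cball 0 R) x"
        using rnb BR C0 by (intro AE_I2) (auto simp: indicator_def C_def)
      show "integrable lborel (\<lambda>x. indicator ?B x * r x)"
        by (rule integrable_dominated_convergence[OF m dom l bd])
      show "(\<lambda>n. \<integral>x. indicator ?B x * rn n x \<partial>lborel) \<longlonglongrightarrow> (\<integral>x. indicator ?B x * r x \<partial>lborel)"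
        by (rule integral_dominated_convergence[OF m dom l bd])
    qed
    have mshift: "(\<lambda>x. indicator ?B (x - e n *\<^sub>R u) :: real) \<in> borel_measurable borel" for n
    proof -
      have "(\<lambda>x. x - e n *\<^sub>R u) \<in> borel_measurable borel" by measurable
      then show ?thesis by (rule measurable_compose) measurable
    qed
    \<comment> \<open>A change of variables moves the shift from \<open>q v n\<close>, which is only
      bounded, to the indicator of the box, whose translates converge off its frontier.\<close>
    have eq: "(\<integral>x. indicator ?B x * rn n x \<partial>lborel) =
      (\<integral>x. q v n x * ?D n x \<partial>lborel)" for n
    proof -
      have mm: "(\<lambda>x. indicator ?B (x - e n *\<^sub>R u) * q v n x :: real) \<in> borel_measurable borel"
        by (intro borel_measurable_times qm mshift)
      have i1: "integrable lborel (\<lambda>x. indicator ?B x * q v n x)"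
        by (rule integrable_bounded_support[of _ C R])
          (use qb[of v n] BR C0 in \<open>auto simp: indicator_def intro: order.trans\<close>)
      have i2: "integrable lborel (\<lambda>x. indicator ?B (x - e n *\<^sub>R u) * q v n x)"
        by (rule integrable_bounded_support[of _ C R])
          (use qb[of v n] BR' C0 mm in \<open>auto simp: indicator_def intro: order.trans\<close>)
      have i3: "integrable lborel (\<lambda>x. indicator ?B x * q v n (x + e n *\<^sub>R u))"
      proof (rule integrable_bounded_support[of _ C R])
        have "(\<lambda>x. x + e n *\<^sub>R u) \<in> borel_measurable borel" by measurable
        then have "(\<lambda>x. q v n (x + e n *\<^sub>R u)) \<in> borel_measurable borel"
          by (rule measurable_compose) (rule qm)
        then show "(\<lambda>x. indicator ?B x * q v n (x + e n *\<^sub>R u)) \<in> borel_measurable borel"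
          by (intro borel_measurable_times) measurable
      qed (use qb[of v n] BR C0 in \<open>auto simp: indicator_def intro: order.trans\<close>)
      have "(\<integral>x. indicator ?B x * rn n x \<partial>lborel) =
        (\<integral>x. indicator ?B x * q v n (x + e n *\<^sub>R u) - indicator ?B x * q v n x \<partial>lborel)"
        by (simp add: rn_def right_diff_distrib)
      also have "\<dots> = (\<integral>x. indicator ?B x * q v n (x + e n *\<^sub>R u) \<partial>lborel) - (\<integral>x. indicator ?B x * q v n x \<partial>lborel)"
        by (rule Bochner_Integration.integral_diff[OF i3 i1])
      also have "(\<integral>x. indicator ?B x * q v n (x + e n *\<^sub>R u) \<partial>lborel) = (\<integral>x. indicator ?B (x - e n *\<^sub>R u) * q v n x \<partial>lborel)"
        using integral_shift_lborel[OF mm, of "e n *\<^sub>R u"] by simp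
      also have "\<dots> - (\<integral>x. indicator ?B x * q v n x \<partial>lborel) =
        (\<integral>x. indicator ?B (x - e n *\<^sub>R u) * q v n x - indicator ?B x * q v n x \<partial>lborel)"
        by (rule Bochner_Integration.integral_diff[OF i2 i1, symmetric])
      finally show ?thesis by (simp add: algebra_simps)
    qed
    have "(\<lambda>n. \<integral>x. q v n x * ?D n x \<partial>lborel) \<longlonglongrightarrow> integral\<^sup>L lborel (\<lambda>x::'a. 0)"
    proof (rule integral_dominated_convergence[OF _ _ dom])
      show "(\<lambda>x. q v n x * ?D n x) \<in> borel_measurable lborel" for n
        using mshift[of n] by simp
      show "AE x in lborel. norm (q v n x * ?D n x) \<le> C * indicator (cball 0 R) x" for n
      proof (rule AE_I2)
        fix x
        have "\<bar>q v n x\<bar> \<le> C" using qb[of v n x] C0 by linarith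
        then show "norm (q v n x * ?D n x) \<le> C * indicator (cball 0 R) x"
          using BR BR'[of x n] by (auto simp: indicator_def)
      qed
      have "negligible (frontier ?B)" by (rule negligible_convex_frontier) (rule convex_box)
      then have "frontier ?B \<in> null_sets lborel"
        by (rule null_sets_lborelI) simp
      moreover have "(\<lambda>n. q v n x * ?D n x) \<longlonglongrightarrow> 0" if x: "x \<notin> frontier ?B" for x
      proof -
        have lim: "(\<lambda>n. x - e n *\<^sub>R u) \<longlonglongrightarrow> x - 0 *\<^sub>R u" by (intro tendsto_intros e0)
        have "eventually (\<lambda>n. indicator ?B (x - e n *\<^sub>R u) = (indicator ?B x :: real)) sequentially"
        proof (cases "x \<in> ?B")
          case True
          then have "x \<in> interior ?B" using x by (simp add: frontier_def)
          then have "eventually (\<lambda>n. x - e n *\<^sub>R u \<in> interior ?B) sequentially"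
            using topological_tendstoD[OF lim open_interior, of ?B] by (simp del: interior_cbox)
          then show ?thesis
            by eventually_elim (use True interior_subset[of ?B] in auto)
        next
          case False
          then have "eventually (\<lambda>n. x - e n *\<^sub>R u \<in> - ?B) sequentially"
            using topological_tendstoD[OF lim, of "- ?B"] by (simp add: open_Compl closed_cbox)
          then show ?thesis
            by eventually_elim (use False in auto)
        qed
        then show ?thesis
          by (intro tendsto_eventually) (auto elim: eventually_mono)
      qed
      ultimately show "AE x in lborel. (\<lambda>n. q v n x * ?D n x) \<longlonglongrightarrow> 0"
        by (intro AE_I'[of "frontier ?B"]) auto
    qed auto
    then have "(\<integral>x. indicator ?B x * r x \<partial>lborel) = 0"
      using lim1 unfolding eq by (simp add: LIMSEQ_unique)
    then show ?thesis using iv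
      by (simp add: set_integrable_def set_lebesgue_integral_def)
  qed
  then obtain N where N: "negligible N" "\<And>x. x \<notin> N \<Longrightarrow> r x = 0"
    using AE_eq_0_if_integral_cbox_eq_0[of r] by metis
  have "{x. r x \<noteq> 0} \<in> sets borel" by measurable
  moreover have "negligible {x. r x \<noteq> 0}"
    by (rule negligible_subset[OF N(1)]) (use N(2) in auto)
  ultimately have "{x. r x \<noteq> 0} \<in> null_sets lborel"
    by (intro null_sets_lborelI)
  then show ?thesis
    by (rule AE_I') (auto simp: r_def)
qed

lemma dirderiv_scaleR:
  assumes "(\<lambda>t. F (x + t *\<^sub>R v)) differentiable (at 0)"
  shows "dirderiv F (c *\<^sub>R v) x = c * dirderiv F v x"
proof (rule dirderiv_eqI)
  have 1: "((\<lambda>t. c * t) has_real_derivative c) (at 0)"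
    by (auto intro!: derivative_eq_intros)
  have "((\<lambda>t. F (x + t *\<^sub>R v)) has_real_derivative dirderiv F v x) (at (c * 0))"
    using has_dirderiv[OF assms] by simp
  from DERIV_chain2[OF this 1]
  show "((\<lambda>t. F (x + t *\<^sub>R c *\<^sub>R v)) has_real_derivative c * dirderiv F v x) (at 0)"
    by (simp add: mult.commute)
qed

lemma dirderiv_sum:
  fixes F :: "'a::euclidean_space \<Rightarrow> real"
  assumes lip: "L-lipschitz_on UNIV F" and "finite A"
  shows "AE x in lborel. dirderiv F (\<Sum>b\<in>A. f b *\<^sub>R b) x = (\<Sum>b\<in>A. f b * dirderiv F b x)"
  using assms(2)
proof (induction A)
  case empty
  have "dirderiv F 0 x = 0" for x
    by (rule dirderiv_eqI) auto
  then show ?case by simp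
next
  case (insert a A)
  show ?case
    using insert.IH dirderiv_add[OF lip, of "f a *\<^sub>R a" "\<Sum>b\<in>A. f b *\<^sub>R b"]
      lipschitz_AE_directional_derivative[OF lip, of a]
  proof eventually_elim
    case (elim x)
    then show ?case
      using insert.hyps by (simp add: dirderiv_scaleR)
  qed
qed

text \<open>
  By the Lipschitz condition it suffices to differentiate in a finite number of directions from
  a dense set, as many as approximate the unit sphere to the desired precision.
\<close>

lemma lipschitz_has_derivative_if_dense:
  fixes F :: "'a::euclidean_space \<Rightarrow> real"
  assumes lip: "L-lipschitz_on UNIV F" and A: "linear A"
    and dense: "\<And>S. open S \<Longrightarrow> S \<noteq> {} \<Longrightarrow> \<exists>q\<in>Q. q \<in> S"
    and Q: "\<And>q. q \<in> Q \<Longrightarrow> ((\<lambda>t. F (x + t *\<^sub>R q)) has_real_derivative A q) (at 0)"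
  shows "(F has_derivative A) (at x)"
  unfolding has_derivative_at_alt
proof (intro conjI allI impI)
  show bl: "bounded_linear A" using A by (simp add: linear_conv_bounded_linear)
  fix e :: real assume e: "e > 0"
  define K where "K = L + onorm A + 1"
  have L0: "L \<ge> 0" using lip by (rule lipschitz_on_nonneg)
  have o0: "onorm A \<ge> 0" using bl by (rule onorm_pos_le)
  have K: "K > 0" using L0 o0 by (simp add: K_def)
  \<comment> \<open>The errors \<open>L * (t * \<eta>)\<close> and
    \<open>t * (onorm A * \<eta>)\<close> from replacing a direction by a nearby one then use up at
    most \<open>e / 2 * t\<close>; the other half is for the difference quotients in the chosen
    directions.\<close>
  define \<eta> where "\<eta> = e / (2 * K)"
  have \<eta>: "\<eta> > 0" using e K by (simp add: \<eta>_def)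
  have "sphere 0 1 \<subseteq> (\<Union>q\<in>Q. ball q \<eta>)"
  proof
    fix u :: 'a
    obtain q where "q \<in> Q" "q \<in> ball u \<eta>" using dense[of "ball u \<eta>"] \<eta> by auto
    then show "u \<in> (\<Union>q\<in>Q. ball q \<eta>)" by (auto simp: dist_commute)
  qed
  then obtain Q' where Q': "Q' \<subseteq> Q" "finite Q'" "sphere 0 1 \<subseteq> (\<Union>q\<in>Q'. ball q \<eta>)"
    using compactE_image[OF compact_sphere, of Q "\<lambda>q. ball q \<eta>" 0 1] by auto
  have "\<exists>d>0. \<forall>t. \<bar>t\<bar> < d \<longrightarrow> \<bar>F (x + t *\<^sub>R q) - F x - t * A q\<bar> \<le> e / 2 * \<bar>t\<bar>" if q: "q \<in> Q" for q
  proof -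
    have "((\<lambda>t. F (x + t *\<^sub>R q)) has_derivative (*) (A q)) (at 0)"
      using Q[OF q] by (simp add: has_field_derivative_def)
    then obtain d where "d > 0" "\<And>t. \<bar>t\<bar> < d \<Longrightarrow> \<bar>F (x + t *\<^sub>R q) - F x - A q * t\<bar> \<le> e / 2 * \<bar>t\<bar>"
      unfolding has_derivative_at_alt using half_gt_zero[OF e] by fastforce
    then show ?thesis by (auto simp: mult.commute)
  qed
  then obtain d where d: "\<And>q. q \<in> Q \<Longrightarrow> d q > 0"
    "\<And>q t. q \<in> Q \<Longrightarrow> \<bar>t\<bar> < d q \<Longrightarrow> \<bar>F (x + t *\<^sub>R q) - F x - t * A q\<bar> \<le> e / 2 * \<bar>t\<bar>"
    by metis
  define d0 where "d0 = Min (insert 1 (d ` Q'))"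
  have d0: "d0 > 0" "\<And>q. q \<in> Q' \<Longrightarrow> d0 \<le> d q"
    unfolding d0_def using Q' d(1) by (auto simp: Min_gr_iff)
  show "\<exists>d>0. \<forall>y. norm (y - x) < d \<longrightarrow> norm (F y - F x - A (y - x)) \<le> e * norm (y - x)"
  proof (intro exI[of _ d0] conjI allI impI)
    fix y assume y: "norm (y - x) < d0"
    show "norm (F y - F x - A (y - x)) \<le> e * norm (y - x)"
    proof (cases "y = x")
      case True
      then show ?thesis using linear_0[OF A] by simp
    next
      case False
      define t where "t = norm (y - x)"
      define u where "u = (y - x) /\<^sub>R t"
      have t: "t > 0" "t < d0" using False y by (auto simp: t_def)
      have yx: "y - x = t *\<^sub>R u" using t by (simp add: u_def)
      have "u \<in> sphere 0 1" using t by (simp add: u_def t_def)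
      then obtain q where q: "q \<in> Q'" "dist q u < \<eta>" using Q'(3) by auto
      have y': "y = x + t *\<^sub>R u" using yx by (simp add: algebra_simps)
      have 1: "\<bar>F y - F (x + t *\<^sub>R q)\<bar> \<le> L * (t * \<eta>)"
      proof -
        have "\<bar>F y - F (x + t *\<^sub>R q)\<bar> \<le> L * dist y (x + t *\<^sub>R q)"
          using lipschitz_onD[OF lip, of y "x + t *\<^sub>R q"] by (simp add: dist_real_def)
        also have "dist y (x + t *\<^sub>R q) = t * dist q u"
          using t by (simp add: y' dist_norm scaleR_diff_right[symmetric] norm_minus_commute)
        also have "L * (t * dist q u) \<le> L * (t * \<eta>)"
          using q t L0 by (intro mult_left_mono) auto
        finally show ?thesis .
      qed
      have 2: "\<bar>F (x + t *\<^sub>R q) - F x - t * A q\<bar> \<le> e / 2 * t"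
        using d(2)[of q t] q Q'(1) d0(2)[of q] t by auto
      have 3: "\<bar>t * A q - A (y - x)\<bar> \<le> t * (onorm A * \<eta>)"
      proof -
        have "t * A q - A (y - x) = t * A (q - u)"
          by (simp add: yx linear_cmul[OF A] linear_diff[OF A] right_diff_distrib)
        moreover have "\<bar>A (q - u)\<bar> \<le> onorm A * norm (q - u)"
          using onorm[OF bl, of "q - u"] by simp
        moreover have "onorm A * norm (q - u) \<le> onorm A * \<eta>"
          using q o0 by (intro mult_left_mono) (auto simp: dist_norm)
        ultimately show ?thesis using t by (simp add: abs_mult)
      qed
      have "\<bar>F y - F x - A (y - x)\<bar> \<le> L * (t * \<eta>) + e / 2 * t + t * (onorm A * \<eta>)"
        using 1 2 3 by linarith
      also have "\<dots> = t * (e / 2 + (L + onorm A) * \<eta>)" by (simp add: algebra_simps)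
      also have "(L + onorm A) * \<eta> \<le> K * \<eta>" using \<eta> by (simp add: K_def)
      also have "K * \<eta> = e / 2" using K by (simp add: \<eta>_def)
      finally show ?thesis using t by (simp add: t_def mult.commute)
    qed
  qed (rule d0)
qed

text \<open>Each direction has its own exceptional null set, and only countably many of these may be
  united. So the candidate \<open>A x\<close>, built from the partial derivatives, is tested on a
  countable dense set of directions, from which the Lipschitz condition extends it to all.\<close>

theorem rademacher_real:
  fixes F :: "'a::euclidean_space \<Rightarrow> real"
  assumes lip: "L-lipschitz_on UNIV F"
  shows "AE x in lborel. F differentiable (at x)"
proof -
  obtain Q :: "'a set" where Q: "countable Q" "\<And>S. open S \<Longrightarrow> S \<noteq> {} \<Longrightarrow> \<exists>q\<in>Q. q \<in> S"
    using countable_dense_exists[where 'a='a] by metis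
  define A where "A x v = (\<Sum>b\<in>Basis. (v \<bullet> b) * dirderiv F b x)" for x v
  have lin: "linear (A x)" for x
    unfolding A_def by (rule linearI) (simp_all add: inner_add_left algebra_simps sum.distrib sum_distrib_left)
  have "AE x in lborel. ((\<lambda>t. F (x + t *\<^sub>R q)) has_real_derivative A x q) (at 0)" for q
    using lipschitz_AE_directional_derivative[OF lip, of q]
      dirderiv_sum[OF lip finite_Basis, of "\<lambda>b. q \<bullet> b"]
  proof eventually_elim
    case (elim x)
    then have "dirderiv F q x = A x q" by (simp add: euclidean_representation A_def)
    then show ?case using has_dirderiv[OF elim(1)] by simp
  qed
  then have "AE x in lborel. \<forall>q\<in>Q. ((\<lambda>t. F (x + t *\<^sub>R q)) has_real_derivative A x q) (at 0)"
    using Q(1) by (simp add: AE_ball_countable)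
  then show ?thesis
  proof eventually_elim
    case (elim x)
    then have "(F has_derivative A x) (at x)"
      by (intro lipschitz_has_derivative_if_dense[OF lip lin Q(2)]) auto
    then show ?case by (rule differentiableI)
  qed
qed

theorem rademacher:
  fixes G :: "'a::euclidean_space \<Rightarrow> 'b::euclidean_space"
  assumes lip: "L-lipschitz_on UNIV G"
  shows "AE x in lborel. G differentiable (at x)"
proof -
  have "L-lipschitz_on UNIV (\<lambda>x. G x \<bullet> i)" if "i \<in> Basis" for i
  proof (rule lipschitz_onI)
    fix x y
    have "dist (G x \<bullet> i) (G y \<bullet> i) \<le> dist (G x) (G y)"
      using Basis_le_norm[OF that, of "G x - G y"] by (simp add: dist_norm inner_diff_left)
    also have "\<dots> \<le> L * dist x y" by (rule lipschitz_onD[OF lip]) auto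
    finally show "dist (G x \<bullet> i) (G y \<bullet> i) \<le> L * dist x y" .
  qed (rule lipschitz_on_nonneg[OF lip])
  then have "AE x in lborel. \<forall>i\<in>Basis. (\<lambda>x. G x \<bullet> i) differentiable (at x)"
    by (intro AE_finite_allI rademacher_real) auto
  then show ?thesis
    by eventually_elim (simp add: differentiable_componentwise_within[of G])
qed

section \<open>The mean value inequality along a segment\<close>

lemma AE_lborel_shift:
  fixes c :: "'a::euclidean_space"
  assumes "AE x in lborel. P x"
  shows "AE x in lborel. P (x + c)"
proof -
  obtain N where N: "{x. \<not> P x} \<subseteq> N" "N \<in> sets lborel" "emeasure lborel N = 0"
    using AE_E[OF assms] by auto
  have m: "(+) c \<in> measurable lborel borel" by measurable
  have "emeasure lborel N = emeasure lborel ((+) c -` N)"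
    using N(2) emeasure_distr[OF m, of N] by (simp add: lborel_distr_plus)
  moreover have "(+) c -` N \<in> sets lborel"
    using measurable_sets[OF m, of N] N(2) by simp
  ultimately have "(+) c -` N \<in> null_sets lborel" using N(3) by (auto simp: null_sets_def)
  then show ?thesis
    by (rule AE_I') (use N(1) in \<open>auto simp: add.commute\<close>)
qed

text \<open>
  Averaging over a small ball, in order that an estimate almost everywhere can be integrated
  along the segment.
\<close>

lemma lipschitz_directional_mean_value:
  fixes G :: "'a::euclidean_space \<Rightarrow> 'b::euclidean_space"
  assumes lip: "L-lipschitz_on UNIV G" and S: "open S"
    and seg: "\<And>s. 0 \<le> s \<Longrightarrow> s \<le> t \<Longrightarrow> x + s *\<^sub>R v \<in> S" and t: "0 \<le> t"
    and D: "\<And>\<xi> D. \<xi> \<in> S \<Longrightarrow> (G has_derivative D) (at \<xi>) \<Longrightarrow> \<delta> \<le> w \<bullet> D v"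
  shows "\<delta> * t \<le> w \<bullet> (G (x + t *\<^sub>R v) - G x)"
proof -
  define \<phi> where "\<phi> y = w \<bullet> G y" for y
  define M where "M = norm w * L"
  have lip\<phi>: "M-lipschitz_on UNIV \<phi>"
  proof (rule lipschitz_onI)
    fix y z
    have "dist (\<phi> y) (\<phi> z) \<le> norm w * norm (G y - G z)"
      unfolding \<phi>_def dist_real_def by (metis inner_diff_right Cauchy_Schwarz_ineq2)
    also have "\<dots> \<le> norm w * (L * dist y z)"
      using lipschitz_onD[OF lip, of y z] by (intro mult_left_mono) (auto simp: dist_norm)
    finally show "dist (\<phi> y) (\<phi> z) \<le> M * dist y z" by (simp add: M_def mult.assoc)
  qed (use lipschitz_on_nonneg[OF lip] in \<open>simp add: M_def\<close>)
  have M0: "M \<ge> 0" using lip\<phi> by (rule lipschitz_on_nonneg)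
  have cont\<phi>: "continuous_on UNIV \<phi>" using lip\<phi> by (rule lipschitz_on_continuous_on)
  have "compact ((\<lambda>s. x + s *\<^sub>R v) ` {0..t})"
    by (intro compact_continuous_image continuous_intros compact_Icc)
  moreover have "(\<lambda>s. x + s *\<^sub>R v) ` {0..t} \<subseteq> S" using seg by auto
  ultimately obtain e where e: "e > 0" "(\<Union>y\<in>(\<lambda>s. x + s *\<^sub>R v) ` {0..t}. ball y e) \<subseteq> S"
    using compact_subset_open_imp_ball_epsilon_subset[OF _ S] by blast
  have diffAE: "AE y in lborel. G differentiable (at y)"
    by (rule rademacher[OF lip])
  \<comment> \<open>The term \<open>2 * M * \<rho>\<close> bounds the changes of
    \<open>\<phi>\<close> at the two ends of the segment when the segment is translated by less than
    \<open>\<rho>\<close>; it vanishes as \<open>\<rho>\<close> tends to zero.\<close>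
  have key: "\<delta> * t \<le> \<phi> (x + t *\<^sub>R v) - \<phi> x + 2 * M * \<rho>" if \<rho>: "0 < \<rho>" "\<rho> \<le> e" for \<rho>
  proof -
    let ?B = "ball x \<rho>"
    have mB: "(\<lambda>y. indicator ?B y :: real) \<in> borel_measurable borel"
      by (intro borel_measurable_indicator) simp
    have Bfin: "emeasure lborel ?B < \<infinity>"
      by (rule emeasure_bounded_finite[OF bounded_ball])
    have indB: "integrable lborel (\<lambda>y. indicator ?B y * C :: real)" for C
      using Bfin by (intro integrable_mult_left) (simp add: integrable_indicator_iff)
    define R where "R = norm x + \<rho>"
    have BR: "?B \<subseteq> cball 0 R"
    proof
      fix y assume "y \<in> ?B"
      then have "norm (x - y) < \<rho>" by (simp add: dist_norm)
      then show "y \<in> cball 0 R" using norm_triangle_ineq4[of x "x - y"] by (simp add: R_def)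
    qed
    have int\<phi>: "integrable lborel (\<lambda>y. indicator ?B y * \<phi> (y + c))" for c
    proof -
      have "continuous_on (cball 0 R) (\<lambda>y. \<phi> (y + c))"
        by (rule continuous_on_shift[OF cont\<phi>])
      then have "compact ((\<lambda>y. \<phi> (y + c)) ` cball 0 R)"
        by (rule compact_continuous_image) (rule compact_cball)
      then obtain C where C: "\<And>y. y \<in> cball 0 R \<Longrightarrow> \<bar>\<phi> (y + c)\<bar> \<le> C"
        using compact_imp_bounded[of "(\<lambda>y. \<phi> (y + c)) ` cball 0 R"]
        by (auto simp only: bounded_iff ball_simps real_norm_def)
      show ?thesis
      proof (rule integrable_bounded_support[of _ C R])
        show "(\<lambda>y. indicator ?B y * \<phi> (y + c)) \<in> borel_measurable borel"
          by (intro borel_measurable_times borel_measurable_shift cont\<phi> mB)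
        show "\<bar>indicator ?B y * \<phi> (y + c)\<bar> \<le> C * indicator (cball 0 R) y" for y
          using C[of y] BR by (auto simp: indicator_def)
      qed
    qed
    \<comment> \<open>Integrating over the starting points gives a function differentiable at every
      \<open>s\<close> in question, by dominated convergence: for each \<open>s\<close> and almost
      all \<open>y\<close>, the map \<open>G\<close> is differentiable at
      \<open>y + s *\<^sub>R v\<close>.\<close>
    define \<Phi> where "\<Phi> s = (\<integral>y. indicator ?B y * \<phi> (y + s *\<^sub>R v) \<partial>lborel)" for s
    have deriv: "\<exists>c. (\<Phi> has_real_derivative c) (at s) \<and> \<delta> * measure lborel ?B \<le> c" if s: "0 \<le> s" "s \<le> t" for s
    proof (intro exI conjI)
      let ?d = "\<lambda>y. indicator ?B y * dirderiv \<phi> v (y + s *\<^sub>R v)"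
      have md: "?d \<in> borel_measurable borel"
      proof (intro borel_measurable_times)
        have "(\<lambda>y. y + s *\<^sub>R v) \<in> borel_measurable borel" by measurable
        then show "(\<lambda>y. dirderiv \<phi> v (y + s *\<^sub>R v)) \<in> borel_measurable borel"
          by (rule measurable_compose) (rule borel_measurable_dirderiv[OF cont\<phi>])
      qed (rule mB)
      have diff: "AE y in lborel. G differentiable (at (y + s *\<^sub>R v))"
        using AE_lborel_shift[OF diffAE] .
      have dd: "((\<lambda>h. \<phi> (z + h *\<^sub>R v)) has_real_derivative w \<bullet> D v) (at 0)"
        if "(G has_derivative D) (at z)" for z D
      proof -
        have 1: "((\<lambda>h. z + h *\<^sub>R v) has_derivative (\<lambda>h. h *\<^sub>R v)) (at 0)"
          by (auto intro!: derivative_eq_intros)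
        have "(G has_derivative D) (at (z + 0 *\<^sub>R v))" using that by simp
        from has_derivative_compose[OF 1 this]
        have "((\<lambda>h. G (z + h *\<^sub>R v)) has_derivative (\<lambda>h. D (h *\<^sub>R v))) (at 0)" .
        then have "((\<lambda>h. w \<bullet> G (z + h *\<^sub>R v)) has_derivative (\<lambda>h. w \<bullet> D (h *\<^sub>R v))) (at 0)"
          by (rule has_derivative_inner_right)
        moreover have "(\<lambda>h. w \<bullet> D (h *\<^sub>R v)) = (*) (w \<bullet> D v)"
          using has_derivative_linear[OF that] by (auto simp: linear_cmul)
        ultimately show ?thesis by (simp add: has_field_derivative_def \<phi>_def)
      qed
      have conv: "integrable lborel ?d \<and>
          (\<lambda>n. \<integral>y. indicator ?B y * ((\<phi> (y + s *\<^sub>R v + X n *\<^sub>R v) - \<phi> (y + s *\<^sub>R v)) / X n) \<partial>lborel)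
            \<longlonglongrightarrow> (\<integral>y. ?d y \<partial>lborel)"
        if X: "X \<longlonglongrightarrow> 0" "\<And>n. X n \<noteq> 0" for X
      proof -
        let ?q = "\<lambda>n y. indicator ?B y * ((\<phi> (y + s *\<^sub>R v + X n *\<^sub>R v) - \<phi> (y + s *\<^sub>R v)) / X n)"
        have m: "?d \<in> borel_measurable lborel" "\<And>n. ?q n \<in> borel_measurable lborel"
          using md unfolding add.assoc measurable_lborel1
          by (auto intro!: borel_measurable_times borel_measurable_divide borel_measurable_diff
            borel_measurable_shift cont\<phi> mB)
        have l: "AE y in lborel. (\<lambda>n. ?q n y) \<longlonglongrightarrow> ?d y"
          using diff
        proof eventually_elim
          case (elim y)
          then obtain D where "(G has_derivative D) (at (y + s *\<^sub>R v))" by (auto simp: differentiable_def)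
          note d' = dd[OF this]
          show ?case
            by (intro tendsto_mult tendsto_const) (use dirderiv_LIMSEQ[OF d' X] dirderiv_eqI[OF d'] in simp)
        qed
        have b: "\<And>n. AE y in lborel. norm (?q n y) \<le> indicator ?B y * (M * norm v)"
          using lipschitz_quotient_bound[OF lip\<phi>] by (intro AE_I2) (auto simp: indicator_def)
        show ?thesis
          using integrable_dominated_convergence[OF m indB l b] integral_dominated_convergence[OF m indB l b]
          by blast
      qed
      have intd: "integrable lborel ?d"
        using conv[OF inverse_Suc_LIMSEQ] by simp
      show "(\<Phi> has_real_derivative (\<integral>y. ?d y \<partial>lborel)) (at s)"
        unfolding DERIV_def tendsto_at_iff_sequentially
      proof (intro allI impI)
        fix X :: "nat \<Rightarrow> real"
        assume X: "\<forall>i. X i \<in> UNIV - {0}" "X \<longlonglongrightarrow> 0"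
        have "(\<Phi> (s + X n) - \<Phi> s) / X n =
          (\<integral>y. indicator ?B y * ((\<phi> (y + s *\<^sub>R v + X n *\<^sub>R v) - \<phi> (y + s *\<^sub>R v)) / X n) \<partial>lborel)" for n
        proof -
          have "\<Phi> (s + X n) - \<Phi> s =
            (\<integral>y. indicator ?B y * \<phi> (y + (s + X n) *\<^sub>R v) - indicator ?B y * \<phi> (y + s *\<^sub>R v) \<partial>lborel)"
            unfolding \<Phi>_def by (rule Bochner_Integration.integral_diff[OF int\<phi> int\<phi>, symmetric])
          also have "\<dots> / X n =
            (\<integral>y. (indicator ?B y * \<phi> (y + (s + X n) *\<^sub>R v) - indicator ?B y * \<phi> (y + s *\<^sub>R v)) / X n \<partial>lborel)"
            by simp
          also have "\<dots> = (\<integral>y. indicator ?B y * ((\<phi> (y + s *\<^sub>R v + X n *\<^sub>R v) - \<phi> (y + s *\<^sub>R v)) / X n) \<partial>lborel)"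
            by (intro Bochner_Integration.integral_cong) (simp_all add: scaleR_add_left add.assoc right_diff_distrib)
          finally show ?thesis .
        qed
        then show "((\<lambda>h. (\<Phi> (s + h) - \<Phi> s) / h) \<circ> X) \<longlonglongrightarrow> (\<integral>y. ?d y \<partial>lborel)"
          using conv[of X] X by (simp add: comp_def)
      qed
      have "(\<integral>y. indicator ?B y * \<delta> \<partial>lborel) \<le> (\<integral>y. ?d y \<partial>lborel)"
      proof (rule integral_mono_AE[OF indB intd])
        show "AE y in lborel. indicator ?B y * \<delta> \<le> ?d y"
          using diff
        proof eventually_elim
          case (elim y)
          then obtain D' where D': "(G has_derivative D') (at (y + s *\<^sub>R v))" by (auto simp: differentiable_def)
          show ?case
          proof (cases "y \<in> ?B")
            case True
            then have "y + s *\<^sub>R v \<in> ball (x + s *\<^sub>R v) e" using \<rho> by (simp add: dist_norm)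
            moreover have "x + s *\<^sub>R v \<in> (\<lambda>s. x + s *\<^sub>R v) ` {0..t}" using s by (intro imageI) simp
            ultimately have "y + s *\<^sub>R v \<in> S" using e(2) by blast
            from D[OF this D'] show ?thesis
              using True dirderiv_eqI[OF dd[OF D']] by simp
          qed simp
        qed
      qed
      then show "\<delta> * measure lborel ?B \<le> (\<integral>y. ?d y \<partial>lborel)"
        by (simp add: mult.commute)
    qed
    have "\<Phi> 0 - \<delta> * measure lborel ?B * 0 \<le> \<Phi> t - \<delta> * measure lborel ?B * t"
    proof (rule DERIV_nonneg_imp_nondecreasing[OF t, of "\<lambda>s. \<Phi> s - \<delta> * measure lborel ?B * s"])
      fix s assume "0 \<le> s" "s \<le> t"
      from deriv[OF this] obtain c where "(\<Phi> has_real_derivative c) (at s)" "\<delta> * measure lborel ?B \<le> c" by blast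
      then show "\<exists>y. ((\<lambda>s. \<Phi> s - \<delta> * measure lborel ?B * s) has_real_derivative y) (at s) \<and> 0 \<le> y"
        by (intro exI[of _ "c - \<delta> * measure lborel ?B"]) (auto intro!: derivative_eq_intros)
    qed
    then have "\<delta> * measure lborel ?B * t \<le> \<Phi> t - \<Phi> 0" by simp
    also have "\<Phi> t - \<Phi> 0 = (\<integral>y. indicator ?B y * \<phi> (y + t *\<^sub>R v) - indicator ?B y * \<phi> (y + 0 *\<^sub>R v) \<partial>lborel)"
      unfolding \<Phi>_def by (rule Bochner_Integration.integral_diff[OF int\<phi> int\<phi>, symmetric])
    also have "\<dots> \<le> (\<integral>y. indicator ?B y * (\<phi> (x + t *\<^sub>R v) - \<phi> x + 2 * M * \<rho>) \<partial>lborel)"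
    proof (rule integral_mono[OF Bochner_Integration.integrable_diff[OF int\<phi> int\<phi>] indB])
      fix y
      show "indicator ?B y * \<phi> (y + t *\<^sub>R v) - indicator ?B y * \<phi> (y + 0 *\<^sub>R v) \<le>
        indicator ?B y * (\<phi> (x + t *\<^sub>R v) - \<phi> x + 2 * M * \<rho>)"
      proof (cases "y \<in> ?B")
        case True
        have "\<bar>\<phi> (y + t *\<^sub>R v) - \<phi> (x + t *\<^sub>R v)\<bar> \<le> M * dist y x" "\<bar>\<phi> y - \<phi> x\<bar> \<le> M * dist y x"
          using lipschitz_onD[OF lip\<phi>, of "y + t *\<^sub>R v" "x + t *\<^sub>R v"] lipschitz_onD[OF lip\<phi>, of y x]
          by (auto simp: dist_norm)
        moreover have "M * dist y x \<le> M * \<rho>"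
          using True M0 by (intro mult_left_mono) (auto simp: dist_commute)
        ultimately show ?thesis using True by simp
      qed simp
    qed
    also have "\<dots> = measure lborel ?B * (\<phi> (x + t *\<^sub>R v) - \<phi> x + 2 * M * \<rho>)"
      by simp
    finally have "measure lborel ?B * (\<delta> * t) \<le> measure lborel ?B * (\<phi> (x + t *\<^sub>R v) - \<phi> x + 2 * M * \<rho>)"
      by (simp add: mult_ac)
    moreover have "measure lborel ?B > 0"
      using content_ball_pos[OF \<rho>(1), of x] by simp
    ultimately show ?thesis by simp
  qed
  have "((\<lambda>\<rho>. \<phi> (x + t *\<^sub>R v) - \<phi> x + 2 * M * \<rho>) \<longlongrightarrow> \<phi> (x + t *\<^sub>R v) - \<phi> x + 2 * M * 0) (at_right 0)"
    by (intro tendsto_intros)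
  moreover have "eventually (\<lambda>\<rho>. \<delta> * t \<le> \<phi> (x + t *\<^sub>R v) - \<phi> x + 2 * M * \<rho>) (at_right 0)"
    unfolding eventually_at_right_field using e(1) key by (intro exI[of _ e]) auto
  ultimately have "\<delta> * t \<le> \<phi> (x + t *\<^sub>R v) - \<phi> x + 2 * M * 0"
    by (rule tendsto_lowerbound) simp
  then show ?thesis by (simp add: \<phi>_def inner_diff_right)
qed

section \<open>The smallest singular value\<close>

lemma gram_inner: "((transpose A ** A) *v x) \<bullet> y = (A *v x) \<bullet> (A *v y)"
  for A :: "real ^ 'm ^ 'n"
  by (simp add: matrix_vector_mul_assoc[symmetric] dot_lmul_matrix[symmetric] inner_commute)

lemma norm_add_scaleR_squared:
  "(norm (a + t *\<^sub>R b))\<^sup>2 = (norm a)\<^sup>2 + 2 * t * (a \<bullet> b) + t\<^sup>2 * (norm b)\<^sup>2"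
  unfolding power2_norm_eq_inner
  by (simp add: inner_add_left inner_add_right inner_commute[of b a] power2_eq_square algebra_simps)

text \<open>A minimiser \<open>u\<close> of the Rayleigh quotient on the unit sphere of
  \<open>W\<close> is an eigenvector of \<open>transpose A ** A\<close>: by minimality the residual
  \<open>z\<close> is orthogonal to \<open>W\<close>, and by invariance it lies in
  \<open>W\<close>.\<close>

lemma gram_minimizer:
  fixes A :: "real ^ 'm ^ 'n"
  assumes W: "subspace W" "W \<noteq> {0}"
    and inv: "\<And>w. w \<in> W \<Longrightarrow> (transpose A ** A) *v w \<in> W"
  obtains u where "u \<in> W" "norm u = 1" "u \<in> singular_eigenspace A (norm (A *v u))"
    "\<And>w. w \<in> W \<Longrightarrow> norm (A *v u) * norm w \<le> norm (A *v w)"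
proof -
  obtain w0 where w0: "w0 \<in> W" "w0 \<noteq> 0" using W subspace_0 by blast
  have "compact (sphere 0 1 \<inter> W)"
    by (intro compact_Int_closed compact_sphere closed_subspace W)
  moreover have "w0 /\<^sub>R norm w0 \<in> sphere 0 1 \<inter> W"
    using w0 W by (simp add: subspace_scale)
  then have "sphere 0 1 \<inter> W \<noteq> {}" by blast
  moreover have "continuous_on (sphere 0 1 \<inter> W) (\<lambda>x. norm (A *v x))"
    by (intro continuous_intros)
  ultimately obtain u where u: "u \<in> sphere 0 1 \<inter> W"
    and umin: "\<And>y. y \<in> sphere 0 1 \<inter> W \<Longrightarrow> norm (A *v u) \<le> norm (A *v y)"
    using continuous_attains_inf by metis
  have uW: "u \<in> W" "norm u = 1" using u by auto
  have min: "norm (A *v u) * norm w \<le> norm (A *v w)" if w: "w \<in> W" for w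
  proof (cases "w = 0")
    case False
    have "w /\<^sub>R norm w \<in> sphere 0 1 \<inter> W"
      using False w W by (simp add: subspace_scale)
    from umin[OF this] have "norm (A *v u) \<le> norm (A *v w) / norm w"
      by (simp add: matrix_vector_mult_scaleR divide_inverse mult.commute)
    then show ?thesis using False by (simp add: field_simps)
  qed simp
  define l where "l = norm (A *v u)"
  \<comment> \<open>First variation: a quadratic polynomial in \<open>t\<close> without constant
    term that is never negative has no linear term.\<close>
  have crit: "(A *v u) \<bullet> (A *v w) - l\<^sup>2 * (u \<bullet> w) = 0" if w: "w \<in> W" for w
  proof -
    define p where "p = (A *v u) \<bullet> (A *v w) - l\<^sup>2 * (u \<bullet> w)"
    define q where "q = (norm (A *v w))\<^sup>2 - l\<^sup>2 * (norm w)\<^sup>2"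
    have quad: "0 \<le> 2 * t * p + t\<^sup>2 * q" for t
    proof -
      have "l * norm (u + t *\<^sub>R w) \<le> norm (A *v (u + t *\<^sub>R w))"
        unfolding l_def using uW w W by (intro min subspace_add subspace_scale)
      then have "(l * norm (u + t *\<^sub>R w))\<^sup>2 \<le> (norm (A *v (u + t *\<^sub>R w)))\<^sup>2"
        by (intro power_mono) (simp_all add: l_def)
      moreover have "(norm (A *v (u + t *\<^sub>R w)))\<^sup>2 = l\<^sup>2 + 2 * t * ((A *v u) \<bullet> (A *v w)) + t\<^sup>2 * (norm (A *v w))\<^sup>2"
        by (simp add: l_def matrix_vector_right_distrib matrix_vector_mult_scaleR norm_add_scaleR_squared)
      moreover have "(l * norm (u + t *\<^sub>R w))\<^sup>2 = l\<^sup>2 * (1 + 2 * t * (u \<bullet> w) + t\<^sup>2 * (norm w)\<^sup>2)"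
      proof -
        show ?thesis using uW by (simp add: power_mult_distrib norm_add_scaleR_squared)
      qed
      ultimately show ?thesis by (simp add: p_def q_def algebra_simps)
    qed
    have q0: "q \<ge> 0" using quad[of 1] quad[of "-1"] by simp
    have "p = 0"
    proof (rule ccontr)
      assume p: "p \<noteq> 0"
      \<comment> \<open>For positive \<open>q\<close> the polynomial is smallest at
        \<open>- p / q\<close>; adding one avoids a division by zero and still gives a negative
        value.\<close>
      define t where "t = - p / (q + 1)"
      have "2 * t * p + t\<^sup>2 * q = - (p\<^sup>2 * (q + 2)) / (q + 1)\<^sup>2"
        using q0 by (simp add: t_def power2_eq_square divide_simps) (simp add: algebra_simps)
      moreover have "p\<^sup>2 * (q + 2) / (q + 1)\<^sup>2 > 0"
        using p q0 by (intro divide_pos_pos mult_pos_pos) auto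
      ultimately show False using quad[of t] by simp
    qed
    then show ?thesis by (simp add: p_def)
  qed
  define z where "z = (transpose A ** A) *v u - l\<^sup>2 *\<^sub>R u"
  have "z \<in> W" unfolding z_def using inv uW W by (intro subspace_diff subspace_scale)
  then have "z \<bullet> z = 0"
    using crit[of z] by (simp add: gram_inner[symmetric] z_def inner_diff_left)
  then have "u \<in> singular_eigenspace A (norm (A *v u))"
    by (simp add: z_def singular_eigenspace_def l_def)
  with uW min that show thesis by blast
qed

lemma subspace_singular_eigenspace: "subspace (singular_eigenspace A s)"
  unfolding subspace_def singular_eigenspace_def
  by (auto simp: matrix_vector_right_distrib matrix_vector_mult_scaleR scaleR_add_right mult.commute)

lemma norm_singular_eigenvector:
  assumes "v \<in> singular_eigenspace A s" "0 \<le> s"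
  shows "norm (A *v v) = s * norm v"
proof -
  have "(norm (A *v v))\<^sup>2 = (s * norm v)\<^sup>2"
    using assms(1) gram_inner[of A v v] unfolding singular_eigenspace_def
    by (simp add: power2_norm_eq_inner power_mult_distrib)
  then show ?thesis using assms(2) by (simp add: power2_eq_iff_nonneg)
qed

lemma orthogonal_singular_eigenspaces:
  assumes "v \<in> singular_eigenspace A s" "w \<in> singular_eigenspace A r" "0 \<le> s" "0 \<le> r" "s \<noteq> r"
  shows "orthogonal v w"
proof -
  have "s\<^sup>2 * (v \<bullet> w) = r\<^sup>2 * (v \<bullet> w)"
    using assms(1,2) gram_inner[of A v w] gram_inner[of A w v]
    unfolding singular_eigenspace_def by (simp add: inner_commute)
  moreover have "s\<^sup>2 \<noteq> r\<^sup>2" using assms(3-5) by (simp add: power2_eq_iff_nonneg)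
  ultimately show ?thesis by (simp add: orthogonal_def)
qed

text \<open>The spectral theorem for \<open>transpose A ** A\<close>. Eigenspaces are mutually
  orthogonal, which bounds their number; the orthogonal complement \<open>W\<close> of their sum is
  invariant, so if it were nonzero it would contain a further eigenvector. Finiteness also matters
  because the sum in \<open>singular_values\<close> would be zero by default over an infinite index
  set.\<close>

lemma
  fixes A :: "real ^ 'm ^ 'n"
  defines "T \<equiv> {s. 0 \<le> s \<and> singular_eigenspace A s \<noteq> {0}}"
  shows finite_singular_spectrum: "finite T"
    and sum_dim_singular_eigenspaces: "(\<Sum>s\<in>T. dim (singular_eigenspace A s)) = CARD('m)"
proof -
  have "\<exists>B. B \<subseteq> singular_eigenspace A s \<and> pairwise orthogonal B \<and> 0 \<notin> B \<and> independent B \<and>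
      card B = dim (singular_eigenspace A s) \<and> span B = singular_eigenspace A s" for s
  proof -
    obtain B where B: "B \<subseteq> singular_eigenspace A s" "pairwise orthogonal B" "\<And>x. x \<in> B \<Longrightarrow> norm x = 1"
      "independent B" "card B = dim (singular_eigenspace A s)" "span B = singular_eigenspace A s"
      using orthonormal_basis_subspace[OF subspace_singular_eigenspace] by metis
    then have "0 \<notin> B" by force
    with B show ?thesis by blast
  qed
  then obtain B where B: "\<And>s. B s \<subseteq> singular_eigenspace A s" "\<And>s. pairwise orthogonal (B s)"
    "\<And>s. 0 \<notin> B s" "\<And>s. independent (B s)" "\<And>s. card (B s) = dim (singular_eigenspace A s)"
    "\<And>s. span (B s) = singular_eigenspace A s"
    by metis
  have finB: "finite (B s)" for s using B(4) by (rule independent_imp_finite)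
  have orth: "orthogonal v w" if "v \<in> B s" "w \<in> B r" "s \<in> T" "r \<in> T" "s \<noteq> r" for v w s r
  proof (rule orthogonal_singular_eigenspaces)
    show "v \<in> singular_eigenspace A s" "w \<in> singular_eigenspace A r" using that B(1) by blast+
    show "0 \<le> s" "0 \<le> r" using that by (simp_all add: T_def)
  qed (rule that)
  have disj: "B s \<inter> B r = {}" if "s \<in> T" "r \<in> T" "s \<noteq> r" for s r
  proof (rule equals0I)
    fix x assume x: "x \<in> B s \<inter> B r"
    then have "orthogonal x x" using orth[of x s x r] that by blast
    then have "x = 0" by (simp add: orthogonal_self)
    then show False using x B(3)[of s] by blast
  qed
  define U where "U = (\<Union>s\<in>T. B s)"
  have "pairwise orthogonal U"
    unfolding pairwise_def
  proof (intro ballI impI)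
    fix v w assume v: "v \<in> U" and w: "w \<in> U" and vw: "v \<noteq> w"
    obtain s r where sr: "s \<in> T" "v \<in> B s" "r \<in> T" "w \<in> B r"
      using v w by (auto simp: U_def)
    show "orthogonal v w"
    proof (cases "s = r")
      case True
      then show ?thesis using B(2)[of s] sr vw by (auto simp: pairwise_def)
    next
      case False
      then show ?thesis using orth sr by blast
    qed
  qed
  moreover have "0 \<notin> U" using B(3) by (auto simp: U_def)
  ultimately have indU: "independent U" by (rule pairwise_orthogonal_independent)
  then have finU: "finite U" by (rule independent_imp_finite)
  have Bne: "B s \<noteq> {}" if "s \<in> T" for s
    using that B(6)[of s] by (auto simp: T_def)
  show finT: "finite T"
  proof (rule finite_imageD)
    show "finite (B ` T)" by (rule finite_subset[of _ "Pow U"]) (auto simp: U_def finU[unfolded U_def])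
    show "inj_on B T"
    proof (rule inj_onI, rule ccontr)
      fix s r assume "s \<in> T" "r \<in> T" "B s = B r" "s \<noteq> r"
      then show False using disj[of s r] Bne[of s] by simp
    qed
  qed
  have "card U = (\<Sum>s\<in>T. card (B s))"
    unfolding U_def by (rule card_UN_disjoint) (use finT finB disj in auto)
  also have "\<dots> = (\<Sum>s\<in>T. dim (singular_eigenspace A s))" by (simp add: B(5))
  finally have card: "card U = (\<Sum>s\<in>T. dim (singular_eigenspace A s))" .
  define W where "W = {w. \<forall>v\<in>U. orthogonal v w}"
  have "W = {0}"
  proof (rule ccontr)
    assume W0: "W \<noteq> {0}"
    have W: "subspace W"
      unfolding W_def by (auto simp: subspace_def orthogonal_clauses)
    have inv: "(transpose A ** A) *v w \<in> W" if w: "w \<in> W" for w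
      unfolding W_def
    proof (intro CollectI ballI)
      fix v assume v: "v \<in> U"
      then obtain s where "v \<in> singular_eigenspace A s" using B(1) by (auto simp: U_def)
      then have "((transpose A ** A) *v w) \<bullet> v = s\<^sup>2 * (w \<bullet> v)"
        using gram_inner[of A w v] gram_inner[of A v w]
        unfolding singular_eigenspace_def by (simp add: inner_commute)
      also have "w \<bullet> v = 0" using w v by (auto simp: W_def orthogonal_def inner_commute)
      finally show "orthogonal v ((transpose A ** A) *v w)" by (simp add: orthogonal_def inner_commute)
    qed
    obtain u where u: "u \<in> W" "norm u = 1" "u \<in> singular_eigenspace A (norm (A *v u))"
      by (rule gram_minimizer[OF W W0 inv])
    have "u \<noteq> 0" using u(2) by auto
    then have "singular_eigenspace A (norm (A *v u)) \<noteq> {0}" using u(3) by blast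
    then have "norm (A *v u) \<in> T" by (simp add: T_def)
    then have "u \<in> span (B (norm (A *v u)))" using u(3) B(6) by simp
    moreover have "orthogonal u x" if "x \<in> B (norm (A *v u))" for x
      using u(1) that \<open>norm (A *v u) \<in> T\<close> by (auto simp: W_def U_def orthogonal_commute[of u])
    ultimately have "orthogonal u u" by (rule orthogonal_to_span)
    then show False using u(2) by (simp add: orthogonal_self)
  qed
  have "span U = UNIV"
  proof (rule ccontr)
    assume "span U \<noteq> UNIV"
    then obtain z where z: "z \<noteq> 0" "\<And>x. x \<in> span U \<Longrightarrow> orthogonal z x"
      using orthogonal_to_subspace_exists_gen[of U UNIV] by (auto simp: span_UNIV)
    then have "z \<in> W" by (auto simp: W_def span_base orthogonal_commute)
    then show False using \<open>W = {0}\<close> z(1) by simp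
  qed
  then have "card U = CARD('m)"
    using dim_eq_card_independent[OF indU] dim_span[of U] by simp
  with card show "(\<Sum>s\<in>T. dim (singular_eigenspace A s)) = CARD('m)" by simp
qed

lemma
  fixes A :: "real ^ 'm ^ 'n"
  shows size_singular_values: "size (singular_values A) = CARD('m)"
    and set_singular_values: "set_mset (singular_values A) = {s. 0 \<le> s \<and> singular_eigenspace A s \<noteq> {0}}"
proof -
  let ?T = "{s. 0 \<le> s \<and> singular_eigenspace A s \<noteq> {0}}"
  have fin: "finite ?T" by (rule finite_singular_spectrum)
  have 1: "size (\<Sum>s\<in>S. replicate_mset (d s) s) = (\<Sum>s\<in>S. d s)" if "finite S" for d and S :: "real set"
    using that by induction auto
  have 2: "set_mset (\<Sum>s\<in>S. replicate_mset (d s) s) = {s\<in>S. d s \<noteq> 0}" if "finite S" for d and S :: "real set"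
    using that
  proof induction
    case (insert x S)
    have "set_mset (\<Sum>s\<in>insert x S. replicate_mset (d s) s) = set_mset (replicate_mset (d x) x) \<union> {s\<in>S. d s \<noteq> 0}"
      using insert by simp
    also have "\<dots> = {s\<in>insert x S. d s \<noteq> 0}"
      by (cases "d x = 0") auto
    finally show ?case .
  qed simp
  show "size (singular_values A) = CARD('m)"
    unfolding singular_values_def by (simp add: 1[OF fin] sum_dim_singular_eigenspaces)
  have "dim (singular_eigenspace A s) \<noteq> 0" if "singular_eigenspace A s \<noteq> {0}" for s
    using that subspace_0[OF subspace_singular_eigenspace, of A s] by auto
  then show "set_mset (singular_values A) = ?T"
    unfolding singular_values_def 2[OF fin] by auto
qed

text \<open>The extremal characterisation of the last singular value; everything below gets at
  singular values through this equivalence.\<close>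

lemma le_smallest_singular_value_iff:
  fixes A :: "real ^ 'm ^ 'n"
  shows "c \<le> singular_value CARD('m) A \<longleftrightarrow> (\<forall>v. c * norm v \<le> norm (A *v v))"
proof -
  let ?\<sigma> = "singular_value CARD('m) A"
  define xs where "xs = sorted_list_of_multiset (singular_values A)"
  have len: "length xs = CARD('m)"
    using size_singular_values[of A] unfolding xs_def
    by (metis mset_sorted_list_of_multiset size_mset)
  have pos: "0 < CARD('m)" by simp
  have set: "set xs = {s. 0 \<le> s \<and> singular_eigenspace A s \<noteq> {0}}"
    using set_singular_values[of A] by (simp add: xs_def)
  \<comment> \<open>The list is ascending and of length \<open>CARD('m)\<close>, so the last entry
    of its reversal is its head.\<close>
  have \<sigma>: "?\<sigma> = xs ! 0"
    unfolding singular_value_def xs_def[symmetric] using len pos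
    by (subst rev_nth) auto
  have "?\<sigma> \<in> set xs" using \<sigma> len pos by (metis nth_mem)
  then have \<sigma>0: "0 \<le> ?\<sigma>" "singular_eigenspace A ?\<sigma> \<noteq> {0}" using set by auto
  then obtain v where v: "v \<in> singular_eigenspace A ?\<sigma>" "v \<noteq> 0"
    using subspace_0[OF subspace_singular_eigenspace, of A ?\<sigma>] by blast
  have min: "?\<sigma> \<le> s" if "s \<in> set xs" for s
  proof -
    obtain i where "i < length xs" "s = xs ! i" using \<open>s \<in> set xs\<close> by (metis in_set_conv_nth)
    then show ?thesis using \<sigma> by (simp add: xs_def sorted_nth_mono)
  qed
  have "(UNIV :: (real ^ 'm) set) \<noteq> {0}"
    using v(2) by blast
  then obtain u where u: "norm u = 1" "u \<in> singular_eigenspace A (norm (A *v u))"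
    "\<And>w. norm (A *v u) * norm w \<le> norm (A *v w)"
    by (rule gram_minimizer[OF subspace_UNIV]) auto
  have "u \<noteq> 0" using u(1) by auto
  then have "singular_eigenspace A (norm (A *v u)) \<noteq> {0}" using u(2) by blast
  then have "norm (A *v u) \<in> set xs" by (simp add: set)
  from min[OF this] have lower: "?\<sigma> * norm w \<le> norm (A *v w)" for w
    using u(3)[of w] by (meson mult_right_mono norm_ge_zero order.trans)
  show ?thesis
  proof
    assume "c \<le> ?\<sigma>"
    then show "\<forall>v. c * norm v \<le> norm (A *v v)"
      using lower by (meson mult_right_mono norm_ge_zero order.trans)
  next
    assume "\<forall>v. c * norm v \<le> norm (A *v v)"
    then have "c * norm v \<le> ?\<sigma> * norm v"
      using norm_singular_eigenvector[OF v(1) \<sigma>0(1)] by metis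
    then show "c \<le> ?\<sigma>" using v(2) by simp
  qed
qed

section \<open>Uniformly expanding maps\<close>

text \<open>Reconciles two conventions: \<open>clarke_derivative\<close> differentiates within
  \<open>U\<close>, \<open>nderiv\<close> within \<open>half_space\<close>.\<close>

lemma at_within_openin:
  assumes "openin (top_of_set H) U" "x \<in> U"
  shows "at x within U = at x within H"
proof -
  obtain T where T: "open T" "U = H \<inter> T" using assms(1) by (auto simp: openin_open)
  show ?thesis
    by (rule at_within_nhd[of x T]) (use T assms(2) in auto)
qed

lemma half_space_iff: "x \<in> half_space \<longleftrightarrow> 0 \<le> x $ Min UNIV"
  by (simp add: half_space_def)

lemma closed_half_space: "closed half_space"
  unfolding half_space_def by (intro closed_Collect_le continuous_intros)

lemma convex_half_space: "convex half_space"
  unfolding convex_def by (auto simp: half_space_def)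

text \<open>
  A substitute for the injectivity of the derivatives that makes sense without differentiability,
  bounds the distances of the values from below, and is stable under small Lipschitz perturbations.
\<close>

definition expanding_on :: "real \<Rightarrow> 'a::real_inner set \<Rightarrow> ('a \<Rightarrow> 'b::real_inner) \<Rightarrow> bool" where
  "expanding_on c K g \<longleftrightarrow> (\<forall>v. norm v = 1 \<longrightarrow> (\<exists>w. norm w = 1 \<and>
     (\<forall>x t. 0 \<le> t \<longrightarrow> x \<in> K \<longrightarrow> x + t *\<^sub>R v \<in> K \<longrightarrow> c * t \<le> w \<bullet> (g (x + t *\<^sub>R v) - g x))))"

lemma expanding_onE:
  assumes "expanding_on c K g" "norm v = 1"
  obtains w where "norm w = 1"
    "\<And>x t. 0 \<le> t \<Longrightarrow> x \<in> K \<Longrightarrow> x + t *\<^sub>R v \<in> K \<Longrightarrow> c * t \<le> w \<bullet> (g (x + t *\<^sub>R v) - g x)"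
  using assms unfolding expanding_on_def by metis

lemma expanding_on_perturb:
  assumes g: "expanding_on c K g" and lip: "e-lipschitz_on K (\<lambda>x. h x - g x)"
  shows "expanding_on (c - e) K h"
  unfolding expanding_on_def
proof (intro allI impI)
  fix v :: 'a assume v: "norm v = 1"
  obtain w where w: "norm w = 1"
    "\<And>x t. 0 \<le> t \<Longrightarrow> x \<in> K \<Longrightarrow> x + t *\<^sub>R v \<in> K \<Longrightarrow> c * t \<le> w \<bullet> (g (x + t *\<^sub>R v) - g x)"
    using expanding_onE[OF g v] by metis
  show "\<exists>w. norm w = 1 \<and>
     (\<forall>x t. 0 \<le> t \<longrightarrow> x \<in> K \<longrightarrow> x + t *\<^sub>R v \<in> K \<longrightarrow> (c - e) * t \<le> w \<bullet> (h (x + t *\<^sub>R v) - h x))"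
  proof (intro exI[of _ w] conjI allI impI w(1))
    fix x and t :: real assume t: "0 \<le> t" "x \<in> K" "x + t *\<^sub>R v \<in> K"
    define d where "d = (h (x + t *\<^sub>R v) - g (x + t *\<^sub>R v)) - (h x - g x)"
    have "norm d \<le> e * t"
      using lipschitz_onD[OF lip t(3,2)] v t(1) by (simp add: d_def dist_norm)
    moreover have "\<bar>w \<bullet> d\<bar> \<le> norm d" using Cauchy_Schwarz_ineq2[of w d] w(1) by simp
    moreover have "w \<bullet> (h (x + t *\<^sub>R v) - h x) = w \<bullet> (g (x + t *\<^sub>R v) - g x) + w \<bullet> d"
      by (simp add: d_def inner_diff_right)
    ultimately show "(c - e) * t \<le> w \<bullet> (h (x + t *\<^sub>R v) - h x)"
      using w(2)[OF t] by (simp add: left_diff_distrib)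
  qed
qed

lemma expanding_on_inj:
  assumes g: "expanding_on c K g" and c: "0 < c"
  shows "inj_on g K"
proof (rule inj_onI, rule ccontr)
  fix x y assume xy: "x \<in> K" "y \<in> K" "g x = g y" "x \<noteq> y"
  define t where "t = norm (y - x)"
  define v where "v = (y - x) /\<^sub>R t"
  have t: "t > 0" using xy by (simp add: t_def)
  have v: "norm v = 1" "x + t *\<^sub>R v = y" using t by (simp_all add: v_def t_def)
  obtain w where w: "norm w = 1"
    "\<And>x t. 0 \<le> t \<Longrightarrow> x \<in> K \<Longrightarrow> x + t *\<^sub>R v \<in> K \<Longrightarrow> c * t \<le> w \<bullet> (g (x + t *\<^sub>R v) - g x)"
    using expanding_onE[OF g v(1)] by metis
  have "c * t \<le> 0" using w(2)[of t x] t v(2) xy by simp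
  then show False using c t by (simp add: mult_le_0_iff)
qed

text \<open>At a boundary point \<open>v\<close> may point out of the half-space. Then
  \<open>- v\<close> points into it, and the difference quotient is taken for
  \<open>t \<le> 0\<close>, the hypothesis being applied to the segment from \<open>l t\<close> to
  \<open>\<xi>\<close>. The constant \<open>c\<close> may be negative.\<close>

lemma derivative_half_space_lower_bound:
  fixes g :: "'m::{finite,linorder} euc \<Rightarrow> 'b::real_inner"
  assumes V: "openin (top_of_set half_space) V" and \<xi>: "\<xi> \<in> V"
    and D: "(g has_derivative D) (at \<xi> within V)"
    and low: "\<And>x t. 0 \<le> t \<Longrightarrow> x \<in> V \<Longrightarrow> x + t *\<^sub>R v \<in> V \<Longrightarrow> c * t \<le> w \<bullet> (g (x + t *\<^sub>R v) - g x)"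
  shows "c \<le> w \<bullet> D v"
proof -
  obtain T where T: "open T" "V = half_space \<inter> T" using V by (auto simp: openin_open)
  define J where "J = (if 0 \<le> v $ Min UNIV then {0::real..} else {..0})"
  define l where "l t = \<xi> + t *\<^sub>R v" for t :: real
  have lH: "l t \<in> half_space" if "t \<in> J" for t
    using that \<xi> T by (auto simp: l_def J_def half_space_iff mult_nonpos_nonpos split: if_splits)
  have lim: "(l \<longlongrightarrow> \<xi> + 0 *\<^sub>R v) (at 0 within J)" unfolding l_def by (intro tendsto_intros)
  have lT: "eventually (\<lambda>t. l t \<in> T) (at 0 within J)"
    using topological_tendstoD[OF lim T(1)] \<xi> T(2) by simp
  have "eventually (\<lambda>t. t \<in> J) (at 0 within J)" by (simp add: eventually_at_filter)
  with lT have lV: "eventually (\<lambda>t. l t \<in> V) (at 0 within J)"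
    by eventually_elim (use lH T(2) in auto)
  have dl: "(l has_derivative (\<lambda>t. t *\<^sub>R v)) (at 0 within J)"
    unfolding l_def by (auto intro!: derivative_eq_intros)
  have "(g has_derivative D) (at \<xi> within half_space)"
    using D by (simp add: at_within_openin[OF V \<xi>])
  then have "(g has_derivative D) (at (l 0) within l ` J)"
    using has_derivative_subset[of g D \<xi> half_space "l ` J"] lH by (auto simp: l_def)
  from has_derivative_in_compose[OF dl this]
  have "((\<lambda>t. g (l t)) has_derivative (\<lambda>t. D (t *\<^sub>R v))) (at 0 within J)" .
  then have "((\<lambda>t. w \<bullet> g (l t)) has_derivative (\<lambda>t. w \<bullet> D (t *\<^sub>R v))) (at 0 within J)"
    by (rule has_derivative_inner_right)
  moreover have "(\<lambda>t. w \<bullet> D (t *\<^sub>R v)) = (*) (w \<bullet> D v)"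
    using has_derivative_linear[OF D] by (auto simp: linear_cmul)
  ultimately have "((\<lambda>t. w \<bullet> g (l t)) has_real_derivative w \<bullet> D v) (at 0 within J)"
    by (simp add: has_field_derivative_def)
  then have q: "((\<lambda>t. (w \<bullet> g (l t) - w \<bullet> g (l 0)) / (t - 0)) \<longlongrightarrow> w \<bullet> D v) (at 0 within J)"
    by (simp add: has_field_derivative_iff)
  have "eventually (\<lambda>t. t \<noteq> 0) (at 0 within J)" by (simp add: eventually_at_filter)
  with lV have "eventually (\<lambda>t. c \<le> (w \<bullet> g (l t) - w \<bullet> g (l 0)) / (t - 0)) (at 0 within J)"
  proof eventually_elim
    case (elim t)
    show ?case
    proof (cases "t > 0")
      case True
      have "c * t \<le> w \<bullet> (g (l t) - g \<xi>)"
        using low[of t \<xi>] True \<xi> elim(1) by (simp add: l_def)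
      then show ?thesis using True by (simp add: l_def inner_diff_right pos_le_divide_eq)
    next
      case False
      then have t: "t < 0" using elim by simp
      have "c * (- t) \<le> w \<bullet> (g (l t + (- t) *\<^sub>R v) - g (l t))"
        using low[of "- t" "l t"] t \<xi> elim(1) by (simp add: l_def)
      then show ?thesis using t by (simp add: l_def inner_diff_right neg_le_divide_eq)
    qed
  qed
  moreover have "at 0 within J \<noteq> bot"
    unfolding J_def trivial_limit_within by (auto simp: islimpt_greaterThanLessThan1 intro: islimpt_subset[OF islimpt_greaterThanLessThan1[of 0 "1::real"]] islimpt_subset[OF islimpt_greaterThanLessThan2[of "-1::real" 0]])
  ultimately show ?thesis
    using tendsto_lowerbound[OF q] by simp
qed

text \<open>An instance of \<open>derivative_half_space_lower_bound\<close> with a nonpositive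
  constant and with \<open>w\<close> opposite to \<open>D v\<close>.\<close>

lemma derivative_half_space_norm_le:
  fixes g :: "'m::{finite,linorder} euc \<Rightarrow> 'b::real_inner"
  assumes V: "openin (top_of_set half_space) V" and \<xi>: "\<xi> \<in> V"
    and D: "(g has_derivative D) (at \<xi> within V)" and lip: "L-lipschitz_on V g"
  shows "norm (D v) \<le> L * norm v"
proof (cases "D v = 0")
  case True
  then show ?thesis using lipschitz_on_nonneg[OF lip] by simp
next
  case False
  define w where "w = - D v /\<^sub>R norm (D v)"
  have w1: "norm w = 1" using False by (simp add: w_def)
  have "- (L * norm v) \<le> w \<bullet> D v"
  proof (rule derivative_half_space_lower_bound[OF V \<xi> D])
    fix x and t :: real assume t: "0 \<le> t" "x \<in> V" "x + t *\<^sub>R v \<in> V"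
    have "\<bar>w \<bullet> (g (x + t *\<^sub>R v) - g x)\<bar> \<le> norm (g (x + t *\<^sub>R v) - g x)"
      using Cauchy_Schwarz_ineq2[of w "g (x + t *\<^sub>R v) - g x"] w1 by simp
    also have "\<dots> \<le> L * (t * norm v)"
      using lipschitz_onD[OF lip t(3,2)] t(1) by (simp add: dist_norm)
    finally show "- (L * norm v) * t \<le> w \<bullet> (g (x + t *\<^sub>R v) - g x)" by (simp add: abs_le_iff mult_ac)
  qed
  also have "w \<bullet> D v = - norm (D v)"
    using False by (simp add: w_def inner_commute power2_norm_eq_inner[symmetric] power2_eq_square)
  finally show ?thesis by simp
qed

section \<open>From the Clarke derivative to expansion\<close>

lemma norm_matrix_le_sum:
  fixes M :: "real ^ 'm ^ 'n"
  shows "norm M \<le> (\<Sum>i\<in>UNIV. \<Sum>j\<in>UNIV. \<bar>M $ i $ j\<bar>)"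
proof -
  have "norm M \<le> (\<Sum>i\<in>UNIV. norm (M $ i))"
    unfolding norm_vec_def[of M] by (rule L2_set_le_sum) simp
  also have "\<dots> \<le> (\<Sum>i\<in>UNIV. \<Sum>j\<in>UNIV. \<bar>M $ i $ j\<bar>)"
    by (intro sum_mono norm_le_l1_cart)
  finally show ?thesis .
qed

lemma norm_matrix_vector_mult_le:
  fixes M :: "real ^ 'm ^ 'n"
  shows "norm (M *v x) \<le> real CARD('n) * norm M * norm x"
proof -
  have "norm (M *v x) \<le> (\<Sum>i\<in>UNIV. \<bar>(M *v x) $ i\<bar>)" by (rule norm_le_l1_cart)
  also have "\<dots> \<le> (\<Sum>i\<in>(UNIV::'n set). norm M * norm x)"
  proof (rule sum_mono)
    fix i
    have "\<bar>(M *v x) $ i\<bar> \<le> norm (M $ i) * norm x"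
      using Cauchy_Schwarz_ineq2[of "M $ i" x]
      by (simp add: matrix_vector_mult_def inner_vec_def)
    also have "\<dots> \<le> norm M * norm x"
      by (intro mult_right_mono Finite_Cartesian_Product.norm_nth_le) simp
    finally show "\<bar>(M *v x) $ i\<bar> \<le> norm M * norm x" .
  qed
  finally show ?thesis by simp
qed

text \<open>\<open>w\<close> is the direction of the point of the closure nearest to the origin. The
  constant \<open>c\<close> is kept exactly, since that point has norm at least
  \<open>c\<close>.\<close>

lemma unit_separating_vector:
  fixes S :: "'a::euclidean_space set"
  assumes "convex S" and c: "0 < c" and S: "\<And>s. s \<in> S \<Longrightarrow> c \<le> norm s"
  obtains w where "norm w = 1" "\<And>s. s \<in> S \<Longrightarrow> c \<le> w \<bullet> s"
proof (cases "S = {}")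
  case True
  obtain w :: 'a where "norm w = 1" using vector_choose_size[of 1] by auto
  with True that show thesis by blast
next
  case False
  have "closed {s::'a. c \<le> norm s}" by (intro closed_Collect_le continuous_intros)
  then have cl: "closure S \<subseteq> {s. c \<le> norm s}"
    by (rule closure_minimal[rotated]) (use S in auto)
  have conv: "convex (closure S)" using assms(1) by (rule convex_closure)
  have ne: "closure S \<noteq> {}" using False by simp
  define z where "z = closest_point (closure S) 0"
  have z: "z \<in> closure S" unfolding z_def by (rule closest_point_in_set[OF closed_closure ne])
  have zc: "c \<le> norm z" using z cl by auto
  have z0: "0 < norm z" using zc c by linarith
  have "c \<le> (z /\<^sub>R norm z) \<bullet> s" if "s \<in> S" for s
  proof -
    have "s \<in> closure S" using that closure_subset by blast
    then have "(0 - z) \<bullet> (s - z) \<le> 0"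
      unfolding z_def by (intro closest_point_dot[OF conv closed_closure])
    then have "(norm z)\<^sup>2 \<le> z \<bullet> s" by (simp add: inner_diff_right power2_norm_eq_inner)
    then have "norm z \<le> (z \<bullet> s) / norm z" using z0 by (simp add: pos_le_divide_eq power2_eq_square)
    then show ?thesis using zc by (simp add: divide_inverse mult.commute)
  qed
  moreover have "norm (z /\<^sub>R norm z) = 1" using z0 by simp
  ultimately show thesis by (rule that[rotated])
qed

text \<open>Upper semicontinuity by compactness: derivatives at points tending to \<open>x0\<close>
  that stay away from the Clarke derivative would be bounded in terms of \<open>L\<close>, and the
  limit of a subsequence would belong to it.\<close>

lemma derivative_near_clarke_derivative:
  fixes g :: "'m::{finite,linorder} euc \<Rightarrow> 'n::finite euc"
  assumes U: "openin (top_of_set half_space) U" and lip: "L-lipschitz_on U g" and e: "0 < e"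
  obtains r where "0 < r"
    "\<And>\<xi> D. \<xi> \<in> U \<Longrightarrow> dist x0 \<xi> < r \<Longrightarrow> (g has_derivative D) (at \<xi> within U) \<Longrightarrow>
       \<exists>A\<in>clarke_derivative U g x0. \<forall>v. norm (D v - A *v v) \<le> e * norm v"
proof (rule ccontr)
  assume not: "\<not> thesis"
  have "\<exists>\<xi> D. \<xi> \<in> U \<and> dist x0 \<xi> < 1 / Suc n \<and> (g has_derivative D) (at \<xi> within U) \<and>
      \<not> (\<exists>A\<in>clarke_derivative U g x0. \<forall>v. norm (D v - A *v v) \<le> e * norm v)" for n
  proof (rule ccontr)
    assume a: "\<not> ?thesis"
    show False
      by (rule notE[OF not], rule that[of "1 / Suc n"]) (use a in \<open>simp, blast\<close>)
  qed
  then obtain \<xi> D where \<xi>: "\<And>n. \<xi> n \<in> U" "\<And>n. dist x0 (\<xi> n) < 1 / Suc n"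
    and D: "\<And>n. (g has_derivative D n) (at (\<xi> n) within U)"
    and far: "\<And>n. \<not> (\<exists>A\<in>clarke_derivative U g x0. \<forall>v. norm (D n v - A *v v) \<le> e * norm v)"
    by metis
  have lin: "linear (D n)" for n using has_derivative_linear[OF D] .
  have M: "matrix (D n) *v v = D n v" for n v using lin by (simp add: matrix_works linear_matrix_vector_mul_eq)
  have "norm (matrix (D n)) \<le> (\<Sum>i\<in>(UNIV::'n set). \<Sum>j\<in>(UNIV::'m set). L)" for n
  proof (rule order.trans[OF norm_matrix_le_sum], intro sum_mono)
    fix i j
    have "\<bar>matrix (D n) $ i $ j\<bar> = \<bar>D n (axis j 1) $ i\<bar>" by (simp add: matrix_def)
    also have "\<dots> \<le> norm (D n (axis j 1))" by (rule component_le_norm_cart)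
    also have "\<dots> \<le> L" using derivative_half_space_norm_le[OF U \<xi>(1) D lip, of n "axis j 1"] by simp
    finally show "\<bar>matrix (D n) $ i $ j\<bar> \<le> L" .
  qed
  then have "bounded (range (\<lambda>n. matrix (D n)))" by (auto simp: bounded_iff)
  from bounded_imp_convergent_subsequence[OF this]
  obtain A s where s: "strict_mono (s :: nat \<Rightarrow> nat)" and A: "((\<lambda>n. matrix (D n)) \<circ> s) \<longlonglongrightarrow> A"
    by blast
  have "\<xi> \<longlonglongrightarrow> x0"
  proof (rule metric_tendsto_imp_tendsto[OF inverse_Suc_LIMSEQ])
    show "\<forall>\<^sub>F n in sequentially. dist (\<xi> n) x0 \<le> dist (1 / real (Suc n)) 0"
      using \<xi>(2) by (intro always_eventually allI) (simp add: dist_commute less_imp_le)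
  qed
  then have "(\<lambda>n. \<xi> (s n)) \<longlonglongrightarrow> x0" using LIMSEQ_subseq_LIMSEQ[OF _ s] by (simp add: comp_def)
  then have AC: "A \<in> clarke_derivative U g x0"
    unfolding clarke_derivative_def
    by (intro hull_inc CollectI exI[of _ "\<lambda>n. \<xi> (s n)"] exI[of _ "\<lambda>n. D (s n)"])
      (use \<xi>(1) D A in \<open>auto simp: comp_def\<close>)
  have "(\<lambda>n. real CARD('n) * norm (matrix (D (s n)) - A)) \<longlonglongrightarrow> real CARD('n) * norm (A - A)"
    using A unfolding comp_def by (intro tendsto_intros)
  then have "eventually (\<lambda>n. real CARD('n) * norm (matrix (D (s n)) - A) < e) sequentially"
    by (rule order_tendstoD(2)) (use e in simp)
  then obtain n where n: "real CARD('n) * norm (matrix (D (s n)) - A) < e"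
    by (auto simp: eventually_sequentially)
  have "norm (D (s n) v - A *v v) \<le> e * norm v" for v
  proof -
    have "norm (D (s n) v - A *v v) = norm ((matrix (D (s n)) - A) *v v)"
      by (simp add: matrix_vector_mult_diff_rdistrib M)
    also have "\<dots> \<le> real CARD('n) * norm (matrix (D (s n)) - A) * norm v"
      by (rule norm_matrix_vector_mult_le)
    also have "\<dots> \<le> e * norm v" using n by (intro mult_right_mono) auto
    finally show ?thesis .
  qed
  then show False using far AC by blast
qed

text \<open>Half of \<open>c\<close> pays for replacing the Clarke derivative at \<open>x0\<close>
  by the derivatives at nearby points.\<close>

lemma clarke_imp_expanding:
  fixes g :: "'m::{finite,linorder} euc \<Rightarrow> 'n::finite euc"
  assumes U: "openin (top_of_set half_space) U" and x0: "x0 \<in> U"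
    and r0: "0 < r0" and sub: "cball x0 r0 \<inter> half_space \<subseteq> U"
    and lip: "L-lipschitz_on U g"
    and c: "0 < c" and A: "\<And>A v. A \<in> clarke_derivative U g x0 \<Longrightarrow> c * norm v \<le> norm (A *v v)"
  obtains r where "0 < r" "r \<le> r0" "expanding_on (c / 2) (cball x0 r \<inter> half_space) g"
proof -
  let ?C = "clarke_derivative U g x0"
  have UH: "U \<subseteq> half_space" using U by (rule openin_imp_subset)
  obtain r1 where r1: "0 < r1"
    "\<And>\<xi> D. \<xi> \<in> U \<Longrightarrow> dist x0 \<xi> < r1 \<Longrightarrow> (g has_derivative D) (at \<xi> within U) \<Longrightarrow>
       \<exists>A\<in>?C. \<forall>v. norm (D v - A *v v) \<le> (c / 2) * norm v"
    using derivative_near_clarke_derivative[OF U lip, of "c / 2" x0] c by (metis half_gt_zero)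
  define r where "r = min r0 r1"
  have r: "0 < r" "r \<le> r0" "r \<le> r1" using r0 r1 by (auto simp: r_def)
  define K where "K = cball x0 r0 \<inter> half_space"
  have K: "convex K" "closed K" "x0 \<in> K"
    using UH x0 r0 by (auto simp: K_def closed_half_space convex_half_space intro!: convex_Int closed_Int)
  \<comment> \<open>The nearest-point projection onto the convex set \<open>K\<close> does not
    increase distances, so \<open>G\<close> is an extension of \<open>g\<close> from
    \<open>K\<close> to the whole space with the same Lipschitz constant. On the open set
    \<open>S\<close> below it agrees with \<open>g\<close>, hence has the same derivatives.\<close>
  define G where "G x = g (closest_point K x)" for x
  have GK: "G x = g x" if "x \<in> K" for x using that by (simp add: G_def closest_point_self)
  have KU: "K \<subseteq> U" using sub by (simp add: K_def)
  have lipG: "L-lipschitz_on UNIV G"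
  proof (rule lipschitz_onI)
    fix x y
    have in_K: "closest_point K z \<in> K" for z
      by (rule closest_point_in_set) (use K in auto)
    have "dist (G x) (G y) \<le> L * dist (closest_point K x) (closest_point K y)"
      unfolding G_def by (rule lipschitz_onD[OF lip]) (use in_K KU in auto)
    also have "\<dots> \<le> L * dist x y"
      by (intro mult_left_mono closest_point_lipschitz lipschitz_on_nonneg[OF lip]) (use K in auto)
    finally show "dist (G x) (G y) \<le> L * dist x y" .
  qed (rule lipschitz_on_nonneg[OF lip])
  define S where "S = ball x0 r \<inter> {x. 0 < x $ Min UNIV}"
  have openS: "open S" unfolding S_def by (intro open_Int open_ball open_Collect_less continuous_intros)
  have convS: "convex S" unfolding S_def
    using convex_halfspace_gt[of 0 "axis (Min UNIV) 1 :: 'm euc"]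
    by (intro convex_Int convex_ball) (simp add: inner_axis')
  have SK: "S \<subseteq> K" using r by (auto simp: S_def K_def half_space_def)
  have "\<exists>w. norm w = 1 \<and> (\<forall>x t. 0 \<le> t \<longrightarrow> x \<in> cball x0 (r / 2) \<inter> half_space \<longrightarrow>
      x + t *\<^sub>R v \<in> cball x0 (r / 2) \<inter> half_space \<longrightarrow> (c / 2) * t \<le> w \<bullet> (g (x + t *\<^sub>R v) - g x))"
    if v: "norm v = 1" for v
  proof -
    have "convex ?C" by (simp add: clarke_derivative_def)
    then have "convex ((\<lambda>A. A *v v) ` ?C)"
      by (rule convex_linear_image[rotated])
        (rule linearI; simp add: matrix_vector_mult_add_rdistrib scaleR_matrix_vector_assoc)
    then obtain w where w: "norm w = 1" "\<And>s. s \<in> (\<lambda>A. A *v v) ` ?C \<Longrightarrow> c \<le> w \<bullet> s"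
      by (rule unit_separating_vector[OF _ c]) (use A[where v = v] v in auto)
    have wD: "c / 2 \<le> w \<bullet> D v" if \<xi>: "\<xi> \<in> S" and D: "(G has_derivative D) (at \<xi>)" for \<xi> D
    proof -
      have "(G has_derivative D) (at \<xi> within U)" using D by (rule has_derivative_at_withinI)
      then have "(g has_derivative D) (at \<xi> within U)"
        by (rule has_derivative_transform_within_open[OF _ openS \<xi>]) (use GK SK in auto)
      moreover have "\<xi> \<in> U" "dist x0 \<xi> < r1" using \<xi> SK KU r by (auto simp: S_def)
      ultimately obtain B where B: "B \<in> ?C" "norm (D v - B *v v) \<le> c / 2 * norm v"
        using r1(2) by blast
      have "\<bar>w \<bullet> (D v - B *v v)\<bar> \<le> c / 2"
        using Cauchy_Schwarz_ineq2[of w "D v - B *v v"] w(1) B(2) v by simp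
      moreover have "c \<le> w \<bullet> (B *v v)" using w(2) B(1) by blast
      moreover have "w \<bullet> (D v - B *v v) = w \<bullet> D v - w \<bullet> (B *v v)" by (rule inner_diff_right)
      ultimately show ?thesis by linarith
    qed
    have inS: "c / 2 * t \<le> w \<bullet> (G (x + t *\<^sub>R v) - G x)" if "0 \<le> t" "x \<in> S" "x + t *\<^sub>R v \<in> S" for x t
    proof (rule lipschitz_directional_mean_value[OF lipG openS _ that(1) wD])
      fix s assume s: "0 \<le> s" "s \<le> t"
      show "x + s *\<^sub>R v \<in> S"
      proof (cases "t = 0")
        case False
        have "(1 - s / t) *\<^sub>R x + (s / t) *\<^sub>R (x + t *\<^sub>R v) \<in> S"
          using s False that by (intro convexD[OF convS]) auto
        then show ?thesis using False by (simp add: algebra_simps)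
      qed (use s that in auto)
    qed
    show ?thesis
    proof (intro exI[of _ w] conjI allI impI w(1))
      fix x and t :: real
      assume t: "0 \<le> t" and x: "x \<in> cball x0 (r / 2) \<inter> half_space" and y: "x + t *\<^sub>R v \<in> cball x0 (r / 2) \<inter> half_space"
      define n :: "'m euc" where "n = axis (Min UNIV) 1"
      \<comment> \<open>An inward shift by less than \<open>r / 2\<close> takes the closed half-ball
        of radius \<open>r / 2\<close> into \<open>S\<close>, where the estimate is already known;
        this is why the radius is halved in the result.\<close>
      have push: "z + s *\<^sub>R n \<in> S" if "z \<in> cball x0 (r / 2) \<inter> half_space" "0 < s" "s < r / 2" for z s
      proof -
        have "dist x0 (z + s *\<^sub>R n) \<le> dist x0 z + dist z (z + s *\<^sub>R n)" by (rule dist_triangle)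
        also have "dist z (z + s *\<^sub>R n) = s" using that by (simp add: dist_norm n_def)
        finally show ?thesis
          using that by (simp add: S_def n_def half_space_def)
      qed
      have contG: "continuous_on UNIV G" using lipG by (rule lipschitz_on_continuous_on)
      have lim: "((\<lambda>s. G (z + s *\<^sub>R n)) \<longlongrightarrow> G z) (at_right 0)" for z
      proof -
        have "((\<lambda>s. z + s *\<^sub>R n) \<longlongrightarrow> z + 0 *\<^sub>R n) (at_right 0)" by (intro tendsto_intros)
        then show ?thesis
          using contG isCont_tendsto_compose[of z G "\<lambda>s. z + s *\<^sub>R n" "at_right 0"]
          by (simp add: continuous_on_eq_continuous_at)
      qed
      have "((\<lambda>s. w \<bullet> (G ((x + t *\<^sub>R v) + s *\<^sub>R n) - G (x + s *\<^sub>R n))) \<longlongrightarrow> w \<bullet> (G (x + t *\<^sub>R v) - G x)) (at_right 0)"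
        by (intro tendsto_intros lim)
      moreover have "eventually (\<lambda>s. c / 2 * t \<le> w \<bullet> (G ((x + t *\<^sub>R v) + s *\<^sub>R n) - G (x + s *\<^sub>R n))) (at_right 0)"
        unfolding eventually_at_right_field
      proof (intro exI[of _ "r / 2"] conjI allI impI)
        fix s assume s: "0 < s" "s < r / 2"
        have eq: "(x + t *\<^sub>R v) + s *\<^sub>R n = (x + s *\<^sub>R n) + t *\<^sub>R v" by simp
        show "c / 2 * t \<le> w \<bullet> (G ((x + t *\<^sub>R v) + s *\<^sub>R n) - G (x + s *\<^sub>R n))"
          using inS[OF t, of "x + s *\<^sub>R n"] push[OF x s] push[OF y s] unfolding eq by blast
      qed (use r in auto)
      ultimately have "c / 2 * t \<le> w \<bullet> (G (x + t *\<^sub>R v) - G x)"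
        by (rule tendsto_lowerbound) simp
      moreover have "cball x0 (r / 2) \<inter> half_space \<subseteq> K" using r by (auto simp: K_def)
      ultimately show "c / 2 * t \<le> w \<bullet> (g (x + t *\<^sub>R v) - g x)"
        using GK x y by (metis subsetD)
    qed
  qed
  then have "expanding_on (c / 2) (cball x0 (r / 2) \<inter> half_space) g"
    unfolding expanding_on_def by blast
  moreover have "0 < r / 2" "r / 2 \<le> r0" using r by auto
  ultimately show thesis using that by blast
qed

section \<open>Maps of class \<open>C\<^sup>k\<^sup>,\<^sup>1\<close> on the half-space\<close>

lemma frechet_derivative_half_space_eq:
  fixes f :: "'m::{finite,linorder} euc \<Rightarrow> 'n::finite euc"
  assumes "x \<in> half_space" "(f has_derivative D) (at x within half_space)"
  shows "frechet_derivative f (at x within half_space) = D"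
proof -
  have "f differentiable (at x within half_space)" using assms(2) by (rule differentiableI)
  then show ?thesis
    using has_derivative_half_space_unique[OF assms(1) _ assms(2)] by (simp add: frechet_derivative_works)
qed

lemma has_derivative_cong_openin:
  assumes "openin (top_of_set H) W" "x \<in> W" "\<And>y. y \<in> W \<Longrightarrow> f y = g y"
  shows "(f has_derivative D) (at x within H) \<longleftrightarrow> (g has_derivative D) (at x within H)"
  using has_derivative_transform[OF assms(2), of f g D] has_derivative_transform[OF assms(2), of g f D]
    assms(3) unfolding at_within_openin[OF assms(1,2), symmetric] by auto

lemma nderiv_cong_openin:
  assumes W: "openin (top_of_set half_space) W" and fg: "\<And>y. y \<in> W \<Longrightarrow> f y = g y"
  shows "x \<in> W \<Longrightarrow> nderiv vs f x = nderiv vs g x"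
proof (induction vs arbitrary: x)
  case (Cons v vs)
  then show ?case
    by (simp add: frechet_derivative_def has_derivative_cong_openin[OF W Cons.prems Cons.IH])
qed (simp add: fg)

lemma Ck_on_cong_openin:
  assumes W: "openin (top_of_set half_space) W" and fg: "\<And>y. y \<in> W \<Longrightarrow> f y = g y"
    and f: "Ck_on k W f"
  shows "Ck_on k W g"
  unfolding Ck_on_def
proof (intro conjI allI impI ballI)
  fix vs :: "'a euc list" and x assume vs: "length vs < k" "x \<in> W"
  then have "nderiv vs f differentiable (at x within half_space)" using f by (simp add: Ck_on_def)
  then show "nderiv vs g differentiable (at x within half_space)"
    unfolding differentiable_def
    using has_derivative_cong_openin[OF W vs(2), of "nderiv vs f" "nderiv vs g"]
      nderiv_cong_openin[OF W, of f g _ vs] fg by blast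
next
  fix vs :: "'a euc list" assume vs: "length vs \<le> k"
  then have "continuous_on W (nderiv vs f)" using f by (simp add: Ck_on_def)
  then show "continuous_on W (nderiv vs g)"
    by (rule continuous_on_eq) (rule nderiv_cong_openin[OF W fg])
qed

lemma Ck_on_subset: "Ck_on k W f \<Longrightarrow> W' \<subseteq> W \<Longrightarrow> Ck_on k W' f"
  unfolding Ck_on_def by (meson continuous_on_subset subsetD)

lemma smooth_on_cong_openin:
  assumes "openin (top_of_set half_space) W" "\<And>y. y \<in> W \<Longrightarrow> f y = g y" "smooth_on W f"
  shows "smooth_on W g"
  using assms(3) Ck_on_cong_openin[OF assms(1,2)] by (simp add: smooth_on_def)

lemma smooth_on_subset: "smooth_on W f \<Longrightarrow> W' \<subseteq> W \<Longrightarrow> smooth_on W' f"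
  unfolding smooth_on_def by (meson Ck_on_subset)

lemma Ck_on_differentiable:
  assumes "Ck_on k W f" "0 < k" "x \<in> W"
  shows "(f has_derivative (\<lambda>v. nderiv [v] f x)) (at x within half_space)"
  using assms unfolding Ck_on_def
  by (auto simp: frechet_derivative_works dest!: spec[of _ "[]"] bspec[of _ _ x])

lemma onorm_le_sum_Basis:
  fixes D :: "'m::finite euc \<Rightarrow> 'n::finite euc"
  assumes "linear D"
  shows "onorm D \<le> (\<Sum>b\<in>Basis. norm (D b))"
proof (rule onorm_le)
  fix x
  have "D x = (\<Sum>b\<in>Basis. (x \<bullet> b) *\<^sub>R D b)"
    using linear_sum[OF assms, of "\<lambda>b. (x \<bullet> b) *\<^sub>R b" Basis]
    by (simp add: euclidean_representation linear_cmul[OF assms])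
  also have "norm \<dots> \<le> (\<Sum>b\<in>Basis. norm ((x \<bullet> b) *\<^sub>R D b))" by (rule norm_sum)
  also have "\<dots> \<le> (\<Sum>b\<in>Basis. norm (D b) * norm x)"
    by (intro sum_mono) (simp add: mult.commute[of _ "norm x"] mult_right_mono Basis_le_norm)
  finally show "norm (D x) \<le> (\<Sum>b\<in>Basis. norm (D b)) * norm x" by (simp add: sum_distrib_right)
qed

lemma openin_half_space_cball:
  assumes "openin (top_of_set half_space) W" "x \<in> W"
  obtains r where "0 < r" "cball x r \<inter> half_space \<subseteq> W"
proof -
  obtain T where T: "open T" "W = half_space \<inter> T" using assms(1) by (auto simp: openin_open)
  then obtain r where "0 < r" "cball x r \<subseteq> T" using assms(2) by (meson IntD2 open_contains_cball)
  then show thesis using T that by blast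
qed

text \<open>For \<open>k = 0\<close> this is the defining condition on the derivative of order
  \<open>k\<close>. For \<open>k > 0\<close> the first derivative is continuous, hence bounded on a
  compact half-ball, and the mean value inequality applies by convexity.\<close>

lemma Ck1_on_locally_lipschitz:
  fixes f :: "'m::{finite,linorder} euc \<Rightarrow> 'n::finite euc"
  assumes f: "Ck1_on k W f" and W: "openin (top_of_set half_space) W" and x: "x \<in> W"
  obtains r L where "0 < r" "cball x r \<inter> half_space \<subseteq> W" "L-lipschitz_on (cball x r \<inter> half_space) f"
proof -
  obtain r0 where r0: "0 < r0" "cball x r0 \<inter> half_space \<subseteq> W"
    using openin_half_space_cball[OF W x] .
  show thesis
  proof (cases "k = 0")
    case True
    obtain r L where r: "0 < r" and L: "\<And>y z. y \<in> W \<inter> ball x r \<Longrightarrow> z \<in> W \<inter> ball x r \<Longrightarrow>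
        mop_norm k (\<lambda>vs. nderiv vs f y - nderiv vs f z) \<le> ennreal (L * dist y z)"
      using f x unfolding Ck1_on_def by meson
    define s where "s = min r0 (r / 2)"
    have s: "0 < s" "s \<le> r0" "s < r" using r0 r by (auto simp: s_def)
    have sub: "cball x s \<inter> half_space \<subseteq> W" using r0 s by auto
    have "\<bar>L\<bar>-lipschitz_on (cball x s \<inter> half_space) f"
    proof (rule lipschitz_onI)
      fix y z assume "y \<in> cball x s \<inter> half_space" "z \<in> cball x s \<inter> half_space"
      then have "mop_norm k (\<lambda>vs. nderiv vs f y - nderiv vs f z) \<le> ennreal (L * dist y z)"
        using sub s by (intro L) auto
      \<comment> \<open>For order zero the supremum runs over the empty list alone, so
        \<open>mop_norm\<close> is the norm of the value.\<close>
      moreover have "{vs::'m euc list. length vs = 0 \<and> (\<forall>v\<in>set vs. norm v \<le> 1)} = {[]}" by auto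
      ultimately have "ennreal (dist (f y) (f z)) \<le> ennreal (L * dist y z)"
        using True by (simp add: mop_norm_def dist_norm)
      also have "\<dots> \<le> ennreal (\<bar>L\<bar> * dist y z)" by (intro ennreal_leI mult_right_mono) auto
      finally show "dist (f y) (f z) \<le> \<bar>L\<bar> * dist y z" by (subst (asm) ennreal_le_iff) auto
    qed simp
    with s(1) sub that show thesis by blast
  next
    case False
    define K where "K = cball x r0 \<inter> half_space"
    have K: "compact K" "convex K" "K \<subseteq> W"
      using r0 by (auto simp: K_def closed_half_space convex_half_space intro!: convex_Int compact_Int_closed)
    have Ck: "Ck_on k W f" using f by (simp add: Ck1_on_def)
    have "\<exists>C. \<forall>y\<in>K. norm (nderiv [b] f y) \<le> C" for b
    proof -
      have "continuous_on W (nderiv [b] f)" using Ck False by (simp add: Ck_on_def del: nderiv.simps)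
      then have "compact (nderiv [b] f ` K)"
        by (intro compact_continuous_image K(1)) (rule continuous_on_subset[OF _ K(3)])
      from compact_imp_bounded[OF this] show ?thesis by (auto simp: bounded_iff simp del: nderiv.simps)
    qed
    then obtain C where C: "\<And>b y. y \<in> K \<Longrightarrow> norm (nderiv [b] f y) \<le> C b" by metis
    \<comment> \<open>\<open>Ck_on\<close> gives continuity of the derivative in each fixed
      direction, so the operator norm is bounded through the finitely many basis directions.\<close>
    define B where "B = (\<Sum>b\<in>Basis. \<bar>C b\<bar>)"
    have der: "(f has_derivative (\<lambda>v. nderiv [v] f y)) (at y within half_space)" if "y \<in> K" for y
      using Ck_on_differentiable[OF Ck] False that K(3) by blast
    have "B-lipschitz_on K f"
    proof (rule lipschitz_onI)
      fix y z assume yz: "y \<in> K" "z \<in> K"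
      have "norm (f y - f z) \<le> B * norm (y - z)"
      proof (rule differentiable_bound[OF K(2) _ _ yz])
        fix y assume y: "y \<in> K"
        show "(f has_derivative (\<lambda>v. nderiv [v] f y)) (at y within K)"
          by (rule has_derivative_subset[OF der[OF y]]) (simp add: K_def)
        have "onorm (\<lambda>v. nderiv [v] f y) \<le> (\<Sum>b\<in>Basis. norm (nderiv [b] f y))"
          by (rule onorm_le_sum_Basis[OF has_derivative_linear[OF der[OF y]]])
        also have "\<dots> \<le> B"
          unfolding B_def by (intro sum_mono order.trans[OF C[OF y]]) simp
        finally show "onorm (\<lambda>v. nderiv [v] f y) \<le> B" .
      qed
      then show "dist (f y) (f z) \<le> B * dist y z" by (simp add: dist_norm)
    qed (simp add: B_def sum_nonneg)
    with r0 that K_def show thesis by blast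
  qed
qed

lemma norm_le_mop_norm:
  assumes "length vs = j" "\<And>v. v \<in> set vs \<Longrightarrow> norm v \<le> 1"
  shows "ennreal (norm (T vs)) \<le> mop_norm j T"
  unfolding mop_norm_def by (rule SUP_upper2[of vs]) (use assms in auto)

text \<open>Only the part of order at most one of the \<open>C\<^sup>k\<^sup>,\<^sup>1\<close> norm matters in what follows.\<close>

lemma
  fixes d :: "'m::{finite,linorder} euc \<Rightarrow> 'n::finite euc"
  assumes less: "Ck1_norm k K d < ennreal e" and e: "0 < e"
  shows Ck1_norm_imp_norm_less: "x \<in> K \<Longrightarrow> norm (d x) < e"
    and Ck1_norm_imp_lipschitz:
      "\<lbrakk>convex K; K \<subseteq> half_space; \<And>x. 0 < k \<Longrightarrow> x \<in> K \<Longrightarrow> d differentiable (at x within half_space)\<rbrakk>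
        \<Longrightarrow> e-lipschitz_on K d"
proof -
  have pt: "mop_norm j (\<lambda>vs. nderiv vs d x) < ennreal e" if "x \<in> K" "j \<le> k" for x j
  proof (rule le_less_trans[OF _ less])
    have "mop_norm j (\<lambda>vs. nderiv vs d x) \<le> (SUP j\<in>{..k}. mop_norm j (\<lambda>vs. nderiv vs d x))"
      using that by (intro SUP_upper) auto
    also have "\<dots> \<le> (SUP x\<in>K. SUP j\<in>{..k}. mop_norm j (\<lambda>vs. nderiv vs d x))"
      using that by (intro SUP_upper)
    finally show "mop_norm j (\<lambda>vs. nderiv vs d x) \<le> Ck1_norm k K d"
      unfolding Ck1_norm_def by (rule le_supI1)
  qed
  show "norm (d x) < e" if x: "x \<in> K"
  proof -
    have "ennreal (norm (nderiv [] d x)) \<le> mop_norm 0 (\<lambda>vs. nderiv vs d x)"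
      by (rule norm_le_mop_norm) auto
    also have "\<dots> < ennreal e" using pt[OF x] by simp
    finally show ?thesis using e by (simp add: ennreal_less_iff)
  qed
  assume K: "convex K" "K \<subseteq> half_space"
    and diff: "\<And>x. 0 < k \<Longrightarrow> x \<in> K \<Longrightarrow> d differentiable (at x within half_space)"
  show "e-lipschitz_on K d"
  proof (rule lipschitz_onI)
    fix x y assume xy: "x \<in> K" "y \<in> K"
    show "dist (d x) (d y) \<le> e * dist x y"
    \<comment> \<open>The Lipschitz bound sits in the difference quotients of the norm if
      \<open>k = 0\<close>, and in its term with \<open>j = 1\<close> otherwise; in the latter case
      the mean value inequality turns it into an estimate on the convex set
      \<open>K\<close>.\<close>
    proof (cases "k = 0")
      case True
      show ?thesis
      proof (cases "x = y")
        case False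
        have "ennreal (norm (d y - d x) / norm (x - y)) = ennreal (norm (nderiv [] d y - nderiv [] d x)) / ennreal (norm (x - y))"
          using False by (simp add: divide_ennreal)
        also have "\<dots> \<le> mop_norm k (\<lambda>vs. nderiv vs d y - nderiv vs d x) / ennreal (norm (x - y))"
          by (intro divide_right_mono_ennreal norm_le_mop_norm[of "[]" k "\<lambda>vs. nderiv vs d y - nderiv vs d x"]) (use True in auto)
        also have "\<dots> \<le> (SUP (x, y)\<in>{(x, y). x \<in> K \<and> y \<in> K \<and> x \<noteq> y}.
            mop_norm k (\<lambda>vs. nderiv vs d y - nderiv vs d x) / ennreal (norm (x - y)))"
          by (rule SUP_upper2[of "(x, y)"]) (use xy False in auto)
        also have "\<dots> \<le> Ck1_norm k K d" unfolding Ck1_norm_def by (rule sup_ge2)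
        also have "\<dots> < ennreal e" by (rule less)
        finally have "norm (d y - d x) / norm (x - y) < e" using e by (simp add: ennreal_less_iff)
        then have "norm (d y - d x) < e * norm (x - y)" using False by (simp add: pos_divide_less_eq)
        then show ?thesis by (simp add: dist_norm norm_minus_commute)
      qed simp
    next
      case False
      have "norm (d x - d y) \<le> e * norm (x - y)"
      proof (rule differentiable_bound[OF K(1) _ _ xy])
        fix z assume z: "z \<in> K"
        let ?D = "frechet_derivative d (at z within half_space)"
        have der: "(d has_derivative ?D) (at z within half_space)"
          using diff[OF _ z] False by (simp add: frechet_derivative_works)
        then show "(d has_derivative ?D) (at z within K)" by (rule has_derivative_subset) (rule K)
        have lin: "linear ?D" using der by (rule has_derivative_linear)
        have unit: "norm (?D v) \<le> e" if "norm v \<le> 1" for v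
        proof -
          have "ennreal (norm (nderiv [v] d z)) \<le> mop_norm 1 (\<lambda>vs. nderiv vs d z)"
            by (rule norm_le_mop_norm) (use that in auto)
          also have "\<dots> < ennreal e" using pt[OF z] False by simp
          finally show ?thesis using e by (simp add: ennreal_less_iff)
        qed
        show "onorm ?D \<le> e"
        proof (rule onorm_le)
          fix v
          show "norm (?D v) \<le> e * norm v"
          proof (cases "v = 0")
            case False
            then have "norm (?D (v /\<^sub>R norm v)) \<le> e" by (intro unit) simp
            then show ?thesis using False by (simp add: linear_cmul[OF lin] field_simps)
          qed (simp add: linear_0[OF lin])
        qed
      qed
      then show ?thesis by (simp add: dist_norm)
    qed
  qed (use e in simp)
qed

lemma nderiv_zero:
  assumes "x \<in> half_space"
  shows "nderiv vs (\<lambda>_. 0) x = (0 :: 'n::finite euc)"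
  using assms
proof (induction vs arbitrary: x)
  case (Cons v vs)
  have "((\<lambda>_. 0 :: 'n euc) has_derivative (\<lambda>_. 0)) (at x within half_space)" by simp
  then have "(nderiv vs (\<lambda>_. 0 :: 'n euc) has_derivative (\<lambda>_. 0)) (at x within half_space)"
    by (rule has_derivative_transform[OF Cons.prems, rotated]) (rule Cons.IH)
  from frechet_derivative_half_space_eq[OF Cons.prems this] show ?case by simp
qed simp

text \<open>Serves to place a map in its own elementary neighbourhoods.\<close>

lemma Ck1_norm_zero:
  assumes "K \<subseteq> half_space"
  shows "Ck1_norm k K (\<lambda>_. 0 :: 'n::finite euc) = 0"
proof -
  have 1: "mop_norm j (\<lambda>vs. nderiv vs (\<lambda>_. 0 :: 'n euc) x) \<le> 0" if "x \<in> K" for j x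
    unfolding mop_norm_def by (rule SUP_least) (use nderiv_zero that assms in auto)
  have 2: "mop_norm j (\<lambda>vs. nderiv vs (\<lambda>_. 0 :: 'n euc) y - nderiv vs (\<lambda>_. 0 :: 'n euc) x) \<le> 0"
    if "x \<in> K" "y \<in> K" for j x y
    unfolding mop_norm_def by (rule SUP_least) (use that assms in \<open>auto simp: nderiv_zero subset_iff\<close>)
  have "Ck1_norm k K (\<lambda>_. 0 :: 'n euc) \<le> 0"
    unfolding Ck1_norm_def using 1 2 by (intro le_supI SUP_least) auto
  then show ?thesis by simp
qed

section \<open>Charts\<close>

lemma topological_chartD:
  assumes "topological_chart X (U, \<phi>)"
  shows "openin (top_of_set half_space) U" "openin X (\<phi> ` U)" "U \<subseteq> half_space" "inj_on \<phi> U"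
    "homeomorphic_map (top_of_set U) (subtopology X (\<phi> ` U)) \<phi>"
    "continuous_map (top_of_set U) X \<phi>" "\<phi> ` U \<subseteq> topspace X"
proof -
  show 1: "openin (top_of_set half_space) U" "openin X (\<phi> ` U)"
    and h: "homeomorphic_map (top_of_set U) (subtopology X (\<phi> ` U)) \<phi>"
    using assms by (auto simp: topological_chart_def)
  show "U \<subseteq> half_space" using 1(1) by (rule openin_imp_subset)
  show "inj_on \<phi> U" using homeomorphic_imp_injective_map[OF h] by simp
  show "continuous_map (top_of_set U) X \<phi>"
    using homeomorphic_imp_continuous_map[OF h] continuous_map_in_subtopology by blast
  show "\<phi> ` U \<subseteq> topspace X" using openin_subset[OF 1(2)] .
qed

lemma continuous_map_chart_inverse:
  assumes "topological_chart X (U, \<phi>)"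
  shows "continuous_map (subtopology X (\<phi> ` U)) (top_of_set U) (inv_into U \<phi>)"
proof -
  note c = topological_chartD[OF assms]
  obtain g where g: "homeomorphic_maps (top_of_set U) (subtopology X (\<phi> ` U)) \<phi> g"
    using c(5) homeomorphic_map_maps by blast
  have "continuous_map (subtopology X (\<phi> ` U)) (top_of_set U) g"
    using g by (simp add: homeomorphic_maps_def)
  moreover have "g y = inv_into U \<phi> y" if y: "y \<in> topspace (subtopology X (\<phi> ` U))" for y
  proof -
    obtain u where u: "u \<in> U" "y = \<phi> u" using y by auto
    then have "g y = u" using g by (simp add: homeomorphic_maps_def)
    then show ?thesis using u c(4) by simp
  qed
  ultimately show ?thesis by (rule continuous_map_eq)
qed

lemma openin_chart_preimage:
  assumes c: "topological_chart X (U, \<phi>)" and N: "openin Y N" and h: "continuous_map X Y h"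
  shows "openin (top_of_set half_space) {x \<in> U. h (\<phi> x) \<in> N}"
proof -
  note c = topological_chartD[OF c]
  have "continuous_map (top_of_set U) Y (h \<circ> \<phi>)"
    using c(6) h by (rule continuous_map_compose)
  from openin_continuous_map_preimage[OF this N]
  have "openin (top_of_set U) {x \<in> U. h (\<phi> x) \<in> N}" by simp
  then show ?thesis using c(1) by (rule openin_trans)
qed

lemma openin_local_dom:
  assumes "topological_chart X (U, \<phi>)" "topological_chart Y (V, \<psi>)" "continuous_map X Y h"
  shows "openin (top_of_set half_space) (local_dom U \<phi> V \<psi> h)"
  unfolding local_dom_def
  by (rule openin_chart_preimage[OF assms(1) _ assms(3)]) (rule topological_chartD(2)[OF assms(2)])

lemma continuous_on_local_rep:
  assumes cU: "topological_chart X (U, \<phi>)" and cV: "topological_chart Y (V, \<psi>)"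
    and h: "continuous_map X Y h"
  shows "continuous_on (local_dom U \<phi> V \<psi> h) (local_rep \<phi> V \<psi> h)"
proof -
  let ?W = "local_dom U \<phi> V \<psi> h"
  have "continuous_map (top_of_set U) Y (h \<circ> \<phi>)"
    using topological_chartD(6)[OF cU] h by (rule continuous_map_compose)
  then have "continuous_map (top_of_set ?W) Y (h \<circ> \<phi>)"
    by (rule continuous_map_from_subtopology_mono) (auto simp: local_dom_def)
  then have "continuous_map (top_of_set ?W) (subtopology Y (\<psi> ` V)) (h \<circ> \<phi>)"
    by (auto simp: continuous_map_in_subtopology local_dom_def)
  from continuous_map_compose[OF this continuous_map_chart_inverse[OF cV]]
  have "continuous_map (top_of_set ?W) (top_of_set V) (inv_into V \<psi> \<circ> (h \<circ> \<phi>))" .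
  then have "continuous_on ?W (inv_into V \<psi> \<circ> (h \<circ> \<phi>))" by auto
  then show ?thesis by (simp add: local_rep_def comp_def)
qed

lemma openin_chart_image:
  assumes c: "topological_chart X (U, \<phi>)" and W: "openin (top_of_set half_space) W" "W \<subseteq> U"
  shows "openin X (\<phi> ` W)"
proof -
  have "openin (top_of_set U) W"
    using W topological_chartD(3)[OF c] by (metis openin_subset_trans)
  then have "openin (subtopology X (\<phi> ` U)) (\<phi> ` W)"
    using topological_chartD(5)[OF c] homeomorphic_map_openness_eq by blast
  then show ?thesis using topological_chartD(2)[OF c] by (rule openin_trans_full)
qed

lemma compactin_chart_image:
  assumes c: "topological_chart X (U, \<phi>)" and K: "compact K" "K \<subseteq> U"
  shows "compactin X (\<phi> ` K)"
proof (rule image_compactin[OF _ topological_chartD(6)[OF c]])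
  show "compactin (top_of_set U) K"
    using K by (simp add: compactin_subtopology)
qed

lemma smooth_manifoldD:
  assumes "smooth_manifold X \<A>"
  shows "Hausdorff_space X" "second_countable X" "\<And>c. c \<in> \<A> \<Longrightarrow> topological_chart X c"
    "\<And>p. p \<in> topspace X \<Longrightarrow> \<exists>U \<phi>. (U, \<phi>) \<in> \<A> \<and> p \<in> \<phi> ` U"
    "\<And>c d. c \<in> \<A> \<Longrightarrow> d \<in> \<A> \<Longrightarrow> smooth_compatible c d"
    "\<And>c. topological_chart X c \<Longrightarrow> (\<And>d. d \<in> \<A> \<Longrightarrow> smooth_compatible c d) \<Longrightarrow> c \<in> \<A>"
  using assms unfolding smooth_manifold_def by (blast | fastforce)+

text \<open>Maximality of the atlas brings the restricted chart into it, once the restriction is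
  seen to be compatible with all charts.\<close>

lemma chart_restrict:
  assumes M: "smooth_manifold X \<A>" and U: "(U, \<phi>) \<in> \<A>"
    and U': "openin (top_of_set half_space) U'" "U' \<subseteq> U"
  shows "(U', \<phi>) \<in> \<A>"
proof (rule smooth_manifoldD(6)[OF M])
  have tU: "topological_chart X (U, \<phi>)" using M U by (rule smooth_manifoldD(3))
  note c = topological_chartD[OF tU]
  have "homeomorphic_map (subtopology (top_of_set U) U') (subtopology (subtopology X (\<phi> ` U)) (\<phi> ` U')) \<phi>"
  proof (rule homeomorphic_map_subtopologies[OF c(5)])
    have "\<phi> ` U' \<subseteq> topspace X" using c(7) U'(2) by blast
    then show "\<phi> ` (topspace (top_of_set U) \<inter> U') = topspace (subtopology X (\<phi> ` U)) \<inter> \<phi> ` U'"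
      using U'(2) by auto
  qed
  moreover have "U \<inter> U' = U'" "\<phi> ` U \<inter> \<phi> ` U' = \<phi> ` U'" using U'(2) by auto
  ultimately have "homeomorphic_map (top_of_set U') (subtopology X (\<phi> ` U')) \<phi>"
    by (simp add: subtopology_subtopology)
  then show t': "topological_chart X (U', \<phi>)"
    using U'(1) openin_chart_image[OF tU U'] by (simp add: topological_chart_def)
  fix d assume d: "d \<in> \<A>"
  obtain W \<theta> where [simp]: "d = (W, \<theta>)" by (cases d)
  have tW: "topological_chart X (W, \<theta>)" using smooth_manifoldD(3)[OF M d] by simp
  have comp: "smooth_on (local_dom U \<phi> W \<theta> id) (local_rep \<phi> W \<theta> id)"
    "smooth_on (local_dom W \<theta> U \<phi> id) (local_rep \<theta> U \<phi> id)"
    using smooth_manifoldD(5)[OF M U d] by (auto simp: smooth_compatible_def)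
  have "smooth_on (local_dom U' \<phi> W \<theta> id) (local_rep \<phi> W \<theta> id)"
    by (rule smooth_on_subset[OF comp(1)]) (use U'(2) in \<open>auto simp: local_dom_def\<close>)
  \<comment> \<open>The inverses of \<open>\<phi>\<close> taken over \<open>U'\<close> and over
    \<open>U\<close> are different total functions that agree on the image of \<open>U'\<close>;
    smoothness passes from one representation to the other because \<open>local_dom\<close> is
    relatively open.\<close>
  moreover have "smooth_on (local_dom W \<theta> U' \<phi> id) (local_rep \<theta> U' \<phi> id)"
  proof (rule smooth_on_cong_openin)
    show "openin (top_of_set half_space) (local_dom W \<theta> U' \<phi> id)"
      by (rule openin_local_dom[OF tW t']) simp
    show "smooth_on (local_dom W \<theta> U' \<phi> id) (local_rep \<theta> U \<phi> id)"
      by (rule smooth_on_subset[OF comp(2)]) (use U'(2) in \<open>auto simp: local_dom_def\<close>)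
    fix y assume "y \<in> local_dom W \<theta> U' \<phi> id"
    then obtain u where u: "u \<in> U'" "\<theta> y = \<phi> u" by (auto simp: local_dom_def)
    then show "local_rep \<theta> U \<phi> id y = local_rep \<theta> U' \<phi> id y"
      using inv_into_f_f[OF c(4), of u] inv_into_f_f[OF inj_on_subset[OF c(4) U'(2)], of u] U'(2)
      by (auto simp: local_rep_def)
  qed
  ultimately show "smooth_compatible (U', \<phi>) d" by (simp add: smooth_compatible_def)
qed

text \<open>In finite dimension, convergence of linear maps on a basis is enough for them to
  converge jointly with their arguments.\<close>

lemma tendsto_linear_apply:
  fixes P :: "'i \<Rightarrow> 'a::euclidean_space \<Rightarrow> 'b::real_normed_vector"
  assumes lin: "\<And>i. linear (P i)" "linear Q" and P: "\<And>b. b \<in> Basis \<Longrightarrow> ((\<lambda>i. P i b) \<longlongrightarrow> Q b) F"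
    and z: "(z \<longlongrightarrow> z0) F"
  shows "((\<lambda>i. P i (z i)) \<longlongrightarrow> Q z0) F"
proof -
  have rep: "T x = (\<Sum>b\<in>Basis. (x \<bullet> b) *\<^sub>R T b)" if "linear T" for T :: "'a \<Rightarrow> 'b" and x
    using linear_sum[OF that, of "\<lambda>b. (x \<bullet> b) *\<^sub>R b" Basis]
    by (simp add: euclidean_representation linear_cmul[OF that])
  have "((\<lambda>i. \<Sum>b\<in>Basis. (z i \<bullet> b) *\<^sub>R P i b) \<longlongrightarrow> (\<Sum>b\<in>Basis. (z0 \<bullet> b) *\<^sub>R Q b)) F"
    by (intro tendsto_intros z P)
  then show ?thesis by (simp add: rep[OF lin(1), symmetric] rep[OF lin(2), symmetric])
qed

lemma transition_derivative:
  assumes M: "smooth_manifold X \<A>" and U: "(U, \<phi>) \<in> \<A>" and V: "(V, \<psi>) \<in> \<A>"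
  defines "W \<equiv> local_dom U \<phi> V \<psi> id" and "\<alpha> \<equiv> local_rep \<phi> V \<psi> id"
  shows "\<And>x. x \<in> W \<Longrightarrow> (\<alpha> has_derivative (\<lambda>v. nderiv [v] \<alpha> x)) (at x within half_space)"
    and "\<And>v. continuous_on W (nderiv [v] \<alpha>)"
    and "openin (top_of_set half_space) W" and "continuous_on W \<alpha>"
    and "\<And>x. x \<in> W \<Longrightarrow> \<alpha> x \<in> V" and "\<And>x. x \<in> W \<Longrightarrow> \<psi> (\<alpha> x) = \<phi> x"
proof -
  have t: "topological_chart X (U, \<phi>)" "topological_chart X (V, \<psi>)"
    using smooth_manifoldD(3)[OF M] U V by auto
  have "smooth_on W \<alpha>"
    using smooth_manifoldD(5)[OF M U V] by (simp add: smooth_compatible_def W_def \<alpha>_def)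
  then have Ck: "Ck_on 1 W \<alpha>" by (simp add: smooth_on_def)
  show "(\<alpha> has_derivative (\<lambda>v. nderiv [v] \<alpha> x)) (at x within half_space)" if "x \<in> W" for x
    by (rule Ck_on_differentiable[OF Ck _ that]) simp
  show "continuous_on W (nderiv [v] \<alpha>)" for v
    using Ck by (simp add: Ck_on_def del: nderiv.simps)
  show "openin (top_of_set half_space) W"
    unfolding W_def by (rule openin_local_dom[OF t]) simp
  show "continuous_on W \<alpha>" unfolding W_def \<alpha>_def by (rule continuous_on_local_rep[OF t]) simp
  show "\<alpha> x \<in> V" if "x \<in> W" for x
    using that unfolding W_def \<alpha>_def local_dom_def local_rep_def by (auto intro: inv_into_into)
  show "\<psi> (\<alpha> x) = \<phi> x" if "x \<in> W" for x
    using that unfolding W_def \<alpha>_def local_dom_def local_rep_def by (auto intro: f_inv_into_f)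
qed

text \<open>
  Derivatives in the charts \<open>\<phi>\<close>, \<open>\<psi>\<close> and \<open>\<phi>1\<close>, \<open>\<psi>1\<close> are related by \<open>D1 = P \<circ> D \<circ> Q\<close> with the
  derivatives \<open>P\<close>, \<open>Q\<close> of the coordinate changes, which depend continuously on the point. So the
  estimate \<open>c \<le> w \<bullet> D1 v\<close> passes to limits and, being linear in \<open>D\<close>, to convex combinations.
\<close>

lemma expanding_imp_singular_value_pos:
  fixes \<A> :: "('p, 'm::{finite,linorder}) chart set" and \<B> :: "('q, 'n::{finite,linorder}) chart set"
  assumes M: "smooth_manifold X \<A>" and N: "smooth_manifold Y \<B>" and h: "continuous_map X Y h"
    and U: "(U, \<phi>) \<in> \<A>" and V: "(V, \<psi>) \<in> \<B>" and UV: "(\<lambda>x. h (\<phi> x)) ` U \<subseteq> \<psi> ` V" and x: "x \<in> U"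
    and U1: "(U1, \<phi>1) \<in> \<A>" and V1: "(V1, \<psi>1) \<in> \<B>"
    and S: "openin (top_of_set half_space) S" "S \<subseteq> U1" "(\<lambda>x. h (\<phi>1 x)) ` S \<subseteq> \<psi>1 ` V1"
    and y: "y \<in> S" "\<phi>1 y = \<phi> x"
    and c: "0 < c" and exp: "expanding_on c S (local_rep \<phi>1 V1 \<psi>1 h)"
  shows "0 < (INF A\<in>clarke_derivative U (local_rep \<phi> V \<psi> h) x. ereal (singular_value CARD('m) A))"
proof -
  have tU: "topological_chart X (U, \<phi>)" and tU1: "topological_chart X (U1, \<phi>1)"
    and tV: "topological_chart Y (V, \<psi>)" and tV1: "topological_chart Y (V1, \<psi>1)"
    using smooth_manifoldD(3)[OF M] smooth_manifoldD(3)[OF N] U U1 V V1 by auto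
  define g where "g = local_rep \<phi> V \<psi> h"
  define g1 where "g1 = local_rep \<phi>1 V1 \<psi>1 h"
  define \<alpha> where "\<alpha> = local_rep \<phi> U1 \<phi>1 id"
  define \<alpha>' where "\<alpha>' = local_rep \<phi>1 U \<phi> id"
  define \<beta> where "\<beta> = local_rep \<psi> V1 \<psi>1 id"
  define A0 where "A0 = local_dom U \<phi> U1 \<phi>1 id"
  define A1 where "A1 = local_dom U1 \<phi>1 U \<phi> id"
  define B0 where "B0 = local_dom V \<psi> V1 \<psi>1 id"
  note \<alpha> = transition_derivative[OF M U U1, folded A0_def \<alpha>_def]
  note \<alpha>' = transition_derivative[OF M U1 U, folded A1_def \<alpha>'_def]
  note \<beta> = transition_derivative[OF N V V1, folded B0_def \<beta>_def]
  note cU = topological_chartD[OF tU] and cU1 = topological_chartD[OF tU1]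
    and cV = topological_chartD[OF tV] and cV1 = topological_chartD[OF tV1]
  have gU: "g \<xi> \<in> V" "\<psi> (g \<xi>) = h (\<phi> \<xi>)" if "\<xi> \<in> U" for \<xi>
  proof -
    have "h (\<phi> \<xi>) \<in> \<psi> ` V" using UV that by blast
    then show "g \<xi> \<in> V" "\<psi> (g \<xi>) = h (\<phi> \<xi>)"
      by (auto simp: g_def local_rep_def intro: inv_into_into f_inv_into_f)
  qed
  have "local_dom U \<phi> V \<psi> h = U" using UV by (auto simp: local_dom_def)
  then have contg: "continuous_on U g"
    using continuous_on_local_rep[OF tU tV h] by (simp add: g_def)
  \<comment> \<open>The part of \<open>U\<close> that the change of coordinates maps into
    \<open>S\<close>; both local representations of \<open>h\<close> are available there.\<close>
  define \<Omega> where "\<Omega> = {\<xi> \<in> A0. \<alpha> \<xi> \<in> S}"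
  have \<Omega>: "openin (top_of_set half_space) \<Omega>"
  proof -
    have "openin (top_of_set U1) S" using S cU1(3) by (metis openin_subset_trans)
    moreover have "\<alpha> \<in> A0 \<rightarrow> U1" using \<alpha>(5) by blast
    ultimately have "openin (top_of_set A0) (A0 \<inter> \<alpha> -` S)"
      using continuous_openin_preimage[OF \<alpha>(4)] by blast
    then have "openin (top_of_set half_space) (A0 \<inter> \<alpha> -` S)" using \<alpha>(3) by (rule openin_trans)
    moreover have "A0 \<inter> \<alpha> -` S = \<Omega>" by (auto simp: \<Omega>_def)
    ultimately show ?thesis by simp
  qed
  have A0I: "\<xi> \<in> A0" "\<alpha> \<xi> = \<eta>" if "\<xi> \<in> U" "\<eta> \<in> U1" "\<phi> \<xi> = \<phi>1 \<eta>" for \<xi> \<eta>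
    using that cU1(4) by (auto simp: A0_def \<alpha>_def local_dom_def local_rep_def)
  have A1I: "\<eta> \<in> A1" "\<alpha>' \<eta> = \<xi>" if "\<xi> \<in> U" "\<eta> \<in> U1" "\<phi> \<xi> = \<phi>1 \<eta>" for \<xi> \<eta>
    using that cU(4) unfolding A1_def \<alpha>'_def local_dom_def local_rep_def id_def
    by (auto simp: that(3)[symmetric])
  have A0U: "A0 \<subseteq> U" by (auto simp: A0_def local_dom_def)
  have A1U: "A1 \<subseteq> U1" by (auto simp: A1_def local_dom_def)
  have x\<Omega>: "x \<in> \<Omega>" and \<alpha>x: "\<alpha> x = y" using A0I[of x y] x y S(2) by (auto simp: \<Omega>_def)
  have on\<Omega>: "\<alpha> \<xi> \<in> S" "\<alpha> \<xi> \<in> A1" "\<alpha>' (\<alpha> \<xi>) = \<xi>" "\<xi> \<in> U" "\<xi> \<in> A0" if "\<xi> \<in> \<Omega>" for \<xi>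
    using A1I[of \<xi> "\<alpha> \<xi>"] \<alpha>(5,6)[of \<xi>] that A0U by (auto simp: \<Omega>_def)
  have S1: "openin (top_of_set half_space) (S \<inter> A1)" using S(1) \<alpha>'(3) by (rule openin_Int)
  have \<beta>g: "g \<xi> \<in> B0 \<and> g1 \<eta> = \<beta> (g \<xi>)" if \<eta>: "\<eta> \<in> S" and \<xi>: "\<xi> \<in> U" "\<phi> \<xi> = \<phi>1 \<eta>" for \<xi> \<eta>
  proof -
    have "h (\<phi>1 \<eta>) \<in> \<psi>1 ` V1" using S(3) \<eta> by blast
    then show ?thesis
      using gU[OF \<xi>(1)] \<xi> by (simp add: B0_def \<beta>_def local_dom_def g1_def local_rep_def)
  qed
  define P where "P \<xi> z = nderiv [z] \<beta> (g \<xi>)" for \<xi> z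
  define Q where "Q \<xi> z = nderiv [z] \<alpha>' (\<alpha> \<xi>)" for \<xi> z
  have gB0: "g \<xi> \<in> B0" if "\<xi> \<in> \<Omega>" for \<xi>
    using \<beta>g[of "\<alpha> \<xi>" \<xi>] on\<Omega>[OF that] \<alpha>(6) by auto
  have P': "(\<beta> has_derivative P \<xi>) (at (g \<xi>) within half_space)" if "\<xi> \<in> \<Omega>" for \<xi>
    using \<beta>(1)[OF gB0[OF that]] by (simp add: P_def[abs_def] del: nderiv.simps)
  have Q': "(\<alpha>' has_derivative Q \<xi>) (at (\<alpha> \<xi>) within half_space)" if "\<xi> \<in> \<Omega>" for \<xi>
    using \<alpha>'(1)[OF on\<Omega>(2)[OF that]] by (simp add: Q_def[abs_def] del: nderiv.simps)
  have linP: "linear (P \<xi>)" and linQ: "linear (Q \<xi>)" if "\<xi> \<in> \<Omega>" for \<xi>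
    using has_derivative_linear[OF P'[OF that]] has_derivative_linear[OF Q'[OF that]] by auto
  have chain: "(g1 has_derivative (\<lambda>v. P \<xi> (D (Q \<xi> v)))) (at (\<alpha> \<xi>) within S)"
    if \<xi>: "\<xi> \<in> \<Omega>" and D: "(g has_derivative D) (at \<xi> within U)" for \<xi> D
  proof -
    let ?\<eta> = "\<alpha> \<xi>"
    have \<eta>: "?\<eta> \<in> S \<inter> A1" "\<alpha>' ?\<eta> = \<xi>" using on\<Omega>[OF \<xi>] by auto
    have w1: "at ?\<eta> within S \<inter> A1 = at ?\<eta> within half_space"
      by (rule at_within_openin[OF S1 \<eta>(1)])
    have d1: "(\<alpha>' has_derivative Q \<xi>) (at ?\<eta> within S \<inter> A1)"
      using Q'[OF \<xi>] by (simp add: w1)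
    have "(g has_derivative D) (at (\<alpha>' ?\<eta>) within \<alpha>' ` (S \<inter> A1))"
      unfolding \<eta>(2) by (rule has_derivative_subset[OF D]) (use \<alpha>'(5) in auto)
    from has_derivative_in_compose[OF d1 this]
    have d2: "((\<lambda>z. g (\<alpha>' z)) has_derivative (\<lambda>v. D (Q \<xi> v))) (at ?\<eta> within S \<inter> A1)" .
    have "(\<beta> has_derivative P \<xi>) (at (g (\<alpha>' ?\<eta>)) within (\<lambda>z. g (\<alpha>' z)) ` (S \<inter> A1))"
      unfolding \<eta>(2) by (rule has_derivative_subset[OF P'[OF \<xi>]]) (use \<alpha>'(5) gU(1) cV(3) in blast)
    from has_derivative_in_compose[OF d2 this]
    have "((\<lambda>z. \<beta> (g (\<alpha>' z))) has_derivative (\<lambda>v. P \<xi> (D (Q \<xi> v)))) (at ?\<eta> within S \<inter> A1)" .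
    then have "(g1 has_derivative (\<lambda>v. P \<xi> (D (Q \<xi> v)))) (at ?\<eta> within S \<inter> A1)"
    proof (rule has_derivative_transform[OF \<eta>(1), rotated])
      fix z assume z: "z \<in> S \<inter> A1"
      then have "\<alpha>' z \<in> U" "\<phi> (\<alpha>' z) = \<phi>1 z" using \<alpha>'(5,6) by auto
      then show "g1 z = \<beta> (g (\<alpha>' z))" using \<beta>g z by blast
    qed
    then show ?thesis using at_within_openin[OF S(1)] \<eta>(1) w1 by simp
  qed
  have lower: "c * norm v \<le> norm (P x (A *v Q x v))" if A: "A \<in> clarke_derivative U g x" for A v
  proof -
    have unit: "c \<le> norm (P x (A *v Q x v))" if v: "norm v = 1" for v
    proof -
      obtain w where w: "norm w = 1" "\<And>z t. 0 \<le> t \<Longrightarrow> z \<in> S \<Longrightarrow> z + t *\<^sub>R v \<in> S \<Longrightarrow> c * t \<le> w \<bullet> (g1 (z + t *\<^sub>R v) - g1 z)"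
        using expanding_onE[OF exp v] unfolding g1_def by metis
      \<comment> \<open>A half-space in the space of matrices: being convex, it contains the Clarke
        derivative as soon as it contains the limits of derivatives.\<close>
      define H where "H = {B. c \<le> w \<bullet> P x (B *v Q x v)}"
      have "convex H"
        unfolding convex_def H_def
      proof clarify
        fix B C and s t :: real
        assume BC: "c \<le> w \<bullet> P x (B *v Q x v)" "c \<le> w \<bullet> P x (C *v Q x v)" and st: "0 \<le> s" "0 \<le> t" "s + t = 1"
        have "c = s * c + t * c" using st by (metis mult_1 distrib_right)
        also have "\<dots> \<le> s * (w \<bullet> P x (B *v Q x v)) + t * (w \<bullet> P x (C *v Q x v))"
          using BC st by (intro add_mono mult_left_mono)
        also have "\<dots> = w \<bullet> P x ((s *\<^sub>R B + t *\<^sub>R C) *v Q x v)"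
          by (simp add: matrix_vector_mult_add_rdistrib scaleR_matrix_vector_assoc[symmetric] inner_add_right
            linear_add[OF linP[OF x\<Omega>]] linear_cmul[OF linP[OF x\<Omega>]])
        finally show "c \<le> w \<bullet> P x ((s *\<^sub>R B + t *\<^sub>R C) *v Q x v)" .
      qed
      moreover have "B \<in> H"
        if \<xi>: "\<And>i::nat. \<xi> i \<in> U" "\<xi> \<longlonglongrightarrow> x" and D: "\<And>i. (g has_derivative D i) (at (\<xi> i) within U)"
          and B: "(\<lambda>i. matrix (D i)) \<longlonglongrightarrow> B" for \<xi> D B
      proof -
        obtain T where T: "open T" "\<Omega> = half_space \<inter> T" using \<Omega> by (auto simp: openin_open)
        have "eventually (\<lambda>i. \<xi> i \<in> T) sequentially"
          using topological_tendstoD[OF \<xi>(2) T(1)] x\<Omega> T(2) by simp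
        then obtain i0 where i0: "\<And>i. i0 \<le> i \<Longrightarrow> \<xi> i \<in> \<Omega>"
          using \<xi>(1) cU(3) T(2) by (auto simp: eventually_sequentially)
        define \<zeta> where "\<zeta> i = \<xi> (i + i0)" for i
        define E where "E i = D (i + i0)" for i
        have \<zeta>: "\<zeta> i \<in> \<Omega>" for i using i0 by (simp add: \<zeta>_def)
        have \<zeta>lim: "\<zeta> \<longlonglongrightarrow> x" unfolding \<zeta>_def using \<xi>(2) by (rule LIMSEQ_ignore_initial_segment)
        have E: "(g has_derivative E i) (at (\<zeta> i) within U)" for i unfolding E_def \<zeta>_def by (rule D)
        have linE: "linear (E i)" for i using has_derivative_linear[OF E] .
        have Elim: "(\<lambda>i. matrix (E i)) \<longlonglongrightarrow> B" unfolding E_def using B by (rule LIMSEQ_ignore_initial_segment)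
        have Ev: "(\<lambda>i. E i z) \<longlonglongrightarrow> B *v z" for z
        proof -
          have "(\<lambda>i. matrix (E i) *v z) \<longlonglongrightarrow> B *v z"
          proof (rule vec_tendstoI)
            fix k
            show "(\<lambda>i. (matrix (E i) *v z) $ k) \<longlonglongrightarrow> (B *v z) $ k"
              unfolding matrix_vector_mult_def vec_lambda_beta
              by (intro tendsto_sum tendsto_mult tendsto_const tendsto_vec_nth Elim)
          qed
          then show ?thesis using linE by (simp add: matrix_works linear_matrix_vector_mul_eq)
        qed
        have glim: "(\<lambda>i. g (\<zeta> i)) \<longlonglongrightarrow> g x"
          by (rule continuous_on_tendsto_compose[OF contg \<zeta>lim x]) (simp add: on\<Omega>(4)[OF \<zeta>])
        have \<alpha>lim: "(\<lambda>i. \<alpha> (\<zeta> i)) \<longlonglongrightarrow> \<alpha> x"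
          by (rule continuous_on_tendsto_compose[OF \<alpha>(4) \<zeta>lim on\<Omega>(5)[OF x\<Omega>]]) (simp add: on\<Omega>(5)[OF \<zeta>])
        have Pv: "(\<lambda>i. P (\<zeta> i) z) \<longlonglongrightarrow> P x z" for z
          unfolding P_def
          by (rule continuous_on_tendsto_compose[OF \<beta>(2) glim gB0[OF x\<Omega>]]) (simp add: gB0[OF \<zeta>])
        have Qv: "(\<lambda>i. Q (\<zeta> i) z) \<longlonglongrightarrow> Q x z" for z
          unfolding Q_def
          by (rule continuous_on_tendsto_compose[OF \<alpha>'(2) \<alpha>lim on\<Omega>(2)[OF x\<Omega>]]) (simp add: on\<Omega>(2)[OF \<zeta>])
        have "(\<lambda>i. E i (Q (\<zeta> i) v)) \<longlonglongrightarrow> B *v Q x v"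
          by (rule tendsto_linear_apply[OF linE matrix_vector_mul_linear Ev Qv])
        then have "(\<lambda>i. P (\<zeta> i) (E i (Q (\<zeta> i) v))) \<longlonglongrightarrow> P x (B *v Q x v)"
          by (rule tendsto_linear_apply[OF linP[OF \<zeta>] linP[OF x\<Omega>] Pv])
        then have "(\<lambda>i. w \<bullet> P (\<zeta> i) (E i (Q (\<zeta> i) v))) \<longlonglongrightarrow> w \<bullet> P x (B *v Q x v)"
          by (intro tendsto_intros)
        moreover have "c \<le> w \<bullet> P (\<zeta> i) (E i (Q (\<zeta> i) v))" for i
          by (rule derivative_half_space_lower_bound[OF S(1) on\<Omega>(1)[OF \<zeta>] chain[OF \<zeta> E] w(2)])
        ultimately have "c \<le> w \<bullet> P x (B *v Q x v)"
          by (intro LIMSEQ_le_const[of _ _ c]) auto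
        then show ?thesis by (simp add: H_def)
      qed
      ultimately have "clarke_derivative U g x \<subseteq> H"
        unfolding clarke_derivative_def by (intro hull_minimal) blast+
      then have "c \<le> w \<bullet> P x (A *v Q x v)" using A by (auto simp: H_def)
      also have "\<dots> \<le> norm (P x (A *v Q x v))"
        using Cauchy_Schwarz_ineq2[of w "P x (A *v Q x v)"] w(1) by simp
      finally show ?thesis .
    qed
    show ?thesis
    proof (cases "v = 0")
      case False
      then have "c \<le> norm (P x (A *v Q x (v /\<^sub>R norm v)))" by (intro unit) simp
      then show ?thesis
        using False by (simp add: linear_cmul[OF linQ[OF x\<Omega>]] linear_cmul[OF linP[OF x\<Omega>]]
          matrix_vector_mult_scaleR field_simps)
    qed simp
  qed
  \<comment> \<open>The derivative of the change of coordinates \<open>\<alpha>\<close> is a right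
    inverse of \<open>Q x\<close>. So every vector \<open>u\<close> has the form
    \<open>Q x v\<close>, and \<open>lower\<close> speaks about \<open>A *v u\<close>.\<close>
  have QR: "Q x (nderiv [u] \<alpha> x) = u" for u
  proof -
    have w\<Omega>: "at x within \<Omega> = at x within half_space" by (rule at_within_openin[OF \<Omega> x\<Omega>])
    have d1: "(\<alpha> has_derivative (\<lambda>v. nderiv [v] \<alpha> x)) (at x within \<Omega>)"
      using \<alpha>(1)[OF on\<Omega>(5)[OF x\<Omega>]] by (simp only: w\<Omega>)
    have "(\<alpha>' has_derivative Q x) (at (\<alpha> x) within \<alpha> ` \<Omega>)"
      by (rule has_derivative_subset[OF Q'[OF x\<Omega>]]) (use on\<Omega>(2) A1U cU1(3) in blast)
    from has_derivative_in_compose[OF d1 this]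
    have "((\<lambda>z. \<alpha>' (\<alpha> z)) has_derivative (\<lambda>v. Q x (nderiv [v] \<alpha> x))) (at x within \<Omega>)" .
    then have "((\<lambda>z. z) has_derivative (\<lambda>v. Q x (nderiv [v] \<alpha> x))) (at x within \<Omega>)"
      by (rule has_derivative_transform[OF x\<Omega>, rotated]) (simp add: on\<Omega>(3))
    then have "(\<lambda>v. Q x (nderiv [v] \<alpha> x)) = (\<lambda>v. v)"
      using has_derivative_half_space_unique[of x "\<lambda>z. z"] x cU(3) has_derivative_ident
      unfolding w\<Omega> by blast
    then show ?thesis by (rule fun_cong)
  qed
  have blP: "bounded_linear (P x)" and blQ: "bounded_linear (Q x)"
    using linP[OF x\<Omega>] linQ[OF x\<Omega>] by (simp_all add: linear_conv_bounded_linear)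
  \<comment> \<open>A distortion by at most \<open>p\<close> in the target and \<open>q\<close> in
    the domain turns the rate \<open>c\<close> into \<open>c / (p * q)\<close>; the added ones keep
    both factors positive.\<close>
  define p q where "p = onorm (P x) + 1" and "q = onorm (Q x) + 1"
  have pq: "0 < p" "0 < q"
    using onorm_pos_le[OF blP] onorm_pos_le[OF blQ] by (auto simp: p_def q_def)
  have Pp: "norm (P x z) \<le> p * norm z" for z
    using onorm[OF blP, of z] by (simp add: p_def distrib_right add_increasing2)
  have Qq: "norm (Q x z) \<le> q * norm z" for z
    using onorm[OF blQ, of z] by (simp add: q_def distrib_right add_increasing2)
  have "c / (p * q) \<le> singular_value CARD('m) A" if A: "A \<in> clarke_derivative U g x" for A
    unfolding le_smallest_singular_value_iff
  proof
    fix u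
    define v where "v = nderiv [u] \<alpha> x"
    have "c * norm v \<le> norm (P x (A *v u))" using lower[OF A, of v] QR[of u] by (simp add: v_def)
    also have "\<dots> \<le> p * norm (A *v u)" by (rule Pp)
    finally have 1: "c * norm v \<le> p * norm (A *v u)" .
    have "norm u \<le> q * norm v" using Qq[of v] QR[of u] by (simp add: v_def)
    then have "c * norm u \<le> c * (q * norm v)" using c by (intro mult_left_mono) auto
    also have "\<dots> = q * (c * norm v)" by simp
    also have "\<dots> \<le> q * (p * norm (A *v u))" using 1 pq by (intro mult_left_mono) auto
    finally show "c / (p * q) * norm u \<le> norm (A *v u)"
      using pq by (simp add: field_simps)
  qed
  then have "ereal (c / (p * q)) \<le> (INF A\<in>clarke_derivative U g x. ereal (singular_value CARD('m) A))"
    by (intro INF_greatest) simp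
  moreover have "0 < ereal (c / (p * q))" using c pq by simp
  ultimately show ?thesis unfolding g_def by (rule less_le_trans[rotated])
qed

section \<open>Locally finite covers and embeddings\<close>

text \<open>The exhaustion argument for paracompactness: compact shells are covered by finitely many
  small sets each, which stay inside slightly larger open shells. \<open>Q\<close> carries further
  properties of the indices through the selection.\<close>

lemma countable_locally_finite_cover:
  fixes Lo Kc :: "'i \<Rightarrow> 'p set"
  assumes X: "Hausdorff_space X" "second_countable X"
    and ex: "\<And>p N. openin X N \<Longrightarrow> p \<in> N \<Longrightarrow>
      \<exists>i. Q i \<and> p \<in> Lo i \<and> openin X (Lo i) \<and> compactin X (Kc i) \<and> Lo i \<subseteq> Kc i \<and> Kc i \<subseteq> N"
  obtains J where "countable J" "\<And>i. i \<in> J \<Longrightarrow> Q i"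
    "\<And>i. i \<in> J \<Longrightarrow> openin X (Lo i) \<and> compactin X (Kc i) \<and> Lo i \<subseteq> Kc i"
    "topspace X \<subseteq> (\<Union>i\<in>J. Lo i)"
    "\<And>p. p \<in> topspace X \<Longrightarrow> \<exists>W. openin X W \<and> p \<in> W \<and> finite {i \<in> J. Kc i \<inter> W \<noteq> {}}"
proof (cases "topspace X = {}")
  case True
  show thesis by (rule that[of "{}"]) (use True in auto)
next
  case False
  define I where "I = {i. Q i \<and> openin X (Lo i) \<and> compactin X (Kc i) \<and> Lo i \<subseteq> Kc i}"
  have "Lindelof_space X" using X(2) by (rule second_countable_imp_Lindelof_space)
  moreover have "\<forall>U\<in>Lo ` I. openin X U" by (auto simp: I_def)
  moreover have "topspace X \<subseteq> \<Union>(Lo ` I)"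
  proof
    fix p assume "p \<in> topspace X"
    then show "p \<in> \<Union>(Lo ` I)" using ex[OF openin_topspace, of p] by (auto simp: I_def)
  qed
  ultimately obtain \<V> where \<V>: "countable \<V>" "\<V> \<subseteq> Lo ` I" "topspace X \<subseteq> \<Union>\<V>"
    unfolding Lindelof_space_alt by meson
  then obtain I0 where I0: "countable I0" "I0 \<subseteq> I" "\<V> = Lo ` I0"
    by (meson countable_subset_image)
  have "I0 \<noteq> {}" using \<V>(3) I0(3) False by auto
  define s where "s = from_nat_into I0"
  have s: "s n \<in> I0" "range s = I0" for n
    using range_from_nat_into[OF \<open>I0 \<noteq> {}\<close> I0(1)] by (auto simp: s_def)
  have sI: "s n \<in> I" for n using s I0(2) by blast
  define E where "E n = (\<Union>k\<le>n. Lo (s k))" for n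
  define C where "C n = (\<Union>k\<le>n. Kc (s k))" for n :: nat
  have E: "openin X (E n)" for n unfolding E_def using sI by (intro openin_Union) (auto simp: I_def)
  have C: "compactin X (C n)" for n
    unfolding C_def using sI by (intro compactin_Union) (auto simp: I_def)
  have EC: "E n \<subseteq> C n" for n unfolding E_def C_def using sI by (force simp: I_def)
  have Emono: "E m \<subseteq> E n" if "m \<le> n" for m n
    unfolding E_def using that by (intro UN_mono) auto
  have Ecov: "topspace X \<subseteq> (\<Union>n. E n)"
  proof
    fix p assume "p \<in> topspace X"
    then obtain i where "i \<in> I0" "p \<in> Lo i" using \<V>(3) I0(3) by auto
    then obtain n where "p \<in> Lo (s n)" using s(2) by (metis imageE)
    then show "p \<in> (\<Union>n. E n)" by (auto simp: E_def)
  qed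
  have "\<exists>m>n. C n \<subseteq> E m" for n
  proof -
    have "C n \<subseteq> \<Union>(range E)" using compactin_subset_topspace[OF C] Ecov by blast
    then obtain F where F: "finite F" "F \<subseteq> range E" "C n \<subseteq> \<Union>F"
      using C[of n] E unfolding compactin_def by (metis imageE)
    obtain A where A: "finite A" "F = E ` A" using finite_subset_image[OF F(1,2)] by blast
    define m where "m = Max (insert (Suc n) A)"
    have "E a \<subseteq> E m" if "a \<in> A" for a using that A(1) by (intro Emono) (simp add: m_def)
    then have "C n \<subseteq> E m" using F(3) A(2) by blast
    moreover have "Suc n \<le> m" unfolding m_def using A(1) by (intro Max_ge) auto
    ultimately show ?thesis by (intro exI[of _ m]) simp
  qed
  then obtain \<tau> where \<tau>: "\<And>n. n < \<tau> n" "\<And>n. C n \<subseteq> E (\<tau> n)" by metis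
  \<comment> \<open>Iterating \<open>\<tau>\<close> thins out the increasing unions, so that the
    compact union \<open>F n\<close> lies in the next open union \<open>G (Suc n)\<close>.\<close>
  define m where "m = rec_nat 0 (\<lambda>_. \<tau>)"
  have m: "m (Suc n) = \<tau> (m n)" for n by (simp add: m_def)
  have mge: "n \<le> m n" for n
  proof (induction n)
    case (Suc n)
    then show ?case using \<tau>(1)[of "m n"] by (simp add: m)
  qed simp
  define G where "G n = E (m n)" for n
  define F where "F n = C (m n)" for n
  have GF: "G n \<subseteq> F n" and FG: "F n \<subseteq> G (Suc n)" for n
    using EC \<tau>(2) by (auto simp: G_def F_def m)
  have G: "openin X (G n)" and F: "compactin X (F n)" and Fcl: "closedin X (F n)" for n
    using E C compactin_imp_closedin[OF X(1)] by (auto simp: G_def F_def)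
  have Fmono: "F a \<subseteq> F b" if "a \<le> b" for a b
    using that by (rule lift_Suc_mono_le[rotated]) (use FG GF in blast)
  have Gmono: "G a \<subseteq> G b" if "a \<le> b" for a b
    using that by (rule lift_Suc_mono_le[rotated]) (use FG GF in blast)
  have Gcov: "\<exists>n. p \<in> G n" if "p \<in> topspace X" for p
  proof -
    have "p \<in> (\<Union>n. E n)" using Ecov that by blast
    then obtain n where "p \<in> E n" by blast
    then have "p \<in> G n" using Emono[OF mge[of n]] by (auto simp: G_def)
    then show ?thesis by blast
  qed
  \<comment> \<open>The compact shell \<open>R n\<close> lies in the open shell \<open>N n\<close>,
    and \<open>N n\<close> misses \<open>G a\<close> as soon as \<open>a + 2 \<le> n\<close>. The
    case distinctions catch the indices for which \<open>n - 1\<close> or \<open>n - 2\<close> would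
    be truncated to zero.\<close>
  define R where "R n = F n - (if n = 0 then {} else G (n - 1))" for n
  define N where "N n = G (Suc n) - (if n < 2 then {} else F (n - 2))" for n
  have R: "compactin X (R n)" for n
  proof -
    have "closedin X (topspace X - (if n = 0 then {} else G (n - 1)))" using G by auto
    then have "compactin X ((topspace X - (if n = 0 then {} else G (n - 1))) \<inter> F n)"
      using F by (rule closed_Int_compactin)
    moreover have "(topspace X - (if n = 0 then {} else G (n - 1))) \<inter> F n = R n"
      using compactin_subset_topspace[OF F] by (auto simp: R_def)
    ultimately show ?thesis by simp
  qed
  have Nopen: "openin X (N n)" for n
    unfolding N_def using G Fcl by (auto intro: openin_diff)
  have RN: "R n \<subseteq> N n" for n
  proof -
    have "F (n - 2) \<subseteq> G (n - 1)" if "\<not> n < 2"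
      using FG[of "n - 2"] that by (simp add: Suc_diff_Suc numeral_2_eq_2)
    then show ?thesis using FG[of n] by (auto simp: R_def N_def)
  qed
  have "\<exists>J. finite J \<and> J \<subseteq> {i \<in> I. Kc i \<subseteq> N n} \<and> R n \<subseteq> \<Union>(Lo ` J)" for n
  proof -
    have "R n \<subseteq> \<Union>(Lo ` {i \<in> I. Kc i \<subseteq> N n})"
    proof
      fix p assume "p \<in> R n"
      then have "p \<in> N n" using RN by blast
      from ex[OF Nopen this] show "p \<in> \<Union>(Lo ` {i \<in> I. Kc i \<subseteq> N n})" by (auto simp: I_def)
    qed
    moreover have "\<forall>U\<in>Lo ` {i \<in> I. Kc i \<subseteq> N n}. openin X U" by (auto simp: I_def)
    ultimately obtain \<F> where \<F>: "finite \<F>" "\<F> \<subseteq> Lo ` {i \<in> I. Kc i \<subseteq> N n}" "R n \<subseteq> \<Union>\<F>"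
      using R[of n] unfolding compactin_def by meson
    from finite_subset_image[OF \<F>(1,2)] \<F>(3) show ?thesis by meson
  qed
  then obtain Jn where Jn: "\<And>n. finite (Jn n)" "\<And>n. Jn n \<subseteq> {i \<in> I. Kc i \<subseteq> N n}" "\<And>n. R n \<subseteq> \<Union>(Lo ` Jn n)"
    by metis
  define J where "J = (\<Union>n. Jn n)"
  have JI: "J \<subseteq> I" using Jn(2) by (auto simp: J_def)
  show thesis
  proof (rule that[of J])
    show "countable J" unfolding J_def using Jn(1) by (intro countable_UN) (auto intro: countable_finite)
    show "Q i" "openin X (Lo i) \<and> compactin X (Kc i) \<and> Lo i \<subseteq> Kc i" if "i \<in> J" for i
      using that JI by (auto simp: I_def)
    show "topspace X \<subseteq> (\<Union>i\<in>J. Lo i)"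
    proof
      fix p assume p: "p \<in> topspace X"
      then obtain n0 where "p \<in> F n0" using Gcov GF by blast
      define n where "n = (LEAST n. p \<in> F n)"
      have n: "p \<in> F n" unfolding n_def using \<open>p \<in> F n0\<close> by (rule LeastI)
      have "p \<in> R n"
      proof (cases n)
        case 0
        then show ?thesis using n by (simp add: R_def)
      next
        case (Suc l)
        then have "p \<notin> F l" using not_less_Least[of l "\<lambda>n. p \<in> F n"] by (simp add: n_def)
        then show ?thesis using n Suc GF[of l] by (auto simp: R_def)
      qed
      then have "p \<in> \<Union>(Lo ` Jn n)" using Jn(3)[of n] by (rule subsetD[rotated])
      then show "p \<in> (\<Union>i\<in>J. Lo i)" by (auto simp: J_def)
    qed
    fix p assume "p \<in> topspace X"
    then obtain a where a: "p \<in> G a" using Gcov by blast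
    have "{i \<in> J. Kc i \<inter> G a \<noteq> {}} \<subseteq> (\<Union>n<a + 2. Jn n)"
    proof
      fix i assume i: "i \<in> {i \<in> J. Kc i \<inter> G a \<noteq> {}}"
      then obtain n where n: "i \<in> Jn n" by (auto simp: J_def)
      have "n < a + 2"
      proof (rule ccontr)
        assume "\<not> n < a + 2"
        then have "a \<le> n - 2" "\<not> n < 2" by auto
        then have "G a \<subseteq> F (n - 2)" using GF[of a] Fmono by blast
        then have "N n \<inter> G a = {}" using \<open>\<not> n < 2\<close> by (auto simp: N_def)
        then show False using i Jn(2)[of n] n by blast
      qed
      then show "i \<in> (\<Union>n<a + 2. Jn n)" using n by auto
    qed
    then have "finite {i \<in> J. Kc i \<inter> G a \<noteq> {}}"
      by (rule finite_subset) (use Jn(1) in auto)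
    then show "\<exists>W. openin X W \<and> p \<in> W \<and> finite {i \<in> J. Kc i \<inter> W \<noteq> {}}" using a G by blast
  qed
qed

text \<open>The image of the complement of \<open>O'\<close> may fail to be closed in
  \<open>Y\<close>, as an embedding can have a non-closed image. It is therefore enclosed in the
  closed complement of an open set \<open>T\<close> that cuts out the image of \<open>O'\<close>;
  regularity separates this complement from the compact image of \<open>L\<close>.\<close>

lemma embedding_separates:
  assumes f: "embedding_map X Y f" and Y: "regular_space Y"
    and L: "compactin X L" "L \<subseteq> O'" and O': "openin X O'"
  obtains A B where "openin Y A" "openin Y B" "A \<inter> B = {}" "f ` L \<subseteq> A" "f ` (topspace X - O') \<subseteq> B"
proof -
  have h: "homeomorphic_map X (subtopology Y (f ` topspace X)) f" using f by (simp add: embedding_map_def)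
  have cont: "continuous_map X Y f"
    using homeomorphic_imp_continuous_map[OF h] continuous_map_in_subtopology by blast
  have inj: "inj_on f (topspace X)" using homeomorphic_imp_injective_map[OF h] .
  have "openin (subtopology Y (f ` topspace X)) (f ` O')"
    using O' homeomorphic_map_openness_eq[OF h] by blast
  then obtain T where T: "openin Y T" "f ` O' = T \<inter> f ` topspace X"
    unfolding openin_subtopology by blast
  have "compactin Y (f ` L)" using L(1) cont by (rule image_compactin)
  moreover have "closedin Y (topspace Y - T)" using T(1) by blast
  moreover have "disjnt (f ` L) (topspace Y - T)" using L(2) T(2) by (auto simp: disjnt_def)
  ultimately obtain A B where AB: "openin Y A" "openin Y B" "f ` L \<subseteq> A" "topspace Y - T \<subseteq> B" "disjnt A B"
    using Y unfolding regular_space_compact_closed_sets by meson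
  have "f ` (topspace X - O') \<subseteq> topspace Y - T"
  proof clarify
    fix z assume z: "z \<in> topspace X" "z \<notin> O'"
    have "f z \<in> topspace Y" using cont z(1) by (simp add: continuous_map_def Pi_iff)
    moreover have "f z \<notin> T"
    proof
      assume "f z \<in> T"
      then have "f z \<in> f ` O'" using T(2) z(1) by blast
      then obtain z' where z': "z' \<in> O'" "f z = f z'" by blast
      then have "z' \<in> topspace X" using openin_subset[OF O'] by blast
      then show False using inj z z' by (metis inj_onD)
    qed
    ultimately show "f z \<in> topspace Y - T" by blast
  qed
  with AB that show thesis by (metis disjnt_def order.trans)
qed

text \<open>
  The sets are compared along an enumeration \<open>e\<close> of the cover. Every set has only finitely many
  predecessors; the conditions on a fixed \<open>L j\<close> are then finite in number, and in the proof that
  \<open>h\<close> is open onto its image the predecessors are dealt with by compactness.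
\<close>

lemma embedding_map_by_cover:
  fixes e :: "'i \<Rightarrow> nat"
  assumes X: "Hausdorff_space X" and Y: "Hausdorff_space Y" and h: "continuous_map X Y h" and e: "inj_on e J"
    and cov: "topspace X \<subseteq> (\<Union>j\<in>J. L j)"
    and L: "\<And>j. j \<in> J \<Longrightarrow> compactin X (L j)" "\<And>j. j \<in> J \<Longrightarrow> L j \<subseteq> U j"
    and U: "\<And>j. j \<in> J \<Longrightarrow> openin X (U j)" "\<And>j. j \<in> J \<Longrightarrow> U j \<subseteq> K j"
    and K: "\<And>j. j \<in> J \<Longrightarrow> compactin X (K j)" "\<And>j. j \<in> J \<Longrightarrow> inj_on h (K j)"
    and A: "\<And>j. j \<in> J \<Longrightarrow> openin Y (A j)" "\<And>j. j \<in> J \<Longrightarrow> A j \<inter> B j = {}"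
    and hA: "\<And>j. j \<in> J \<Longrightarrow> h ` L j \<subseteq> A j"
    and hB: "\<And>i j. i \<in> J \<Longrightarrow> j \<in> J \<Longrightarrow> e i < e j \<Longrightarrow> h ` (L j - U i) \<subseteq> B i"
  shows "embedding_map X Y h"
proof -
  \<comment> \<open>For \<open>i\<close> before \<open>j\<close>, a point \<open>y\<close> outside
    \<open>U i\<close> would have \<open>h y\<close> in \<open>B i\<close>, while \<open>h x\<close>
    is in \<open>A i\<close>. So both points lie in \<open>K i\<close>, where \<open>h\<close> is
    injective.\<close>
  have step: "x = y" if "i \<in> J" "j \<in> J" "x \<in> L i" "y \<in> L j" "h x = h y" "e i \<le> e j" for x y i j
  proof -
    have "y \<in> U i"
    proof (cases "i = j")
      case True
      then show ?thesis using L(2) that by blast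
    next
      case False
      then have "e i < e j" using that e by (metis inj_onD le_neq_implies_less)
      then show ?thesis using hB[of i j] hA[of i] A(2)[of i] that by (metis DiffI disjoint_iff image_subset_iff)
    qed
    then show ?thesis using K(2)[of i] U(2)[of i] L(2)[of i] that by (meson inj_onD subsetD)
  qed
  have inj: "inj_on h (topspace X)"
  proof (rule inj_onI)
    fix x y assume xy: "x \<in> topspace X" "y \<in> topspace X" "h x = h y"
    obtain i j where ij: "i \<in> J" "x \<in> L i" "j \<in> J" "y \<in> L j" using cov xy(1,2) by blast
    show "x = y"
    proof (cases "e i \<le> e j")
      case True
      then show ?thesis using step[of i j x y] ij xy(3) by blast
    next
      case False
      then show ?thesis using step[of j i y x] ij xy(3) by force
    qed
  qed
  have hY: "h ` topspace X \<subseteq> topspace Y" using h by (auto simp: continuous_map_def)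
  have cl: "closedin Y (h ` C)" if "compactin X C" for C
    using image_compactin[OF that h] compactin_imp_closedin[OF Y] by blast
  have diffc: "compactin X (C - W)" if "compactin X C" "openin X W" for C W
  proof -
    have "compactin X ((topspace X - W) \<inter> C)"
      by (rule closed_Int_compactin) (use that in auto)
    moreover have "(topspace X - W) \<inter> C = C - W" using compactin_subset_topspace[OF that(1)] by auto
    ultimately show ?thesis by simp
  qed
  have op: "open_map X (subtopology Y (h ` topspace X)) h"
    unfolding open_map_def
  proof (intro allI impI)
    fix W assume W: "openin X W"
    have WX: "W \<subseteq> topspace X" using W by (rule openin_subset)
    show "openin (subtopology Y (h ` topspace X)) (h ` W)"
    proof (subst openin_subopen, intro ballI)
      fix q assume "q \<in> h ` W"
      then obtain x where x: "x \<in> W" "q = h x" by blast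
      obtain i where i: "i \<in> J" "x \<in> L i" using x(1) WX cov by blast
      define P where "P = {j \<in> J. e j < e i}"
      have "finite P"
      proof (rule finite_imageD)
        show "finite (e ` P)" by (rule finite_subset[of _ "{..<e i}"]) (auto simp: P_def)
        show "inj_on e P" by (rule inj_on_subset[OF e]) (auto simp: P_def)
      qed
      \<comment> \<open>One compact set with all that could spoil openness at \<open>q\<close>: the
        points of \<open>K i\<close> outside \<open>W\<close>, and those of the finitely many
        earlier pieces outside \<open>U i\<close>. Points of later pieces outside \<open>U i\<close>
        are sent to \<open>B i\<close>, away from \<open>A i\<close>.\<close>
      define Z where "Z = (K i - W) \<union> (\<Union>j\<in>P. L j - U i)"
      have Z: "compactin X Z"
        unfolding Z_def using K(1) L(1) U(1) i(1) W \<open>finite P\<close>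
        by (intro compactin_Un compactin_Union diffc) (auto simp: P_def intro!: diffc)
      have xZ: "x \<notin> Z" using x(1) i L(2)[OF i(1)] by (auto simp: Z_def)
      define N where "N = A i - h ` Z"
      have N: "openin Y N" unfolding N_def using A(1)[OF i(1)] cl[OF Z] by (rule openin_diff)
      have "q \<notin> h ` Z"
      proof
        assume "q \<in> h ` Z"
        then obtain z where "z \<in> Z" "h z = h x" using x(2) by auto
        then show False
          using xZ inj x(1) WX compactin_subset_topspace[OF Z] by (metis inj_onD subsetD)
      qed
      then have qN: "q \<in> N" using hA[OF i(1)] i(2) x(2) by (auto simp: N_def)
      have NW: "N \<inter> h ` topspace X \<subseteq> h ` W"
      proof clarify
        fix z assume z: "h z \<in> N" "z \<in> topspace X"
        then obtain j where j: "j \<in> J" "z \<in> L j" using cov by blast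
        have zZ: "z \<notin> Z" using z(1) by (auto simp: N_def)
        have hzA: "h z \<in> A i" using z(1) by (simp add: N_def)
        have "z \<in> U i"
        proof (rule ccontr)
          assume nU: "z \<notin> U i"
          have "j \<notin> P" using nU zZ j by (auto simp: Z_def)
          then have "e i \<le> e j" using j by (auto simp: P_def)
          moreover have "i \<noteq> j" using nU j L(2) by blast
          ultimately have "e i < e j" using e i(1) j(1) by (metis inj_onD le_neq_implies_less)
          then show False using hB[OF i(1) j(1)] nU j(2) hzA A(2)[OF i(1)] by blast
        qed
        then have "z \<in> K i" using U(2)[OF i(1)] by blast
        then have "z \<in> W" using zZ by (auto simp: Z_def)
        then show "h z \<in> h ` W" by blast
      qed
      show "\<exists>T. openin (subtopology Y (h ` topspace X)) T \<and> q \<in> T \<and> T \<subseteq> h ` W"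
      proof (intro exI conjI)
        show "openin (subtopology Y (h ` topspace X)) (N \<inter> h ` topspace X)"
          using N unfolding openin_subtopology by blast
        show "q \<in> N \<inter> h ` topspace X" using qN x WX by blast
      qed (rule NW)
    qed
  qed
  have ct: "continuous_map X (subtopology Y (h ` topspace X)) h"
    using h by (simp add: continuous_map_in_subtopology)
  have "h ` topspace X = topspace (subtopology Y (h ` topspace X))"
    using hY by auto
  from bijective_open_imp_homeomorphic_map[OF ct op this inj] show ?thesis
    unfolding embedding_map_def .
qed

section \<open>Openness of the set of embeddings\<close>

lemma expanding_on_subset: "expanding_on c K g \<Longrightarrow> K' \<subseteq> K \<Longrightarrow> expanding_on c K' g"
  unfolding expanding_on_def by (meson subsetD)

lemma openin_half_space_ball: "openin (top_of_set half_space) (ball x r \<inter> half_space)"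
  by (metis open_ball openin_open_Int inf_commute)

lemma compact_half_space_cball: "compact (cball x r \<inter> half_space)"
  by (intro compact_Int_closed compact_cball closed_half_space)

text \<open>Meant for the target, where it separates compact images from closed sets. Closed
  half-balls in charts are the compact neighbourhoods.\<close>

lemma smooth_manifold_imp_regular_space:
  assumes "smooth_manifold X \<A>"
  shows "regular_space X"
proof (rule locally_compact_Hausdorff_imp_regular_space)
  show "Hausdorff_space X" using assms by (rule smooth_manifoldD)
  show "locally_compact_space X"
    unfolding locally_compact_space_def
  proof
    fix p assume "p \<in> topspace X"
    then obtain U \<phi> where U: "(U, \<phi>) \<in> \<A>" "p \<in> \<phi> ` U" using smooth_manifoldD(4)[OF assms] by blast
    have t: "topological_chart X (U, \<phi>)" using smooth_manifoldD(3)[OF assms U(1)] .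
    obtain x where x: "x \<in> U" "p = \<phi> x" using U(2) by blast
    obtain r where r: "0 < r" "cball x r \<inter> half_space \<subseteq> U"
      using openin_half_space_cball[OF topological_chartD(1)[OF t] x(1)] .
    have sub: "ball x r \<inter> half_space \<subseteq> cball x r \<inter> half_space" by auto
    have "openin X (\<phi> ` (ball x r \<inter> half_space))"
      using r(2) sub by (intro openin_chart_image[OF t] openin_half_space_ball) blast
    moreover have "compactin X (\<phi> ` (cball x r \<inter> half_space))"
      by (rule compactin_chart_image[OF t compact_half_space_cball r(2)])
    moreover have "x \<in> ball x r \<inter> half_space" using r(1) x(1) topological_chartD(3)[OF t] by auto
    ultimately show "\<exists>V K. openin X V \<and> compactin X K \<and> p \<in> V \<and> V \<subseteq> K"
      using sub x(2) by (meson image_eqI image_mono)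
  qed
qed

lemma Imm_locally_expanding:
  fixes \<A> :: "('p, 'm::{finite,linorder}) chart set" and \<B> :: "('q, 'n::{finite,linorder}) chart set"
  assumes M: "smooth_manifold X \<A>" and N: "smooth_manifold Y \<B>"
    and f: "f \<in> Imm k X \<A> Y \<B>" and T: "openin X T" "p \<in> T"
  obtains U \<phi> V \<psi> x r c where "(U, \<phi>) \<in> \<A>" "(V, \<psi>) \<in> \<B>" "x \<in> U" "\<phi> x = p" "0 < r"
    "cball x r \<inter> half_space \<subseteq> U" "\<phi> ` U \<subseteq> T" "(\<lambda>x. f (\<phi> x)) ` U \<subseteq> \<psi> ` V"
    "0 < c" "expanding_on c (cball x r \<inter> half_space) (local_rep \<phi> V \<psi> f)"
proof -
  have fC: "f \<in> Ck1_maps k X \<A> Y \<B>" using f by (simp add: Imm_def)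
  then have cont: "continuous_map X Y f" by (simp add: Ck1_maps_def)
  have pX: "p \<in> topspace X" using T openin_subset by blast
  obtain U0 \<phi> x where U0: "(U0, \<phi>) \<in> \<A>" "x \<in> U0" "\<phi> x = p" using smooth_manifoldD(4)[OF M pX] by blast
  have "f p \<in> topspace Y" using cont pX by (auto simp: continuous_map_def)
  then obtain V \<psi> where V: "(V, \<psi>) \<in> \<B>" "f p \<in> \<psi> ` V" using smooth_manifoldD(4)[OF N] by blast
  have t0: "topological_chart X (U0, \<phi>)" and tV: "topological_chart Y (V, \<psi>)"
    using smooth_manifoldD(3)[OF M U0(1)] smooth_manifoldD(3)[OF N V(1)] .
  define U1 where "U1 = {u \<in> U0. f (\<phi> u) \<in> \<psi> ` V} \<inter> {u \<in> U0. id (\<phi> u) \<in> T}"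
  have U1: "openin (top_of_set half_space) U1"
    unfolding U1_def
    by (intro openin_Int openin_chart_preimage[OF t0 topological_chartD(2)[OF tV] cont]
        openin_chart_preimage[OF t0 T(1)]) simp
  define g where "g = local_rep \<phi> V \<psi> f"
  have "Ck1_on k (local_dom U0 \<phi> V \<psi> f) g" "openin (top_of_set half_space) (local_dom U0 \<phi> V \<psi> f)"
    using fC U0(1) V(1) openin_local_dom[OF t0 tV cont] by (auto simp: Ck1_maps_def g_def)
  moreover have "x \<in> local_dom U0 \<phi> V \<psi> f" using U0 V by (simp add: local_dom_def)
  ultimately obtain r1 L where r1: "0 < r1" "L-lipschitz_on (cball x r1 \<inter> half_space) g"
    using Ck1_on_locally_lipschitz by metis
  \<comment> \<open>Three requirements shrink the chart: its image lies in \<open>T\<close>,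
    \<open>f\<close> sends that image into the image of the second chart as the definition of
    \<open>Imm\<close> demands, and the local representation is Lipschitz on all of
    \<open>U\<close>.\<close>
  define U where "U = U1 \<inter> (ball x r1 \<inter> half_space)"
  have Uo: "openin (top_of_set half_space) U"
    unfolding U_def by (intro openin_Int U1 openin_half_space_ball)
  have UU0: "U \<subseteq> U0" by (auto simp: U_def U1_def)
  have U: "(U, \<phi>) \<in> \<A>" by (rule chart_restrict[OF M U0(1) Uo UU0])
  have xU: "x \<in> U"
    using U0 V T r1 topological_chartD(3)[OF t0] by (auto simp: U_def U1_def)
  have UV: "(\<lambda>x. f (\<phi> x)) ` U \<subseteq> \<psi> ` V" by (auto simp: U_def U1_def)
  have lip: "L-lipschitz_on U g"
    by (rule lipschitz_on_subset[OF r1(2)]) (auto simp: U_def)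
  have "0 < (INF A\<in>clarke_derivative U g x. ereal (singular_value CARD('m) A))"
    using f U V(1) UV xU unfolding Imm_def g_def by fast
  \<comment> \<open>The infimum lives in the extended reals; a real number strictly between zero and
    it serves as the rate.\<close>
  then obtain c where c: "0 < ereal c" "ereal c < (INF A\<in>clarke_derivative U g x. ereal (singular_value CARD('m) A))"
    using ereal_dense2 by blast
  have "c * norm v \<le> norm (A *v v)" if A: "A \<in> clarke_derivative U g x" for A v
  proof -
    have "ereal c \<le> ereal (singular_value CARD('m) A)"
      using c(2) INF_lower[OF A, of "\<lambda>A. ereal (singular_value CARD('m) A)"] by (meson less_imp_le order.trans)
    then show ?thesis using le_smallest_singular_value_iff[of c A] by simp
  qed
  moreover obtain r2 where r2: "0 < r2" "cball x r2 \<inter> half_space \<subseteq> U"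
    using openin_half_space_cball[OF Uo xU] .
  moreover have "0 < c" using c(1) by simp
  ultimately obtain r where r: "0 < r" "r \<le> r2" "expanding_on (c / 2) (cball x r \<inter> half_space) g"
    using clarke_imp_expanding[OF Uo xU r2 lip] by blast
  show thesis
  proof (rule that[OF U V(1) xU U0(3) r(1)])
    show "cball x r \<inter> half_space \<subseteq> U" using r(2) r2(2) by auto
    show "\<phi> ` U \<subseteq> T" by (auto simp: U_def U1_def)
    show "0 < c / 2" using \<open>0 < c\<close> by simp
    show "expanding_on (c / 2) (cball x r \<inter> half_space) (local_rep \<phi> V \<psi> f)" using r(3) by (simp add: g_def)
  qed (rule UV)
qed

text \<open>Translates a topological condition on the target into a uniform distance in chart
  coordinates: a compact set has a positive distance from the complement of an open set around
  it.\<close>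

lemma uniform_nbhd_in_chart:
  assumes t: "topological_chart Y (V, \<psi>)" and T: "openin Y T"
    and C: "compact C" "continuous_on C g" "\<And>a. a \<in> C \<Longrightarrow> g a \<in> V \<and> \<psi> (g a) \<in> T"
  obtains \<delta> where "0 < \<delta>" "\<And>a b. a \<in> C \<Longrightarrow> b \<in> V \<Longrightarrow> norm (b - g a) < \<delta> \<Longrightarrow> \<psi> b \<in> T"
proof -
  have "openin (top_of_set half_space) {y \<in> V. id (\<psi> y) \<in> T}"
    by (rule openin_chart_preimage[OF t T]) simp
  then obtain T' where T': "open T'" "{y \<in> V. \<psi> y \<in> T} = half_space \<inter> T'"
    by (auto simp: openin_open)
  have "g ` C \<subseteq> T'" using C(3) T'(2) by blast
  then obtain \<delta> where \<delta>: "0 < \<delta>" "(\<Union>y\<in>g ` C. ball y \<delta>) \<subseteq> T'"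
    using compact_subset_open_imp_ball_epsilon_subset[OF compact_continuous_image[OF C(2,1)] T'(1)] by metis
  show thesis
  proof (rule that[OF \<delta>(1)])
    fix a b assume ab: "a \<in> C" "b \<in> V" "norm (b - g a) < \<delta>"
    then have "b \<in> ball (g a) \<delta>" by (simp add: dist_norm norm_minus_commute)
    then have "b \<in> T'" using \<delta>(2) ab(1) by blast
    moreover have "b \<in> half_space" using ab(2) topological_chartD(3)[OF t] by blast
    ultimately show "\<psi> b \<in> T" using T'(2) by blast
  qed
qed

text \<open>A bound on \<open>frechet_derivative\<close> is meaningful only where the derivative
  exists. For \<open>k > 0\<close> this is ensured for the difference because both maps belong to
  \<open>Ck1_maps\<close> and send \<open>K\<close> into the image of the second chart.\<close>

lemma elementary_nbhdD:
  assumes h: "h \<in> elementary_nbhd k X \<A> Y \<B> f (K, (U, \<phi>), (V, \<psi>), ennreal \<delta>)"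
    and f: "f \<in> Ck1_maps k X \<A> Y \<B>" and \<delta>: "0 < \<delta>" and U: "(U, \<phi>) \<in> \<A>" and V: "(V, \<psi>) \<in> \<B>"
    and K: "convex K" "K \<subseteq> half_space" "K \<subseteq> U" "(\<lambda>x. f (\<phi> x)) ` K \<subseteq> \<psi> ` V"
  shows "h \<in> Ck1_maps k X \<A> Y \<B>" "(\<lambda>x. h (\<phi> x)) ` K \<subseteq> \<psi> ` V"
    "\<And>a. a \<in> K \<Longrightarrow> norm (local_rep \<phi> V \<psi> h a - local_rep \<phi> V \<psi> f a) < \<delta>"
    "\<delta>-lipschitz_on K (\<lambda>a. local_rep \<phi> V \<psi> h a - local_rep \<phi> V \<psi> f a)"
proof -
  show hC: "h \<in> Ck1_maps k X \<A> Y \<B>" and hK: "(\<lambda>x. h (\<phi> x)) ` K \<subseteq> \<psi> ` V"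
    using h by (auto simp: elementary_nbhd_def)
  have less: "Ck1_norm k K (\<lambda>x. local_rep \<phi> V \<psi> h x - local_rep \<phi> V \<psi> f x) < ennreal \<delta>"
    using h by (simp add: elementary_nbhd_def)
  show "norm (local_rep \<phi> V \<psi> h a - local_rep \<phi> V \<psi> f a) < \<delta>" if "a \<in> K" for a
    using Ck1_norm_imp_norm_less[OF less \<delta> that] .
  have diff: "local_rep \<phi> V \<psi> u differentiable (at a within half_space)"
    if "0 < k" "a \<in> K" "u \<in> Ck1_maps k X \<A> Y \<B>" "(\<lambda>x. u (\<phi> x)) ` K \<subseteq> \<psi> ` V" for u a
  proof -
    have "Ck1_on k (local_dom U \<phi> V \<psi> u) (local_rep \<phi> V \<psi> u)"
      using that(3) U V by (auto simp: Ck1_maps_def)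
    then have "Ck_on k (local_dom U \<phi> V \<psi> u) (local_rep \<phi> V \<psi> u)" by (simp add: Ck1_on_def)
    from Ck_on_differentiable[OF this that(1), of a] show ?thesis
      using that(2,4) K(3) by (intro differentiableI) (auto simp: local_dom_def)
  qed
  show "\<delta>-lipschitz_on K (\<lambda>a. local_rep \<phi> V \<psi> h a - local_rep \<phi> V \<psi> f a)"
  proof (rule Ck1_norm_imp_lipschitz[OF less \<delta> K(1,2)])
    fix a assume "0 < k" "a \<in> K"
    then show "(\<lambda>a. local_rep \<phi> V \<psi> h a - local_rep \<phi> V \<psi> f a) differentiable (at a within half_space)"
      using diff[OF _ _ hC hK] diff[OF _ _ f K(4)] by (intro differentiable_diff) auto
  qed
qed

text \<open>
  A tuple of a point \<open>x\<close>, a radius \<open>r\<close> and a rate \<open>c\<close> for the local representation of the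
  immersion in two charts on the half-ball of radius \<open>r\<close> around \<open>x\<close>.
\<close>

type_synonym ('p, 'm, 'q, 'n) expanding_datum =
  "'m euc \<times> real \<times> real \<times> ('p, 'm) chart \<times> ('q, 'n) chart"

lemma Emb_contains_strong_basis_element:
  fixes \<A> :: "('p, 'm::{finite,linorder}) chart set" and \<B> :: "('q, 'n::{finite,linorder}) chart set"
  assumes M: "smooth_manifold X \<A>" and N: "smooth_manifold Y \<B>" and f: "f \<in> Emb k X \<A> Y \<B>"
  obtains \<W> where "\<W> \<in> strong_basis k X \<A> Y \<B>" "f \<in> \<W>" "\<W> \<subseteq> Emb k X \<A> Y \<B>"
proof -
  have fI: "f \<in> Imm k X \<A> Y \<B>" and femb: "embedding_map X Y f" using f by (auto simp: Emb_def)
  have fC: "f \<in> Ck1_maps k X \<A> Y \<B>" using fI by (simp add: Imm_def)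
  have fcont: "continuous_map X Y f" using fC by (simp add: Ck1_maps_def)
  define cx cr cc where "cx i = fst i" and "cr i = fst (snd i)" and "cc i = fst (snd (snd i))"
    for i :: "('p, 'm, 'q, 'n) expanding_datum"
  define U \<phi> where "U i = fst (fst (snd (snd (snd i))))" and "\<phi> i = snd (fst (snd (snd (snd i))))"
    for i :: "('p, 'm, 'q, 'n) expanding_datum"
  define V \<psi> where "V i = fst (snd (snd (snd (snd i))))" and "\<psi> i = snd (snd (snd (snd (snd i))))"
    for i :: "('p, 'm, 'q, 'n) expanding_datum"
  note proj = cx_def cr_def cc_def U_def \<phi>_def V_def \<psi>_def
  \<comment> \<open>For positive radius each of \<open>S'\<close>, \<open>L\<close>,
    \<open>S\<close>, \<open>K\<close> is contained in the next: the open \<open>S'\<close> cover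
    the manifold, the compact \<open>L\<close> are the pieces compared along the enumeration,
    \<open>S\<close> are their open neighbourhoods, and the compact \<open>K\<close> enter the
    neighbourhood data.\<close>
  define K where "K i = cball (cx i) (cr i) \<inter> half_space" for i
  define S where "S i = ball (cx i) (cr i) \<inter> half_space" for i
  define L where "L i = cball (cx i) (cr i / 2) \<inter> half_space" for i
  define S' where "S' i = ball (cx i) (cr i / 2) \<inter> half_space" for i
  define rep where "rep i h = local_rep (\<phi> i) (V i) (\<psi> i) h" for i and h :: "'p \<Rightarrow> 'q"
  define Q where "Q i \<longleftrightarrow> (U i, \<phi> i) \<in> \<A> \<and> (V i, \<psi> i) \<in> \<B> \<and> 0 < cr i \<and> K i \<subseteq> U i \<and>
    (\<lambda>x. f (\<phi> i x)) ` U i \<subseteq> \<psi> i ` V i \<and> 0 < cc i \<and> expanding_on (cc i) (K i) (rep i f)" for i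
  have sub: "S' i \<subseteq> L i" "S i \<subseteq> K i" and LS: "Q i \<Longrightarrow> L i \<subseteq> S i" for i
    by (auto simp: S'_def L_def S_def K_def Q_def)
  have KH: "K i \<subseteq> half_space" for i by (auto simp: K_def)
  have oS: "openin (top_of_set half_space) (S i)" "openin (top_of_set half_space) (S' i)" for i
    unfolding S_def S'_def by (rule openin_half_space_ball)+
  have cK: "compact (K i)" "compact (L i)" for i
    unfolding K_def L_def by (rule compact_half_space_cball)+
  have tU: "topological_chart X (U i, \<phi> i)" and tV: "topological_chart Y (V i, \<psi> i)" if "Q i" for i
    using that smooth_manifoldD(3)[OF M] smooth_manifoldD(3)[OF N] by (auto simp: Q_def)
  have sets: "K i \<subseteq> U i" "S i \<subseteq> U i" "S' i \<subseteq> U i" "L i \<subseteq> U i" if "Q i" for i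
    using that sub[of i] LS[OF that] by (auto simp: Q_def)
  have ex: "\<exists>i. Q i \<and> p \<in> \<phi> i ` S' i \<and> openin X (\<phi> i ` S' i) \<and> compactin X (\<phi> i ` K i) \<and>
      \<phi> i ` S' i \<subseteq> \<phi> i ` K i \<and> \<phi> i ` K i \<subseteq> T" if T: "openin X T" "p \<in> T" for p T
  proof -
    obtain U0 \<phi>0 V0 \<psi>0 x r c where i: "(U0, \<phi>0) \<in> \<A>" "(V0, \<psi>0) \<in> \<B>" "x \<in> U0" "\<phi>0 x = p" "0 < r"
      "cball x r \<inter> half_space \<subseteq> U0" "\<phi>0 ` U0 \<subseteq> T" "(\<lambda>x. f (\<phi>0 x)) ` U0 \<subseteq> \<psi>0 ` V0"
      "0 < c" "expanding_on c (cball x r \<inter> half_space) (local_rep \<phi>0 V0 \<psi>0 f)"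
      using Imm_locally_expanding[OF M N fI T] by blast
    define j where "j = (x, r, c, (U0, \<phi>0), (V0, \<psi>0))"
    have j: "cx j = x" "cr j = r" "cc j = c" "U j = U0" "\<phi> j = \<phi>0" "V j = V0" "\<psi> j = \<psi>0"
      by (simp_all add: j_def proj)
    have Q: "Q j" using i unfolding Q_def j K_def rep_def by blast
    have "x \<in> half_space" using topological_chartD(3)[OF tU[OF Q]] i(3) by (auto simp: j)
    then have "x \<in> S' j" using i(5) by (simp add: S'_def j)
    then have "p \<in> \<phi> j ` S' j" using i(4) j(5) by blast
    moreover have "openin X (\<phi> j ` S' j)" by (rule openin_chart_image[OF tU[OF Q] oS(2) sets(3)[OF Q]])
    moreover have "compactin X (\<phi> j ` K j)" by (rule compactin_chart_image[OF tU[OF Q] cK(1) sets(1)[OF Q]])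
    moreover have "\<phi> j ` S' j \<subseteq> \<phi> j ` K j" using sub[of j] LS[OF Q] by blast
    moreover have "\<phi> j ` K j \<subseteq> T" using sets(1)[OF Q] i(7) j by blast
    ultimately show ?thesis using Q by blast
  qed
  obtain J where J: "countable J" "\<And>i. i \<in> J \<Longrightarrow> Q i"
    "\<And>i. i \<in> J \<Longrightarrow> openin X (\<phi> i ` S' i) \<and> compactin X (\<phi> i ` K i) \<and> \<phi> i ` S' i \<subseteq> \<phi> i ` K i"
    "topspace X \<subseteq> (\<Union>i\<in>J. \<phi> i ` S' i)"
    "\<And>p. p \<in> topspace X \<Longrightarrow> \<exists>W. openin X W \<and> p \<in> W \<and> finite {i \<in> J. \<phi> i ` K i \<inter> W \<noteq> {}}"
    by (rule countable_locally_finite_cover[OF smooth_manifoldD(1,2)[OF M],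
          of Q "\<lambda>i. \<phi> i ` S' i" "\<lambda>i. \<phi> i ` K i"]) (erule (1) ex, rule that)
  define e where "e = to_nat_on J"
  have e: "inj_on e J" using J(1) by (simp add: e_def inj_on_to_nat_on)
  have OL: "openin X (\<phi> i ` S i)" "compactin X (\<phi> i ` L i)" "compactin X (\<phi> i ` K i)"
    "\<phi> i ` L i \<subseteq> \<phi> i ` S i" "\<phi> i ` S i \<subseteq> \<phi> i ` K i" if "i \<in> J" for i
  proof -
    note Qi = J(2)[OF that]
    show "openin X (\<phi> i ` S i)" by (rule openin_chart_image[OF tU[OF Qi] oS(1) sets(2)[OF Qi]])
    show "compactin X (\<phi> i ` L i)" by (rule compactin_chart_image[OF tU[OF Qi] cK(2) sets(4)[OF Qi]])
    show "compactin X (\<phi> i ` K i)" by (rule compactin_chart_image[OF tU[OF Qi] cK(1) sets(1)[OF Qi]])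
    show "\<phi> i ` L i \<subseteq> \<phi> i ` S i" using LS[OF Qi] by (rule image_mono)
    show "\<phi> i ` S i \<subseteq> \<phi> i ` K i" using sub(2) by (rule image_mono)
  qed
  define sep where "sep i A B \<longleftrightarrow> openin Y A \<and> openin Y B \<and> A \<inter> B = {} \<and>
    f ` (\<phi> i ` L i) \<subseteq> A \<and> f ` (topspace X - \<phi> i ` S i) \<subseteq> B" for i A B
  have "\<exists>A B. sep i A B" if i: "i \<in> J" for i
    by (rule embedding_separates[OF femb smooth_manifold_imp_regular_space[OF N] OL(2)[OF i] OL(4)[OF i] OL(1)[OF i]])
      (unfold sep_def, blast)
  then obtain A B where "\<And>i. i \<in> J \<Longrightarrow> sep i (A i) (B i)" by metis
  then have AB: "openin Y (A i)" "openin Y (B i)" "A i \<inter> B i = {}" "f ` (\<phi> i ` L i) \<subseteq> A i"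
    "f ` (topspace X - \<phi> i ` S i) \<subseteq> B i" if "i \<in> J" for i
    using that unfolding sep_def by blast+
  have fV: "rep i f a \<in> V i \<and> \<psi> i (rep i f a) = f (\<phi> i a)" if "i \<in> J" "a \<in> U i" for i a
  proof -
    have "f (\<phi> i a) \<in> \<psi> i ` V i" using J(2)[OF that(1)] that(2) by (auto simp: Q_def)
    then show ?thesis by (auto simp: rep_def local_rep_def intro: inv_into_into f_inv_into_f)
  qed
  have fcontU: "continuous_on (U i) (rep i f)" if "i \<in> J" for i
  proof -
    have "local_dom (U i) (\<phi> i) (V i) (\<psi> i) f = U i"
      using J(2)[OF that] by (auto simp: Q_def local_dom_def)
    then show ?thesis
      using continuous_on_local_rep[OF tU[OF J(2)[OF that]] tV[OF J(2)[OF that]] fcont] by (simp add: rep_def)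
  qed
  define near where "near j C T \<delta> \<longleftrightarrow> 0 < \<delta> \<and>
    (\<forall>a\<in>C. \<forall>b\<in>V j. norm (b - rep j f a) < \<delta> \<longrightarrow> \<psi> j b \<in> T)" for j C T and \<delta> :: real
  have near: "\<exists>\<delta>. near j C T \<delta>"
    if j: "j \<in> J" and C: "compact C" "C \<subseteq> U j" and T: "openin Y T" "\<And>a. a \<in> C \<Longrightarrow> f (\<phi> j a) \<in> T" for j C T
  proof -
    have "continuous_on C (rep j f)" using fcontU[OF j] C(2) by (rule continuous_on_subset)
    moreover have "rep j f a \<in> V j \<and> \<psi> j (rep j f a) \<in> T" if "a \<in> C" for a
      using fV[OF j, of a] C(2) T(2)[OF that] that by auto
    ultimately obtain \<delta> where "0 < \<delta>" "\<And>a b. a \<in> C \<Longrightarrow> b \<in> V j \<Longrightarrow> norm (b - rep j f a) < \<delta> \<Longrightarrow> \<psi> j b \<in> T"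
      by (rule uniform_nbhd_in_chart[OF tV[OF J(2)[OF j]] T(1) C(1)]) (blast, rule that)
    then show ?thesis unfolding near_def by blast
  qed
  have "\<exists>\<delta>. near j (L j) (A j) \<delta>" if j: "j \<in> J" for j
    by (rule near[OF j cK(2) sets(4)[OF J(2)[OF j]] AB(1)[OF j]]) (use AB(4)[OF j] in blast)
  then obtain \<delta>A where "\<And>j. j \<in> J \<Longrightarrow> near j (L j) (A j) (\<delta>A j)" by metis
  then have \<delta>A: "0 < \<delta>A j" "\<And>a b. a \<in> L j \<Longrightarrow> b \<in> V j \<Longrightarrow> norm (b - rep j f a) < \<delta>A j \<Longrightarrow> \<psi> j b \<in> A j"
    if "j \<in> J" for j
    using that unfolding near_def by blast+
  \<comment> \<open>The part of \<open>L j\<close> outside \<open>S i\<close> is compact, and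
    \<open>f\<close> sends it into the open set \<open>B i\<close>; the tolerance makes nearby maps
    do the same.\<close>
  have "\<exists>\<delta>. near j {a \<in> L j. \<phi> j a \<notin> \<phi> i ` S i} (B i) \<delta>" if i: "i \<in> J" and j: "j \<in> J" for i j
  proof (rule near[OF j _ _ AB(2)[OF i]])
    note Qj = J(2)[OF j]
    have "openin (top_of_set half_space) {a \<in> U j. id (\<phi> j a) \<in> \<phi> i ` S i}"
      by (rule openin_chart_preimage[OF tU[OF Qj] OL(1)[OF i]]) simp
    then obtain T where T: "open T" "{a \<in> U j. \<phi> j a \<in> \<phi> i ` S i} = half_space \<inter> T"
      by (auto simp: openin_open)
    have "{a \<in> L j. \<phi> j a \<notin> \<phi> i ` S i} = L j \<inter> - T"
    proof -
      have "L j \<subseteq> half_space" by (auto simp: L_def)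
      then show ?thesis using T(2) sets(4)[OF Qj] by blast
    qed
    then show "compact {a \<in> L j. \<phi> j a \<notin> \<phi> i ` S i}"
      using cK(2)[of j] T(1) by (simp add: compact_Int_closed closed_Compl)
    show "{a \<in> L j. \<phi> j a \<notin> \<phi> i ` S i} \<subseteq> U j" using sets(4)[OF Qj] by blast
    fix a assume a: "a \<in> {a \<in> L j. \<phi> j a \<notin> \<phi> i ` S i}"
    then have "\<phi> j a \<in> topspace X - \<phi> i ` S i"
      using compactin_subset_topspace[OF OL(2)[OF j]] by blast
    then show "f (\<phi> j a) \<in> B i" using AB(5)[OF i] by blast
  qed
  note ex_near = this
  define \<delta>B where "\<delta>B i j = (SOME \<delta>. near j {a \<in> L j. \<phi> j a \<notin> \<phi> i ` S i} (B i) \<delta>)" for i j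
  have "near j {a \<in> L j. \<phi> j a \<notin> \<phi> i ` S i} (B i) (\<delta>B i j)" if "i \<in> J" "j \<in> J" for i j
    unfolding \<delta>B_def by (rule someI_ex) (rule ex_near[OF that])
  then have \<delta>B: "0 < \<delta>B i j" "\<And>a b. a \<in> L j \<Longrightarrow> \<phi> j a \<notin> \<phi> i ` S i \<Longrightarrow> b \<in> V j \<Longrightarrow>
      norm (b - rep j f a) < \<delta>B i j \<Longrightarrow> \<psi> j b \<in> B i" if "i \<in> J" "j \<in> J" for i j
    using that unfolding near_def by blast+
  \<comment> \<open>The first entry leaves half of the expansion rate, the second keeps the image of
    \<open>L j\<close> in \<open>A j\<close>, and the others keep the image of the part of
    \<open>L j\<close> outside \<open>S i\<close> in \<open>B i\<close>, for the earlier
    \<open>i\<close>. These are finitely many because \<open>e\<close> is injective into the natural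
    numbers.\<close>
  define \<delta> where "\<delta> j = Min (insert (cc j / 2) (insert (\<delta>A j) ((\<lambda>i. \<delta>B i j) ` {i \<in> J. e i < e j})))" for j
  have fin: "finite {i \<in> J. e i < e j}" for j
  proof (rule finite_imageD)
    show "finite (e ` {i \<in> J. e i < e j})" by (rule finite_subset[of _ "{..<e j}"]) auto
    show "inj_on e {i \<in> J. e i < e j}" by (rule inj_on_subset[OF e]) auto
  qed
  have \<delta>: "0 < \<delta> j" "\<delta> j \<le> cc j / 2" "\<delta> j \<le> \<delta>A j" "\<And>i. i \<in> J \<Longrightarrow> e i < e j \<Longrightarrow> \<delta> j \<le> \<delta>B i j" if j: "j \<in> J" for j
  proof -
    have "0 < cc j / 2" using J(2)[OF j] by (simp add: Q_def)
    then show "0 < \<delta> j" unfolding \<delta>_def using fin[of j] \<delta>A(1)[OF j] \<delta>B(1)[OF _ j] by (subst Min_gr_iff) auto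
    show "\<delta> j \<le> cc j / 2" "\<delta> j \<le> \<delta>A j" unfolding \<delta>_def using fin[of j] by (intro Min_le; simp)+
    show "\<delta> j \<le> \<delta>B i j" if "i \<in> J" "e i < e j" for i
      unfolding \<delta>_def using fin[of j] that by (intro Min_le) auto
  qed
  define dat where "dat j = (K j, (U j, \<phi> j), (V j, \<psi> j), ennreal (\<delta> j))" for j
  define \<W> where "\<W> = Ck1_maps k X \<A> Y \<B> \<inter> (\<Inter>d\<in>dat ` J. elementary_nbhd k X \<A> Y \<B> f d)"
  have fK: "(\<lambda>x. f (\<phi> j x)) ` K j \<subseteq> \<psi> j ` V j" if "j \<in> J" for j
  proof -
    have "(\<lambda>x. f (\<phi> j x)) ` U j \<subseteq> \<psi> j ` V j" using J(2)[OF that] by (simp add: Q_def)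
    then show ?thesis using sets(1)[OF J(2)[OF that]] by blast
  qed
  have "\<W> \<in> strong_basis k X \<A> Y \<B>"
    unfolding strong_basis_def
  proof (intro CollectI exI conjI)
    show "\<W> = Ck1_maps k X \<A> Y \<B> \<inter> (\<Inter>d\<in>dat ` J. elementary_nbhd k X \<A> Y \<B> f d)" by (rule \<W>_def)
    show "f \<in> Ck1_maps k X \<A> Y \<B>" by (rule fC)
    show "\<forall>d\<in>dat ` J. admissible_datum \<A> \<B> f d"
    proof
      fix d assume "d \<in> dat ` J"
      then obtain j where j: "j \<in> J" and d: "d = dat j" by (auto simp only: image_iff)
      have "(U j, \<phi> j) \<in> \<A>" "(V j, \<psi> j) \<in> \<B>" using J(2)[OF j] by (auto simp: Q_def)
      then show "admissible_datum \<A> \<B> f d"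
        unfolding d using cK(1)[of j] sets(1)[OF J(2)[OF j]] fK[OF j] \<delta>(1)[OF j]
        by (simp add: dat_def admissible_datum_def)
    qed
    show "locally_finite_data X (dat ` J)"
      unfolding locally_finite_data_def
    proof
      fix p assume "p \<in> topspace X"
      from J(5)[OF this] obtain W where W: "openin X W" "p \<in> W" "finite {i \<in> J. \<phi> i ` K i \<inter> W \<noteq> {}}" by blast
      \<comment> \<open>Local finiteness is known for the indices and is required for the set of
        data, which the map \<open>dat\<close> can only make smaller by identifying indices.\<close>
      have "{(K, (U, \<phi>), (V, \<psi>), \<epsilon>) \<in> dat ` J. \<phi> ` K \<inter> W \<noteq> {}} \<subseteq> dat ` {i \<in> J. \<phi> i ` K i \<inter> W \<noteq> {}}"
      proof
        fix z assume z: "z \<in> {(K, (U, \<phi>), (V, \<psi>), \<epsilon>) \<in> dat ` J. \<phi> ` K \<inter> W \<noteq> {}}"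
        obtain K0 U0 \<phi>0 V0 \<psi>0 \<epsilon>0 where "z = (K0, (U0, \<phi>0), (V0, \<psi>0), \<epsilon>0)" by (metis surj_pair)
        then have "z \<in> dat ` J" using z by (simp only: mem_Collect_eq prod.case)
        then obtain j where j: "j \<in> J" "z = dat j" by (auto simp only: image_iff)
        have "\<phi> j ` K j \<inter> W \<noteq> {}" using z unfolding j(2) by (simp add: dat_def)
        then show "z \<in> dat ` {i \<in> J. \<phi> i ` K i \<inter> W \<noteq> {}}" using j by blast
      qed
      then have "finite {(K, (U, \<phi>), (V, \<psi>), \<epsilon>) \<in> dat ` J. \<phi> ` K \<inter> W \<noteq> {}}"
        using W(3) by (meson finite_imageI finite_subset)
      then show "\<exists>W. openin X W \<and> p \<in> W \<and> finite {(K, (U, \<phi>), (V, \<psi>), \<epsilon>) \<in> dat ` J. \<phi> ` K \<inter> W \<noteq> {}}"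
        using W by blast
    qed
  qed
  moreover have "f \<in> \<W>"
  proof -
    have "f \<in> elementary_nbhd k X \<A> Y \<B> f (dat j)" if j: "j \<in> J" for j
      using fC fK[OF j] \<delta>(1)[OF j] by (simp add: elementary_nbhd_def dat_def Ck1_norm_zero[OF KH])
    then show ?thesis using fC by (simp add: \<W>_def)
  qed
  moreover have "\<W> \<subseteq> Emb k X \<A> Y \<B>"
  proof
    fix h assume h: "h \<in> \<W>"
    have hC: "h \<in> Ck1_maps k X \<A> Y \<B>" using h by (simp add: \<W>_def)
    have hcont: "continuous_map X Y h" using hC by (simp add: Ck1_maps_def)
    have el: "h \<in> elementary_nbhd k X \<A> Y \<B> f (K j, (U j, \<phi> j), (V j, \<psi> j), ennreal (\<delta> j))" if "j \<in> J" for j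
      using h that by (auto simp: \<W>_def dat_def)
    have convK: "convex (K j)" for j unfolding K_def by (intro convex_Int convex_cball convex_half_space)
    have ch: "(U j, \<phi> j) \<in> \<A>" "(V j, \<psi> j) \<in> \<B>" if "j \<in> J" for j using J(2)[OF that] by (auto simp: Q_def)
    have D: "(\<lambda>x. h (\<phi> j x)) ` K j \<subseteq> \<psi> j ` V j"
      "\<And>a. a \<in> K j \<Longrightarrow> norm (rep j h a - rep j f a) < \<delta> j"
      "(\<delta> j)-lipschitz_on (K j) (\<lambda>a. rep j h a - rep j f a)" if j: "j \<in> J" for j
      using elementary_nbhdD(2-4)[OF el[OF j] fC \<delta>(1)[OF j] ch[OF j] convK KH sets(1)[OF J(2)[OF j]] fK[OF j]]
      unfolding rep_def by blast+
    have hV: "rep j h a \<in> V j" "\<psi> j (rep j h a) = h (\<phi> j a)" if "j \<in> J" "a \<in> K j" for j a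
    proof -
      have "h (\<phi> j a) \<in> \<psi> j ` V j" using D(1)[OF that(1)] that(2) by blast
      then show "rep j h a \<in> V j" "\<psi> j (rep j h a) = h (\<phi> j a)"
        by (auto simp: rep_def local_rep_def intro: inv_into_into f_inv_into_f)
    qed
    have exp: "expanding_on (cc j / 2) (K j) (rep j h)" if j: "j \<in> J" for j
    proof -
      have "expanding_on (cc j) (K j) (rep j f)" using J(2)[OF j] by (simp add: Q_def)
      moreover have "(cc j / 2)-lipschitz_on (K j) (\<lambda>a. rep j h a - rep j f a)"
        using D(3)[OF j] \<delta>(2)[OF j] by (rule lipschitz_on_le)
      ultimately have "expanding_on (cc j - cc j / 2) (K j) (rep j h)" by (rule expanding_on_perturb)
      then show ?thesis by simp
    qed
    have cc: "0 < cc j / 2" if "j \<in> J" for j using J(2)[OF that] by (simp add: Q_def)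
    have LK: "L j \<subseteq> K j" if "j \<in> J" for j using LS[OF J(2)[OF that]] sub(2)[of j] by blast
    have close: "norm (rep j h a - rep j f a) < \<delta> j" if "j \<in> J" "a \<in> L j" for j a
      using D(2)[OF that(1)] LK[OF that(1)] that(2) by blast
    have "embedding_map X Y h"
    proof (rule embedding_map_by_cover[OF _ _ hcont e, where L = "\<lambda>j. \<phi> j ` L j" and U = "\<lambda>j. \<phi> j ` S j"
          and K = "\<lambda>j. \<phi> j ` K j" and A = A and B = B])
      show "Hausdorff_space X" "Hausdorff_space Y"
        using smooth_manifoldD(1)[OF M] smooth_manifoldD(1)[OF N] .
      show "topspace X \<subseteq> (\<Union>j\<in>J. \<phi> j ` L j)" using J(4) sub(1) by blast
      fix j assume j: "j \<in> J"
      show "compactin X (\<phi> j ` L j)" "\<phi> j ` L j \<subseteq> \<phi> j ` S j" "openin X (\<phi> j ` S j)"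
        "\<phi> j ` S j \<subseteq> \<phi> j ` K j" "compactin X (\<phi> j ` K j)"
        using OL[OF j] by auto
      show "openin Y (A j)" "A j \<inter> B j = {}" using AB j by auto
      show "inj_on h (\<phi> j ` K j)"
      proof (rule inj_onI, clarify)
        fix a b assume ab: "a \<in> K j" "b \<in> K j" "h (\<phi> j a) = h (\<phi> j b)"
        then have "rep j h a = rep j h b" by (simp add: rep_def local_rep_def)
        then have "a = b" using expanding_on_inj[OF exp[OF j] cc[OF j]] ab by (meson inj_onD)
        then show "\<phi> j a = \<phi> j b" by simp
      qed
      show "h ` \<phi> j ` L j \<subseteq> A j"
      proof clarify
        fix a assume a: "a \<in> L j"
        then have aK: "a \<in> K j" using LK[OF j] by blast
        have "\<psi> j (rep j h a) \<in> A j"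
          by (rule \<delta>A(2)[OF j a hV(1)[OF j aK]]) (use close[OF j a] \<delta>(3)[OF j] in linarith)
        then show "h (\<phi> j a) \<in> A j" using hV(2)[OF j aK] by simp
      qed
    next
      fix i j assume i: "i \<in> J" and j: "j \<in> J" and ij: "e i < e j"
      show "h ` (\<phi> j ` L j - \<phi> i ` S i) \<subseteq> B i"
      proof clarify
        fix a assume a: "a \<in> L j" "\<phi> j a \<notin> \<phi> i ` S i"
        then have aK: "a \<in> K j" using LK[OF j] by blast
        have "\<psi> j (rep j h a) \<in> B i"
          by (rule \<delta>B(2)[OF i j a hV(1)[OF j aK]]) (use close[OF j a(1)] \<delta>(4)[OF j i ij] in linarith)
        then show "h (\<phi> j a) \<in> B i" using hV(2)[OF j aK] by simp
      qed
    qed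
    moreover have "0 < (INF A\<in>clarke_derivative U' (local_rep \<phi>' V' \<psi>' h) x. ereal (singular_value CARD('m) A))"
      if c: "(U', \<phi>') \<in> \<A>" "(V', \<psi>') \<in> \<B>" "(\<lambda>x. h (\<phi>' x)) ` U' \<subseteq> \<psi>' ` V'" "x \<in> U'" for U' \<phi>' V' \<psi>' x
    proof -
      have "\<phi>' x \<in> topspace X" using topological_chartD(7)[OF smooth_manifoldD(3)[OF M c(1)]] c(4) by blast
      \<comment> \<open>The charts in the definition of \<open>Imm\<close> are arbitrary; the
        estimate is transported to them from the half-ball of the cover that contains the given
        point.\<close>
      then obtain j y where j: "j \<in> J" "y \<in> S' j" "\<phi>' x = \<phi> j y" using J(4) by blast
      have yS: "y \<in> S j" using j(2) sub(1)[of j] LS[OF J(2)[OF j(1)]] by blast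
      have hS: "(\<lambda>x. h (\<phi> j x)) ` S j \<subseteq> \<psi> j ` V j"
        using D(1)[OF j(1)] sub(2)[of j] by blast
      have "expanding_on (cc j / 2) (S j) (local_rep (\<phi> j) (V j) (\<psi> j) h)"
        using expanding_on_subset[OF exp[OF j(1)] sub(2)] by (simp add: rep_def)
      then show ?thesis
        by (rule expanding_imp_singular_value_pos[OF M N hcont c(1-4) ch[OF j(1)] oS(1)
              sets(2)[OF J(2)[OF j(1)]] hS yS j(3)[symmetric] cc[OF j(1)]])
    qed
    then have "h \<in> Imm k X \<A> Y \<B>"
      unfolding Imm_def using hC by blast
    ultimately show "h \<in> Emb k X \<A> Y \<B>" by (simp add: Emb_def)
  qed
  ultimately show thesis by (rule that)
qed

theorem propositionA14:
  fixes X :: "'p topology" and \<A> :: "('p, 'm::{finite,linorder}) chart set"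
    and Y :: "'q topology" and \<B> :: "('q, 'n::{finite,linorder}) chart set"
    and k :: nat
  assumes "smooth_manifold X \<A>" and "smooth_manifold Y \<B>"
  shows "openin (strong_topology k X \<A> Y \<B>) (Emb k X \<A> Y \<B>)"
proof (subst openin_subopen, intro ballI)
  fix f assume "f \<in> Emb k X \<A> Y \<B>"
  then obtain \<W> where \<W>: "\<W> \<in> strong_basis k X \<A> Y \<B>" "f \<in> \<W>" "\<W> \<subseteq> Emb k X \<A> Y \<B>"
    using Emb_contains_strong_basis_element[OF assms] by blast
  have "openin (strong_topology k X \<A> Y \<B>) \<W>"
    unfolding strong_topology_def using \<W>(1) by (rule topology_generated_by_Basis)
  then show "\<exists>T. openin (strong_topology k X \<A> Y \<B>) T \<and> f \<in> T \<and> T \<subseteq> Emb k X \<A> Y \<B>"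
    using \<W>(2,3) by blast
qed

end
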